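(* Let $\Gamma\subset\mathrm{PSU}(1,1)$ be a cofinite Fuchsian group and $Q\in A_\infty(\Delta,\Gamma)$. For $w\in\Delta$ put $\gamma_w(z)=\frac{z+w}{1+\bar wz}$, $Q_w=(Q\circ\gamma_w)(\gamma_w')^2$ and define $a_n^w$ by $Q_w(z)=\sum_{n=2}^\infty(n^3-n)a_n^wz^{n-2}$. Then for every integer $j\ge2$, $$\lim_{r'\to1^-}\frac{\mathrm{Area}_H(\Gamma\backslash\Delta)\iint_{\Delta_{r'}}|a_j^w|^2\,dA_H}{\iint_{\Delta_{r'}}dA_H}=\frac{8}{3(j^3-j)}\|Q\|_{WP}^2 .$$
   Context: $\Delta$ is the open unit disc, $\Delta_{r'}=\{|z|<r'\}$. $dA_H=\frac{4\,dx\,dy}{(1-|w|^2)^2}$ ($w=x+iy$) is the hyperbolic area form and $\mathrm{Area}_H(\Gamma\backslash\Delta)$ the hyperbolic area of the quotient; $\Gamma$ is cofinite if this area is finite. $A_\infty(\Delta,\Gamma)$ is the space of holomorphic $Q$ on $\Delta$ with $\sup_{z\in\Delta}|Q(z)(1-|z|^2)^2|<\infty$ and $(Q\circ\gamma)(\gamma')^2=Q$ for all $\gamma\in\Gamma$. The Weil–Petersson norm is $\|Q\|_{WP}^2=\frac14\iint_{\Gamma\backslash\Delta}|Q(w)|^2(1-|w|^2)^2\,dx\,dy$. *)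

theory Defs
  imports "HOL-Analysis.Analysis" "HOL-Algebra.Coset"
begin

section \<open>The group PSU(1,1) and its action on the unit disc\<close>

abbreviation unit_disc :: "complex set" where
  "unit_disc \<equiv> ball 0 1"

definition SU11 :: "(complex^2^2) monoid" where
  "SU11 = \<lparr>carrier = {A. A $ 2 $ 1 = cnj (A $ 1 $ 2) \<and> A $ 2 $ 2 = cnj (A $ 1 $ 1) \<and> det A = 1},
           mult = (**), one = mat 1\<rparr>"

text \<open>The elements of \<open>PSU11\<close> are the cosets \<open>{A, - A}\<close>.\<close>

definition PSU11 :: "(complex^2^2) set monoid" where
  "PSU11 = SU11 Mod {mat 1, - mat 1}"

text \<open>The quotient topology: \<open>\<Union>U\<close> is the preimage of \<open>U\<close> under the projection from
  \<open>SU11\<close> to \<open>PSU11\<close>.\<close>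

definition PSU11_topology :: "(complex^2^2) set topology" where
  "PSU11_topology =
     topology (\<lambda>U. U \<subseteq> carrier PSU11 \<and> openin (top_of_set (carrier SU11)) (\<Union>U))"

definition fuchsian :: "(complex^2^2) set set \<Rightarrow> bool" where
  "fuchsian \<Gamma> \<longleftrightarrow> subgroup \<Gamma> PSU11 \<and> subtopology PSU11_topology \<Gamma> = discrete_topology \<Gamma>"

definition mobius :: "complex^2^2 \<Rightarrow> complex \<Rightarrow> complex" where
  "mobius A z = (A $ 1 $ 1 * z + A $ 1 $ 2) / (A $ 2 $ 1 * z + A $ 2 $ 2)"

text \<open>The two representatives of a coset induce the same map, see \<open>psu_map_coset\<close> below.\<close>

definition psu_map :: "(complex^2^2) set \<Rightarrow> complex \<Rightarrow> complex" where
  "psu_map g = mobius (SOME A. A \<in> g)"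

lemma minus_mat_mult: "- mat 1 ** A = - (A :: complex^2^2)"
  by (simp add: matrix_matrix_mult_def vec_eq_iff forall_2 sum_2 mat_def)

lemma mult_minus_mat: "A ** - mat 1 = - (A :: complex^2^2)"
  by (simp add: matrix_matrix_mult_def vec_eq_iff forall_2 sum_2 mat_def)

lemma group_SU11: "group SU11"
proof (rule groupI)
  fix A assume A: "A \<in> carrier SU11"
  define B :: "complex^2^2" where
    "B = vector [vector [A $ 2 $ 2, - A $ 1 $ 2], vector [- A $ 2 $ 1, A $ 1 $ 1]]"
  have "B \<in> carrier SU11" "B ** A = mat 1"
    using A by (auto simp: SU11_def B_def det_2 matrix_matrix_mult_def vec_eq_iff forall_2
                           sum_2 mat_def algebra_simps)
  thus "\<exists>B\<in>carrier SU11. B \<otimes>\<^bsub>SU11\<^esub> A = \<one>\<^bsub>SU11\<^esub>"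
    by (auto simp: SU11_def)
next
  fix A B assume "A \<in> carrier SU11" "B \<in> carrier SU11"
  then show "A \<otimes>\<^bsub>SU11\<^esub> B \<in> carrier SU11"
    by (simp add: SU11_def det_mul) (simp add: matrix_matrix_mult_def sum_2 algebra_simps)
qed (auto simp: SU11_def matrix_mul_assoc, auto simp: mat_def)

lemma normal_pm_one: "{mat 1, - mat 1} \<lhd> SU11"
proof -
  interpret group SU11 by (rule group_SU11)
  have in_SU: "mat 1 \<in> carrier SU11" "- mat 1 \<in> carrier SU11"
    by (auto simp: SU11_def det_2 mat_def)
  have sub: "subgroup {mat 1, - mat 1} SU11"
  proof (rule subgroupI)
    fix A assume "A \<in> {mat 1, - mat 1 :: complex^2^2}"
    then have "A \<in> carrier SU11" "A \<otimes>\<^bsub>SU11\<^esub> A = \<one>\<^bsub>SU11\<^esub>"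
      using in_SU by (auto simp: SU11_def minus_mat_mult)
    then have "inv\<^bsub>SU11\<^esub> A = A"
      by (simp add: inv_equality)
    with \<open>A \<in> {mat 1, - mat 1}\<close> show "inv\<^bsub>SU11\<^esub> A \<in> {mat 1, - mat 1}" by simp
  qed (use in_SU in \<open>auto simp: SU11_def minus_mat_mult\<close>)
  show ?thesis
    by (rule normalI[OF sub])
       (auto simp: SU11_def r_coset_def l_coset_def minus_mat_mult mult_minus_mat)
qed

lemma group_PSU11: "group PSU11"
  unfolding PSU11_def by (rule normal.factorgroup_is_group[OF normal_pm_one])

lemma carrier_PSU11: "carrier PSU11 = (\<lambda>A. {A, - A}) ` carrier SU11"
  by (auto simp: PSU11_def FactGroup_def RCOSETS_def r_coset_def SU11_def minus_mat_mult)

lemma psu_map_coset: "psu_map {A, - A} = mobius A"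
proof -
  have "mobius (- A) = mobius A"
  proof
    fix z
    have "mobius (- A) z = (- (A $ 1 $ 1 * z + A $ 1 $ 2)) / (- (A $ 2 $ 1 * z + A $ 2 $ 2))"
      by (simp add: mobius_def)
    thus "mobius (- A) z = mobius A z"
      by (simp add: mobius_def minus_divide_left [symmetric] minus_divide_right [symmetric] del: minus_add_distrib)
  qed
  moreover have "(SOME B. B \<in> {A, - A}) \<in> {A, - A}"
    by (rule someI[of _ A]) simp
  ultimately show ?thesis
    unfolding psu_map_def by auto
qed

lemma openin_PSU11_topology:
  "openin PSU11_topology U \<longleftrightarrow>
     U \<subseteq> carrier PSU11 \<and> openin (top_of_set (carrier SU11)) (\<Union>U)"
proof -
  have "istopology (\<lambda>U. U \<subseteq> carrier PSU11 \<and> openin (top_of_set (carrier SU11)) (\<Union>U))"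
    unfolding istopology_def
  proof (intro conjI allI impI)
    fix S T
    assume S: "S \<subseteq> carrier PSU11 \<and> openin (top_of_set (carrier SU11)) (\<Union>S)"
      and T: "T \<subseteq> carrier PSU11 \<and> openin (top_of_set (carrier SU11)) (\<Union>T)"
    have "\<Union>(S \<inter> T) = \<Union>S \<inter> \<Union>T"
    proof (intro equalityI subsetI)
      fix A assume "A \<in> \<Union>S \<inter> \<Union>T"
      then obtain g h where gh: "g \<in> S" "h \<in> T" "A \<in> g" "A \<in> h" by auto
      with S T have "g \<in> carrier PSU11" "h \<in> carrier PSU11" by auto
      with gh have "g = {A, - A}" "h = {A, - A}" by (auto simp: carrier_PSU11)
      with gh show "A \<in> \<Union>(S \<inter> T)" by auto
    qed auto
    with S T show "openin (top_of_set (carrier SU11)) (\<Union>(S \<inter> T))"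
      by (metis openin_Int)
  next
    fix K
    assume "\<forall>S\<in>K. S \<subseteq> carrier PSU11 \<and> openin (top_of_set (carrier SU11)) (\<Union>S)"
    then have "openin (top_of_set (carrier SU11)) (\<Union>(Union ` K))"
      by (intro openin_Union) auto
    moreover have "\<Union>(Union ` K) = \<Union>(\<Union>K)" by auto
    ultimately show "openin (top_of_set (carrier SU11)) (\<Union>(\<Union>K))" by simp
  qed auto
  thus ?thesis
    by (simp add: PSU11_topology_def topology_inverse')
qed


section \<open>Hyperbolic area and integration over the quotient\<close>

definition hyp_area :: "complex measure" where
  "hyp_area = density lborel (\<lambda>w. indicator unit_disc w * ennreal (4 / (1 - (cmod w)\<^sup>2)\<^sup>2))"

definition fundamental_set :: "(complex^2^2) set set \<Rightarrow> complex set \<Rightarrow> bool" where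
  "fundamental_set \<Gamma> F \<longleftrightarrow> F \<in> sets borel \<and> F \<subseteq> unit_disc \<and>
     (\<forall>z\<in>unit_disc. \<exists>!w. w \<in> F \<and> (\<exists>g\<in>\<Gamma>. w = psu_map g z))"

text \<open>
  Integrals of \<open>\<Gamma>\<close>-invariant densities over the quotient of the disc by \<open>\<Gamma>\<close> are taken over a
  Borel set of orbit representatives.  For a Fuchsian group such a set exists: orbits are locally
  finite, so one may choose in each orbit the point with the least \<open>(cmod w, Arg w)\<close> in the
  lexicographic order.  Since \<open>\<Gamma>\<close> is countable and acts by isometries of the hyperbolic metric,
  the area and the integrals do not depend on the choice.
\<close>

definition quotient_set :: "(complex^2^2) set set \<Rightarrow> complex set" where
  "quotient_set \<Gamma> = (SOME F. fundamental_set \<Gamma> F)"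

definition quotient_area :: "(complex^2^2) set set \<Rightarrow> ennreal" where
  "quotient_area \<Gamma> = emeasure hyp_area (quotient_set \<Gamma>)"

definition cofinite_fuchsian :: "(complex^2^2) set set \<Rightarrow> bool" where
  "cofinite_fuchsian \<Gamma> \<longleftrightarrow> fuchsian \<Gamma> \<and> quotient_area \<Gamma> < \<infinity>"


section \<open>Quadratic differentials\<close>

definition A_inf :: "(complex^2^2) set set \<Rightarrow> (complex \<Rightarrow> complex) set" where
  "A_inf \<Gamma> = {Q. Q holomorphic_on unit_disc \<and>
      bdd_above ((\<lambda>z. cmod (Q z * (1 - (cmod z)\<^sup>2)\<^sup>2)) ` unit_disc) \<and>
      (\<forall>g\<in>\<Gamma>. \<forall>z\<in>unit_disc. Q (psu_map g z) * (deriv (psu_map g) z)\<^sup>2 = Q z)}"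

definition WP_norm :: "(complex^2^2) set set \<Rightarrow> (complex \<Rightarrow> complex) \<Rightarrow> real" where
  "WP_norm \<Gamma> Q =
     sqrt (1/4 * (LINT w:quotient_set \<Gamma>|lborel. (cmod (Q w))\<^sup>2 * (1 - (cmod w)\<^sup>2)\<^sup>2))"

definition disc_translation :: "complex \<Rightarrow> complex \<Rightarrow> complex" where
  "disc_translation w z = (z + w) / (1 + cnj w * z)"

definition pullback :: "(complex \<Rightarrow> complex) \<Rightarrow> complex \<Rightarrow> complex \<Rightarrow> complex" where
  "pullback Q w z = Q (disc_translation w z) * (deriv (disc_translation w) z)\<^sup>2"

end

theory Submission
  imports Defs "HOL-Probability.Probability" "HOL-Complex_Analysis.Great_Picard" "HOL-Real_Asymp.Real_Asymp"
begin

text \<open>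
  Put \<open>f w = |Q w|\<^sup>2 (1 - |w|\<^sup>2)\<^sup>4\<close>, which is \<open>\<Gamma>\<close>-invariant and bounded, and write \<open>q\<^sub>m(w)\<close> for the
  Taylor coefficients of \<open>Q\<^sub>w\<close>. Parseval's identity says that the mean of \<open>f\<close> over the hyperbolic circle
  with centre \<open>w\<close> and Euclidean radius \<open>\<rho>\<close> (as seen from \<open>w\<close>) is \<open>(1 - \<rho>\<^sup>2)\<^sup>4 \<Sum>|q\<^sub>m(w)|\<^sup>2 \<rho>\<^sup>2\<^sup>m\<close>. If the mean of
  \<open>f\<close> over large discs tends to its mean \<open>m(f)\<close> over the quotient by \<open>\<Gamma>\<close>, then, radial averages commuting, so does the
  disc mean of each circle mean, and comparing coefficients with \<open>(1 - x)\<close> to the power \<open>-4\<close>, whose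
  \<open>m\<close>-th coefficient is the binomial coefficient of \<open>m + 3\<close> over \<open>3\<close>, yields the limit of the disc
  mean of \<open>|q\<^sub>m|\<^sup>2\<close>.

  Equidistribution needs no spectral theory. The averages \<open>W\<^sub>a\<close> of \<open>f\<close> (smoothed) over circles of radius
  \<open>r\<close> with \<open>1 - r\<^sup>2 = e\<^sup>-\<^sup>a\<close> are commuting self-adjoint operators on the quotient, and since
  \<open>1 - |T\<^sub>r(su)|\<^sup>2 = (1 - r\<^sup>2)(1 - s\<^sup>2)/|1 + rsu|\<^sup>2\<close> for the translation \<open>T\<^sub>r\<close>, the inner product of \<open>W\<^sub>a\<close> and
  \<open>W\<^sub>b\<close> depends asymptotically on \<open>a + b\<close> only. Positivity of \<open>\<parallel>W\<^sub>a - W\<^sub>b\<parallel>\<^sup>2\<close> makes this bounded function of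
  \<open>a + b\<close> almost midpoint convex, so it varies slowly, and \<open>W\<^sub>a - W\<^sub>b\<close> tends to \<open>0\<close> in the mean while \<open>a - b\<close>
  stays bounded. Hence every limit point of \<open>W\<^sub>a\<close> has the mean value property; by the equality case of
  Jensen's inequality on a quotient of finite area it is constant, equal to \<open>m(f)\<close>.
\<close>

section \<open>Moebius transformations of the disc\<close>

text \<open>Smoothing is what makes the averaging operators tractable. A circle carries no area, so
  circle averages have no kernel against the area form; preceded by a disc average they do, which
  gives self-adjointness by unfolding, and equicontinuity, hence pointwise limits along
  subsequences. The smoothing is removed at the end because f varies uniformly slowly in the
  hyperbolic metric. The obstacle is that the quotient may have cusps: it need not be compact, so
  limits over it rest on dominated convergence, for which boundedness and finite area suffice. Slow
  variation comes from persistence: for a bounded almost convex function an increment of fixed size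
  would reappear over many consecutive steps. Origin of the constant: the integral of f over the
  quotient is 16 times the squared norm, with a factor 4 from the area form and another from the 1/4
  in the norm. With m = j - 2 the binomial coefficient is (j^3 - j)/6, and the Taylor coefficient is
  (j^3 - j) a_j, which leaves 16 / (6 (j^3 - j)).\<close>

definition mob :: "complex \<Rightarrow> complex \<Rightarrow> complex \<Rightarrow> complex" where
  "mob a b z = (a * z + b) / (cnj b * z + cnj a)"

text \<open>\<open>mob\<close> is not normalised to determinant one; only
  \<open>cmod b < cmod a\<close> is asked for, so translations occur with a = 1 and without square
  roots.\<close>

lemma disc_translation_eq_mob: "disc_translation w = mob 1 w"
  by (auto simp: disc_translation_def mob_def fun_eq_iff add.commute)

lemma norm_le_disc:
  assumes "cmod z < 1"
  shows "cmod (b * z) \<le> cmod b"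
  using assms by (simp add: norm_mult mult_left_le)

lemma mob_denom_nz:
  assumes "cmod b < cmod a" "cmod z < 1"
  shows "cnj b * z + cnj a \<noteq> 0"
proof
  assume "cnj b * z + cnj a = 0"
  hence "cmod (cnj b * z) = cmod (cnj a)"
    by (metis add_eq_0_iff norm_minus_cancel)
  with norm_le_disc[OF assms(2), of "cnj b"] assms(1) show False by simp
qed

text \<open>The matrix of \<open>mob a b\<close> preserves the Hermitian form |z2|^2 - |z1|^2 up to
  its determinant |a|^2 - |b|^2; this is that invariance at the vector (z, 1).\<close>

lemma mob_norm_identity:
  "(cmod (cnj b * z + cnj a))\<^sup>2 - (cmod (a * z + b))\<^sup>2
     = ((cmod a)\<^sup>2 - (cmod b)\<^sup>2) * (1 - (cmod z)\<^sup>2)"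
proof -
  have "complex_of_real ((cmod (cnj b * z + cnj a))\<^sup>2 - (cmod (a * z + b))\<^sup>2)
      = complex_of_real (((cmod a)\<^sup>2 - (cmod b)\<^sup>2) * (1 - (cmod z)\<^sup>2))"
    unfolding of_real_diff of_real_mult of_real_1 complex_norm_square by (simp add: algebra_simps)
  thus ?thesis using of_real_eq_iff by blast
qed

lemma one_minus_mob:
  assumes "cmod b < cmod a" "cmod z < 1"
  shows "1 - (cmod (mob a b z))\<^sup>2
    = ((cmod a)\<^sup>2 - (cmod b)\<^sup>2) * (1 - (cmod z)\<^sup>2) / (cmod (cnj b * z + cnj a))\<^sup>2"
proof -
  have "cmod (cnj b * z + cnj a) \<noteq> 0" using mob_denom_nz[OF assms] by simp
  thus ?thesis
    unfolding mob_norm_identity[symmetric] mob_def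
    by (simp add: norm_divide power_divide diff_divide_distrib)
qed

lemma mob_in_disc:
  assumes "cmod b < cmod a" "cmod z < 1"
  shows "cmod (mob a b z) < 1"
proof -
  have "(cmod b)\<^sup>2 < (cmod a)\<^sup>2" "(cmod z)\<^sup>2 < 1"
    using assms by (auto simp: abs_square_less_1 power_strict_mono)
  moreover have "cmod (cnj b * z + cnj a) > 0" using mob_denom_nz[OF assms] by simp
  ultimately have "1 - (cmod (mob a b z))\<^sup>2 > 0"
    unfolding one_minus_mob[OF assms] by (intro divide_pos_pos mult_pos_pos) auto
  thus ?thesis by (simp add: abs_square_less_1)
qed

lemma mob_inverse:
  assumes "cmod b < cmod a" "cmod z < 1"
  shows "mob (cnj a) (- b) (mob a b z) = z"
proof -
  let ?d = "cnj b * z + cnj a"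
  have d: "?d \<noteq> 0" using mob_denom_nz[OF assms] .
  have n: "a * cnj a - b * cnj b \<noteq> 0"
  proof
    assume "a * cnj a - b * cnj b = 0"
    hence "complex_of_real ((cmod a)\<^sup>2) = of_real ((cmod b)\<^sup>2)"
      unfolding complex_norm_square by simp
    hence "(cmod a)\<^sup>2 = (cmod b)\<^sup>2" using of_real_eq_iff by blast
    with assms(1) show False by (simp add: power2_eq_iff)
  qed
  have "mob (cnj a) (- b) (mob a b z) =
    ((cnj a * (a * z + b) - b * ?d) / ?d) / ((- cnj b * (a * z + b) + a * ?d) / ?d)"
    unfolding mob_def using d by (simp add: field_simps)
  also have "\<dots> = (cnj a * (a * z + b) - b * ?d) / (- cnj b * (a * z + b) + a * ?d)"
    using d by simp
  also have "cnj a * (a * z + b) - b * ?d = (a * cnj a - b * cnj b) * z"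
    by (simp add: algebra_simps)
  also have "- cnj b * (a * z + b) + a * ?d = a * cnj a - b * cnj b"
    by (simp add: algebra_simps)
  finally show ?thesis using n by simp
qed

text \<open>\<open>mob a b\<close> after the translation by w, and the translation by the image of
  w, send 0 to the same point. As automorphisms of the disc they differ by a rotation about 0, which
  radially symmetric averages do not see.\<close>

lemma mob_disc_translation:
  assumes "cmod b < cmod a" "cmod w < 1" "cmod z < 1"
  shows "mob a b (disc_translation w z)
     = disc_translation (mob a b w) ((a + b * cnj w) / (cnj a + cnj b * w) * z)"
    and "cmod ((a + b * cnj w) / (cnj a + cnj b * w)) = 1"
proof -
  let ?D = "cnj b * w + cnj a"
  have d: "?D \<noteq> 0" using mob_denom_nz[OF assms(1,2)] .
  have d': "cnj ?D \<noteq> 0" using d complex_cnj_zero_iff by blast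
  hence d'': "b * cnj w + a \<noteq> 0"
    unfolding complex_cnj_add complex_cnj_mult complex_cnj_cnj .
  have d1: "cnj w * z + 1 \<noteq> 0" using mob_denom_nz[of w 1 z] assms by simp
  have "cmod (disc_translation w z) < 1"
    unfolding disc_translation_eq_mob using assms by (intro mob_in_disc) auto
  hence d2: "cnj b * disc_translation w z + cnj a \<noteq> 0" using mob_denom_nz[OF assms(1)] by blast
  have L: "mob a b (disc_translation w z) = (a * (z + w) + b * (1 + cnj w * z)) / (cnj b * (z + w) + cnj a * (1 + cnj w * z))"
  proof -
    have "mob a b (disc_translation w z) = ((a * (z + w) + b * (1 + cnj w * z)) / (1 + cnj w * z)) / ((cnj b * (z + w) + cnj a * (1 + cnj w * z)) / (1 + cnj w * z))"
      unfolding mob_def disc_translation_def using d1 by (simp add: field_simps)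
    thus ?thesis using d1 by (simp add: add.commute)
  qed
  have R: "disc_translation (mob a b w) ((a + b * cnj w) / (cnj a + cnj b * w) * z)
      = (((a + b * cnj w) * z + (a * w + b)) / ?D) / ((?D + (cnj a * cnj w + cnj b) * z) / ?D)"
  proof -
    have "cnj (mob a b w) * ((a + b * cnj w) / (cnj a + cnj b * w) * z)
        = (cnj a * cnj w + cnj b) * z / ?D"
      using d'' by (simp add: mob_def add.commute)
    hence "1 + cnj (mob a b w) * ((a + b * cnj w) / (cnj a + cnj b * w) * z)
        = (?D + (cnj a * cnj w + cnj b) * z) / ?D"
      using d by (simp add: add_divide_distrib)
    moreover have "(a + b * cnj w) / (cnj a + cnj b * w) * z + mob a b w = ((a + b * cnj w) * z + (a * w + b)) / ?D"
      by (simp only: mob_def add_divide_distrib[of "(a + b * cnj w) * z" _ ?D] times_divide_eq_left add.commute[of "cnj a"])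
    ultimately show ?thesis unfolding disc_translation_def by simp
  qed
  show "mob a b (disc_translation w z)
     = disc_translation (mob a b w) ((a + b * cnj w) / (cnj a + cnj b * w) * z)"
  proof -
    have "x / ?D / (y / ?D) = x / y" for x y using d by simp
    thus ?thesis unfolding L R by (simp only:) (simp add: algebra_simps)
  qed
  have "cmod (a + b * cnj w) = cmod (cnj ?D)" by (simp add: add.commute)
  hence "cmod (a + b * cnj w) = cmod ?D" by (simp only: complex_mod_cnj)
  thus "cmod ((a + b * cnj w) / (cnj a + cnj b * w)) = 1"
    using d by (simp add: norm_divide add.commute)
qed

lemma disc_translation_in_disc:
  "cmod w < 1 \<Longrightarrow> cmod z < 1 \<Longrightarrow> cmod (disc_translation w z) < 1"
  unfolding disc_translation_eq_mob by (intro mob_in_disc) auto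

lemma one_minus_disc_translation:
  "cmod w < 1 \<Longrightarrow> cmod z < 1 \<Longrightarrow> 1 - (cmod (disc_translation w z))\<^sup>2
     = (1 - (cmod w)\<^sup>2) * (1 - (cmod z)\<^sup>2) / (cmod (1 + cnj w * z))\<^sup>2"
  unfolding disc_translation_eq_mob using one_minus_mob[of w 1 z] by (simp add: add.commute)

lemma disc_translation_denom_nz: "cmod w < 1 \<Longrightarrow> cmod z < 1 \<Longrightarrow> 1 + cnj w * z \<noteq> 0"
  using mob_denom_nz[of w 1 z] by (simp add: add.commute)

lemma disc_translation_inverse:
  "cmod w < 1 \<Longrightarrow> cmod z < 1 \<Longrightarrow> disc_translation (- w) (disc_translation w z) = z"
  unfolding disc_translation_eq_mob using mob_inverse[of w 1 z] by simp

lemma disc_translation_inverse':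
  "cmod w < 1 \<Longrightarrow> cmod z < 1 \<Longrightarrow> disc_translation w (disc_translation (- w) z) = z"
  using disc_translation_inverse[of "-w" z] by simp

lemma disc_translation_0 [simp]: "disc_translation w 0 = w" "disc_translation 0 z = z"
  by (auto simp: disc_translation_def)

lemma disc_translation_rotate:
  assumes "cmod c = 1"
  shows "disc_translation (c * w) (c * z) = c * disc_translation w z"
proof -
  have "c * cnj c = 1" using assms by (simp flip: complex_norm_square)
  hence "cnj (c * w) * (c * z) = cnj w * z"
    by (simp add: mult_ac)
  thus ?thesis by (simp add: disc_translation_def distrib_left)
qed

text \<open>The first equation lets two radial averages be interchanged; the second is the symmetry
  of the hyperbolic distance d, since \<open>cmod (disc_translation (- w) z)\<close> is tanh
  (d/2).\<close>

lemma cmod_disc_translation_sym: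
  shows "cmod (disc_translation w z) = cmod (disc_translation z w)"
    and "cmod (disc_translation (- w) z) = cmod (disc_translation (- z) w)"
proof -
  have *: "cmod (disc_translation w z) = cmod (disc_translation z w)" for w z
  proof -
    have "cmod (1 + cnj w * z) = cmod (cnj (1 + cnj w * z))" by (simp only: complex_mod_cnj)
    also have "\<dots> = cmod (1 + cnj z * w)" by (simp add: mult.commute)
    finally show ?thesis by (simp add: disc_translation_def norm_divide add.commute)
  qed
  show "cmod (disc_translation w z) = cmod (disc_translation z w)" by (rule *)
  have "disc_translation (- z) w = - disc_translation z (- w)"
    using disc_translation_rotate[of "-1" z "-w"] by simp
  thus "cmod (disc_translation (- w) z) = cmod (disc_translation (- z) w)"
    using *[of "-w" z] by simp
qed

text \<open>Once z is written as the translate of y by w, the automorphism merely rotates y, which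
  keeps the distance from the base point.\<close>

lemma cmod_disc_translation_mob:
  assumes "cmod b < cmod a" "cmod w < 1" "cmod z < 1"
  shows "cmod (disc_translation (- mob a b w) (mob a b z)) = cmod (disc_translation (- w) z)"
proof -
  define y where "y = disc_translation (- w) z"
  have y: "cmod y < 1" "z = disc_translation w y"
    unfolding y_def using assms by (auto intro!: disc_translation_in_disc simp: disc_translation_inverse')
  define c where "c = (a + b * cnj w) / (cnj a + cnj b * w)"
  have c: "cmod c = 1" unfolding c_def by (rule mob_disc_translation(2)[OF assms(1,2) y(1)])
  have "mob a b z = disc_translation (mob a b w) (c * y)"
    unfolding y(2) c_def by (rule mob_disc_translation[OF assms(1,2) y(1)])
  moreover have "cmod (c * y) < 1" using c y by (simp add: norm_mult)
  ultimately have "disc_translation (- mob a b w) (mob a b z) = c * y"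
    using disc_translation_inverse mob_in_disc[OF assms(1,2)] by simp
  thus ?thesis using c by (simp add: norm_mult y_def)
qed

lemma borel_measurable_cnj [measurable (raw)]:
  "f \<in> borel_measurable M \<Longrightarrow> (\<lambda>x. cnj (f x)) \<in> borel_measurable M"
  by (rule borel_measurable_continuous_on[of cnj]) (auto intro: continuous_intros)

lemma mob_measurable [measurable]: "mob a b \<in> borel_measurable borel"
  unfolding mob_def[abs_def] by measurable

lemma disc_translation_measurable [measurable (raw)]:
  assumes [measurable]: "f \<in> borel_measurable M" "g \<in> borel_measurable M"
  shows "(\<lambda>x. disc_translation (f x) (g x)) \<in> borel_measurable M"
  unfolding disc_translation_def by measurable

lemma mob_has_field_derivative:
  assumes "cnj b * z + cnj a \<noteq> 0"
  shows "(mob a b has_field_derivative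
     of_real ((cmod a)\<^sup>2 - (cmod b)\<^sup>2) / (cnj b * z + cnj a)\<^sup>2) (at z)"
proof -
  have "((\<lambda>z. (a * z + b) / (cnj b * z + cnj a)) has_field_derivative
     (a * (cnj b * z + cnj a) - (a * z + b) * cnj b) / ((cnj b * z + cnj a) * (cnj b * z + cnj a))) (at z)"
    by (rule derivative_eq_intros refl assms | simp)+
  moreover have "a * (cnj b * z + cnj a) - (a * z + b) * cnj b = of_real ((cmod a)\<^sup>2 - (cmod b)\<^sup>2)"
    unfolding of_real_diff complex_norm_square by (simp add: algebra_simps)
  ultimately show ?thesis unfolding mob_def[abs_def] by (simp add: power2_eq_square)
qed

section \<open>Invariance of the hyperbolic area\<close>

abbreviation hyp_dens :: "complex \<Rightarrow> real" where
  "hyp_dens w \<equiv> 4 / (1 - (cmod w)\<^sup>2)\<^sup>2"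

lemma sets_hyp_area [simp, measurable_cong]: "sets hyp_area = sets borel"
  by (simp add: hyp_area_def)

lemma space_hyp_area [simp]: "space hyp_area = UNIV"
  by (simp add: hyp_area_def)

lemma hyp_dens_measurable [measurable]: "hyp_dens \<in> borel_measurable borel"
  by measurable

lemma emeasure_hyp_area:
  "E \<in> sets borel \<Longrightarrow>
    emeasure hyp_area E = (\<integral>\<^sup>+w. indicator (E \<inter> unit_disc) w * ennreal (hyp_dens w) \<partial>lborel)"
  unfolding hyp_area_def
  by (subst emeasure_density) (auto intro!: nn_integral_cong simp: indicator_def)

lemma AE_hyp_area_disc: "AE z in hyp_area. cmod z < 1"
  unfolding hyp_area_def by (subst AE_density) (auto simp: indicator_def)

lemma sigma_finite_hyp_area: "sigma_finite_measure hyp_area"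
  unfolding hyp_area_def
  by (subst sigma_finite_measure.sigma_finite_iff_density_finite[OF sigma_finite_lborel]) (auto simp: ennreal_mult_less_top indicator_def)

section \<open>Change of variables for the hyperbolic area\<close>

definition vec_complex :: "real^2 \<Rightarrow> complex" where
  "vec_complex v = Complex (v $ 1) (v $ 2)"

definition complex_vec :: "complex \<Rightarrow> real^2" where
  "complex_vec z = vector [Re z, Im z]"

lemma vec_complex_inverse [simp]: "complex_vec (vec_complex v) = v" "vec_complex (complex_vec z) = z"
  by (auto simp: vec_complex_def complex_vec_def vec_eq_iff forall_2 complex_eq_iff)

lemma linear_vec_complex: "linear vec_complex" "linear complex_vec"
  by (auto intro!: linearI simp: vec_complex_def complex_vec_def complex_eq_iff vec_eq_iff forall_2)

lemma vec_complex_measurable [measurable]: "vec_complex \<in> borel_measurable borel"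
  "complex_vec \<in> borel_measurable borel"
  by (auto intro!: borel_measurable_continuous_onI linear_continuous_on simp: linear_conv_bounded_linear[symmetric] linear_vec_complex)

lemma lborel_vec_complex: "lborel = distr lborel borel vec_complex"
proof (rule lborel_eqI)
  fix l u :: complex assume "\<And>b. b \<in> Basis \<Longrightarrow> l \<bullet> b \<le> u \<bullet> b"
  from this[of 1] this[of \<i>] have lu: "Re l \<le> Re u" "Im l \<le> Im u"
    by (auto simp: Basis_complex_def inner_complex_def)
  have "vec_complex -` box l u = box (complex_vec l) (complex_vec u)"
    by (auto simp: box_def Basis_complex_def inner_complex_def vec_complex_def complex_vec_def Basis_vec_def inner_axis forall_2)
  hence "emeasure (distr lborel borel vec_complex) (box l u) = emeasure lborel (box (complex_vec l) (complex_vec u))"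
    by (simp add: emeasure_distr)
  also have "\<dots> = (\<Prod>b\<in>Basis. (complex_vec u - complex_vec l) \<bullet> b)"
  proof (rule emeasure_lborel_box)
    have "\<forall>i. complex_vec l $ i \<le> complex_vec u $ i" using lu by (simp add: forall_2 complex_vec_def)
    thus "complex_vec l \<bullet> b \<le> complex_vec u \<bullet> b" if "b \<in> Basis" for b
      using that by (auto simp: Basis_vec_def inner_axis)
  qed
  also have "(\<Prod>b\<in>Basis. (complex_vec u - complex_vec l) \<bullet> b) = (Re u - Re l) * (Im u - Im l)"
  proof -
    have B: "(Basis :: (real^2) set) = {axis 1 1, axis 2 1}"
      by (simp add: Basis_vec_def UNIV_2 insert_commute)
    have "axis 1 1 \<noteq> (axis 2 1 :: real^2)" by (simp add: axis_eq_axis)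
    thus ?thesis unfolding B by (simp add: inner_axis complex_vec_def)
  qed
  also have "\<dots> = (\<Prod>b\<in>Basis. (u - l) \<bullet> b)"
    by (simp add: Basis_complex_def inner_complex_def)
  finally show "emeasure (distr lborel borel vec_complex) (box l u) = (\<Prod>b\<in>Basis. (u - l) \<bullet> b)" .
qed simp

lemma det_matrix_complex_mult:
  "det (matrix (\<lambda>h. complex_vec (d * vec_complex h))) = (cmod d)\<^sup>2"
  unfolding cmod_power2
  by (simp add: det_2 matrix_def complex_vec_def vec_complex_def axis_def power2_eq_square)

lemma emeasure_hyp_area_vec:
  assumes [measurable]: "E \<in> sets borel" and "E \<subseteq> unit_disc"
    and I: "((\<lambda>v. hyp_dens (vec_complex v)) has_integral I) (vec_complex -` E)"
  shows "emeasure hyp_area E = ennreal I"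
proof -
  have "emeasure hyp_area E = (\<integral>\<^sup>+w. indicator E w * ennreal (hyp_dens w) \<partial>distr lborel borel vec_complex)"
    using assms(2) by (subst emeasure_hyp_area) (auto simp: lborel_vec_complex[symmetric] Int_absorb2)
  also have "\<dots> = (\<integral>\<^sup>+v. indicator (vec_complex -` E) v * ennreal (hyp_dens (vec_complex v)) \<partial>lborel)"
    by (subst nn_integral_distr) (auto simp: indicator_def intro!: nn_integral_cong)
  also have "\<dots> = (\<integral>\<^sup>+v\<in>(vec_complex -` E). ennreal (hyp_dens (vec_complex v)) \<partial>lborel)"
    by (simp add: mult.commute)
  also have "\<dots> = ennreal I"
    using nn_integral_has_integral_lebesgue'[OF _ I] by simp
  finally show ?thesis .
qed

text \<open>The Jacobian |g'|^2 turns the density at g z into the density at z, because |g'(z)| (1 -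
  |z|^2) = 1 - |g z|^2. Staying inside a ball of radius r < 1 keeps the density bounded on E, so the
  change of variables theorem for absolutely integrable functions applies.\<close>

lemma emeasure_hyp_area_vimage_mob_ball:
  assumes ab: "cmod b < cmod a" and E [measurable]: "E \<in> sets borel" and "E \<subseteq> ball 0 r" "r < 1"
  shows "emeasure hyp_area (mob a b -` E \<inter> unit_disc) = emeasure hyp_area E"
proof -
  define d where "d z = of_real ((cmod a)\<^sup>2 - (cmod b)\<^sup>2) / (cnj b * z + cnj a)\<^sup>2" for z
  define S where "S = vec_complex -` (mob a b -` E \<inter> unit_disc)"
  define g where "g v = complex_vec (mob a b (vec_complex v))" for v
  define g' where "g' v h = complex_vec (d (vec_complex v) * vec_complex h)" for v h
  \<comment> \<open>The change of variables theorem is stated for vector-valued integrands, hence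
    one component instead of a real number.\<close>
  define f :: "real^2 \<Rightarrow> real^1" where "f v = vec (hyp_dens (vec_complex v))" for v
  have E_disc: "E \<subseteq> unit_disc" using assms by auto
  have [measurable]: "mob a b -` E \<inter> unit_disc \<in> sets borel" "vec_complex -` E \<in> sets borel" "S \<in> sets borel"
    unfolding S_def using measurable_sets_borel[OF mob_measurable E, of a b]
      measurable_sets_borel[OF vec_complex_measurable(1)] E by auto
  have S_leb: "S \<in> sets lebesgue" by simp
  have der: "(g has_derivative g' v) (at v within S)" if "v \<in> S" for v
  proof -
    have "cnj b * vec_complex v + cnj a \<noteq> 0"
      using that mob_denom_nz[OF ab] by (auto simp: S_def)
    hence "(mob a b has_derivative (\<lambda>h. d (vec_complex v) * h)) (at (vec_complex v))"
      using mob_has_field_derivative unfolding d_def has_field_derivative_def by blast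
    moreover have "(vec_complex has_derivative vec_complex) (at v within S)"
      using linear_vec_complex by (auto intro: linear_imp_has_derivative)
    ultimately have "((\<lambda>v. mob a b (vec_complex v)) has_derivative (\<lambda>h. d (vec_complex v) * vec_complex h)) (at v within S)"
      using has_derivative_compose by blast
    moreover have "(complex_vec has_derivative complex_vec) (at z)" for z
      using linear_vec_complex by (auto intro: linear_imp_has_derivative)
    ultimately show ?thesis
      unfolding g_def g'_def using has_derivative_compose by blast
  qed
  have inj: "inj_on g S"
  proof (rule inj_onI)
    fix v v' assume vv: "v \<in> S" "v' \<in> S" and eq: "g v = g v'"
    from eq have "mob a b (vec_complex v) = mob a b (vec_complex v')"
      unfolding g_def by (metis vec_complex_inverse(2))
    hence "vec_complex v = vec_complex v'"
      using vv mob_inverse[OF ab] by (auto simp: S_def) metis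
    thus "v = v'" by (metis vec_complex_inverse(1))
  qed
  have img: "g ` S = vec_complex -` E"
  proof (intro equalityI subsetI)
    fix x assume "x \<in> g ` S" thus "x \<in> vec_complex -` E" by (auto simp: S_def g_def)
  next
    fix v assume "v \<in> vec_complex -` E"
    hence v: "vec_complex v \<in> E" by simp
    define z where "z = mob (cnj a) (- b) (vec_complex v)"
    have v1: "cmod (vec_complex v) < 1" using v E_disc by auto
    have "cmod z < 1" unfolding z_def using ab v1 by (intro mob_in_disc) auto
    moreover have "mob a b z = vec_complex v"
      unfolding z_def using mob_inverse[of "-b" "cnj a"] ab v1 by simp
    ultimately have "complex_vec z \<in> S" "g (complex_vec z) = v" using v by (auto simp: S_def g_def)
    thus "v \<in> g ` S" by blast
  qed
  have bdd: "bounded (vec_complex -` E)"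
  proof -
    have "bounded (complex_vec ` unit_disc)"
      by (rule bounded_linear_image) (simp_all add: linear_conv_bounded_linear[symmetric] linear_vec_complex)
    moreover have "vec_complex -` E \<subseteq> complex_vec ` unit_disc"
      using E_disc by (metis vec_complex_inverse(1) image_eqI subsetD subsetI vimageD)
    ultimately show ?thesis using bounded_subset by blast
  qed
  have lm: "vec_complex -` E \<in> lmeasurable"
    using bdd by (intro bounded_set_imp_lmeasurable) auto
  have absf: "f absolutely_integrable_on (vec_complex -` E)"
    unfolding absolutely_integrable_on_1_iff f_def vec_component
  proof (rule measurable_bounded_by_integrable_imp_absolutely_integrable)
    have "(\<lambda>v. hyp_dens (vec_complex v)) \<in> borel_measurable borel" by measurable
    hence "(\<lambda>v. hyp_dens (vec_complex v)) \<in> borel_measurable lebesgue"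
      by (simp add: measurable_completion)
    thus "(\<lambda>v. hyp_dens (vec_complex v)) \<in> borel_measurable (lebesgue_on (vec_complex -` E))"
      by (rule measurable_restrict_space1)
    \<comment> \<open>Here r may be negative, in which case E is empty; \<open>max r 0\<close> keeps
      the bound meaningful.\<close>
    show "(\<lambda>v::real^2. 4 / (1 - (max r 0)\<^sup>2)\<^sup>2) integrable_on (vec_complex -` E)"
      using lm by (rule integrable_on_const)
    fix v assume "v \<in> vec_complex -` E"
    hence r: "cmod (vec_complex v) < r" using assms by auto
    hence "(cmod (vec_complex v))\<^sup>2 \<le> (max r 0)\<^sup>2" by (intro power_mono) auto
    moreover have "(max r 0)\<^sup>2 < 1" using \<open>r < 1\<close> by (auto simp: abs_square_less_1)
    moreover from calculation have "(cmod (vec_complex v))\<^sup>2 < 1" by linarith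
    ultimately have "(1 - (max r 0)\<^sup>2)\<^sup>2 \<le> (1 - (cmod (vec_complex v))\<^sup>2)\<^sup>2" "0 < (1 - (max r 0)\<^sup>2)\<^sup>2"
      by (intro power_mono zero_less_power; linarith)+
    thus "norm (hyp_dens (vec_complex v)) \<le> 4 / (1 - (max r 0)\<^sup>2)\<^sup>2"
      by (simp add: frac_le)
  qed (use lm in auto)
  define I where "I = integral (vec_complex -` E) f"
  have "(\<lambda>x. \<bar>det (matrix (g' x))\<bar> *\<^sub>R f (g x)) absolutely_integrable_on S \<and>
           integral S (\<lambda>x. \<bar>det (matrix (g' x))\<bar> *\<^sub>R f (g x)) = I"
    using has_absolute_integral_change_of_variables[OF S_leb der inj, of f I] absf
    unfolding img I_def by blast
  hence "((\<lambda>x. \<bar>det (matrix (g' x))\<bar> *\<^sub>R f (g x)) has_integral I) S"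
    unfolding has_integral_iff absolutely_integrable_on_def by blast
  moreover have "\<bar>det (matrix (g' v))\<bar> *\<^sub>R f (g v) = f v" if "v \<in> S" for v
  proof -
    define z where "z = vec_complex v"
    have z: "cmod z < 1" using that by (auto simp: S_def z_def)
    have nz: "cmod (cnj b * z + cnj a) \<noteq> 0" using mob_denom_nz[OF ab z] by simp
    have ab2: "(cmod a)\<^sup>2 - (cmod b)\<^sup>2 > 0" using ab by (simp add: power_strict_mono)
    have z2: "1 - (cmod z)\<^sup>2 > 0" using z by (simp add: abs_square_less_1)
    have "cmod (d z) = ((cmod a)\<^sup>2 - (cmod b)\<^sup>2) / (cmod (cnj b * z + cnj a))\<^sup>2"
      unfolding d_def norm_divide norm_power norm_of_real using abs_of_pos[OF ab2] by simp
    moreover have "A * (4 / (n * y / q)\<^sup>2) = 4 / y\<^sup>2"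
      if "n > 0" "q \<noteq> 0" "y > 0" "A = (n / q)\<^sup>2" for n q y A :: real
      using that by (simp add: field_simps power2_eq_square)
    ultimately have "(cmod (d z))\<^sup>2 * hyp_dens (mob a b z) = hyp_dens z"
      unfolding one_minus_mob[OF ab z] using ab2 z2 nz by simp
    moreover have "det (matrix (g' v)) = (cmod (d z))\<^sup>2"
      unfolding g'_def[abs_def] det_matrix_complex_mult by (simp add: z_def)
    ultimately show ?thesis by (simp add: f_def g_def z_def vec_eq_iff)
  qed
  ultimately have hS: "(f has_integral I) S"
    by (metis (no_types, lifting) has_integral_cong)
  have hE: "(f has_integral I) (vec_complex -` E)"
    using absf unfolding I_def absolutely_integrable_on_def by (metis integrable_integral)
  have f1: "((\<lambda>v. hyp_dens (vec_complex v)) has_integral (I $ 1)) X" if "(f has_integral I) X" for X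
    using has_integral_linear[OF that bounded_linear_vec_nth[of 1]] by (simp add: f_def o_def)
  have "emeasure hyp_area E = ennreal (I $ 1)"
    by (rule emeasure_hyp_area_vec[OF E E_disc f1[OF hE]])
  moreover have "emeasure hyp_area (mob a b -` E \<inter> unit_disc) = ennreal (I $ 1)"
    by (rule emeasure_hyp_area_vec) (use f1[OF hS] in \<open>auto simp: S_def\<close>)
  ultimately show ?thesis by simp
qed

text \<open>Passes from Borel sets inside smaller balls to all Borel sets: the balls of radius 1 -
  1/(n + 2) exhaust the disc, and measures are continuous from below.\<close>

lemma distr_hyp_area_mob:
  assumes ab: "cmod b < cmod a"
  shows "distr hyp_area borel (mob a b) = hyp_area"
proof (rule measure_eqI)
  fix E assume "E \<in> sets (distr hyp_area borel (mob a b))"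
  hence E [measurable]: "E \<in> sets borel" by simp
  define r :: "nat \<Rightarrow> real" where "r n = 1 - 1 / (n + 2)" for n
  define X where "X n = E \<inter> ball 0 (r n)" for n
  have r1: "r n < 1" for n by (simp add: r_def)
  have inc: "incseq r" by (auto simp: incseq_def r_def frac_le)
  hence incX: "incseq X"
    unfolding incseq_def X_def by (meson Int_mono ball_subset_ball_iff order_refl subset_ball)
  have ball: "(\<Union>n. ball 0 (r n)) = unit_disc"
  proof safe
    fix z :: complex assume "z \<in> ball 0 1"
    hence "1 - cmod z > 0" by simp
    then obtain n where "1 / real (Suc n) < 1 - cmod z" using reals_Archimedean inverse_eq_divide by metis
    moreover have "1 / (real n + 2) \<le> 1 / real (Suc n)" by (simp add: divide_simps)
    ultimately have "z \<in> ball 0 (r n)" by (simp add: r_def)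
    thus "z \<in> (\<Union>n. ball 0 (r n))" by blast
  next
    fix z :: complex and n assume "z \<in> ball 0 (r n)" thus "z \<in> unit_disc" using r1[of n] by simp
  qed
  have [measurable]: "mob a b -` E \<in> sets borel" "mob a b -` X n \<in> sets borel" "X n \<in> sets borel" for n
    unfolding X_def by (auto intro!: measurable_sets_borel[OF mob_measurable])
  have disc: "emeasure hyp_area A = emeasure hyp_area (A \<inter> unit_disc)" if [measurable]: "A \<in> sets borel" for A
    by (simp add: emeasure_hyp_area)
  have "emeasure (distr hyp_area borel (mob a b)) E = emeasure hyp_area (mob a b -` E \<inter> unit_disc)"
    by (subst emeasure_distr) (auto simp: disc[of "mob a b -` E"] cong: measurable_cong_sets)
  also have "mob a b -` E \<inter> unit_disc = (\<Union>n. mob a b -` X n \<inter> unit_disc)"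
    using mob_in_disc[OF ab] ball unfolding X_def by auto (metis UN_iff mem_ball_0)
  also have "emeasure hyp_area \<dots> = (SUP n. emeasure hyp_area (mob a b -` X n \<inter> unit_disc))"
    by (rule SUP_emeasure_incseq[symmetric]) (use incX in \<open>auto simp: incseq_def\<close>)
  also have "\<dots> = (SUP n. emeasure hyp_area (X n))"
    using r1 by (intro SUP_cong refl emeasure_hyp_area_vimage_mob_ball[OF ab, where r = "r _"]) (auto simp: X_def)
  also have "\<dots> = emeasure hyp_area (\<Union>n. X n)"
    by (rule SUP_emeasure_incseq) (use incX in auto)
  also have "(\<Union>n. X n) = E \<inter> unit_disc" using ball by (auto simp: X_def)
  also have "emeasure hyp_area \<dots> = emeasure hyp_area E" by (rule disc[symmetric]) simp
  finally show "emeasure (distr hyp_area borel (mob a b)) E = emeasure hyp_area E" .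
qed simp

lemma distr_hyp_area_disc_translation:
  "cmod w < 1 \<Longrightarrow> distr hyp_area borel (disc_translation w) = hyp_area"
  unfolding disc_translation_eq_mob by (rule distr_hyp_area_mob) simp

lemma nn_integral_hyp_area_disc_translation:
  assumes [measurable]: "h \<in> borel_measurable borel" and "cmod w < 1"
  shows "(\<integral>\<^sup>+z. h (disc_translation w z) \<partial>hyp_area) = (\<integral>\<^sup>+z. h z \<partial>hyp_area)"
  by (subst (2) distr_hyp_area_disc_translation[OF assms(2), symmetric]) (simp add: nn_integral_distr)

lemma distr_hyp_area_rotate:
  assumes "cmod c = 1"
  shows "distr hyp_area borel ((*) c) = hyp_area"
proof -
  \<comment> \<open>For |s| = 1 the map \<open>mob s 0\<close> multiplies by s / cnj s = s^2, so the
    rotation by c needs a square root of c.\<close>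
  define s where "s = csqrt c"
  have s2: "s\<^sup>2 = c" by (simp add: s_def)
  have "(cmod s)\<^sup>2 = 1" unfolding norm_power[symmetric] s2 using assms .
  hence s1: "cmod s = 1" by (simp add: power2_eq_1_iff) (smt (verit) norm_ge_zero)
  hence "s * cnj s = 1" by (simp flip: complex_norm_square)
  hence "inverse (cnj s) = s" by (intro inverse_unique) (simp add: mult.commute)
  hence "mob s 0 = (*) c"
    by (auto simp: mob_def fun_eq_iff divide_inverse s2[symmetric] power2_eq_square)
  thus ?thesis using distr_hyp_area_mob[of 0 s] s1 by simp
qed

section \<open>Radial averages\<close>

definition radial_prob :: "complex measure \<Rightarrow> bool" where
  "radial_prob \<mu> \<longleftrightarrow> prob_space \<mu> \<and> sets \<mu> = sets borel \<and> (AE z in \<mu>. cmod z < 1) \<and>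
     (\<forall>c. cmod c = 1 \<longrightarrow> distr \<mu> borel ((*) c) = \<mu>)"

definition hyp_disc :: "real \<Rightarrow> complex measure" where
  "hyp_disc r = uniform_measure hyp_area (ball 0 r)"

text \<open>Normalised arc length on the unit circle: \<open>sgn\<close> projects a
  rotation-invariant probability measure radially, and the point 0, where \<open>sgn\<close>
  vanishes, has measure zero. The radius 1/2 is arbitrary.\<close>

definition circle_measure :: "complex measure" where
  "circle_measure = distr (hyp_disc (1/2)) borel sgn"

definition hyp_circle :: "real \<Rightarrow> complex measure" where
  "hyp_circle r = distr circle_measure borel (\<lambda>u. u * of_real r)"

definition avg :: "complex measure \<Rightarrow> (complex \<Rightarrow> real) \<Rightarrow> complex \<Rightarrow> real" where
  "avg \<mu> f w = (\<integral>z. f (disc_translation w z) \<partial>\<mu>)"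

text \<open>Asking for the bound on the whole plane gives integrability for every probability
  measure without exceptional sets.\<close>

definition bounded_borel :: "real \<Rightarrow> (complex \<Rightarrow> real) \<Rightarrow> bool" where
  "bounded_borel C f \<longleftrightarrow> f \<in> borel_measurable borel \<and> (\<forall>z. \<bar>f z\<bar> \<le> C)"

lemma bounded_borelD [measurable_dest]: "bounded_borel C f \<Longrightarrow> f \<in> borel_measurable borel"
  by (simp add: bounded_borel_def)

lemma bounded_borel_bound: "bounded_borel C f \<Longrightarrow> \<bar>f z\<bar> \<le> C"
  by (simp add: bounded_borel_def)

lemma hyp_area_dens_measurable:
  "(\<lambda>w. indicator unit_disc w * ennreal (hyp_dens w)) \<in> borel_measurable borel"
  by (intro borel_measurable_times_ennreal borel_measurable_indicator
      measurable_compose[OF hyp_dens_measurable measurable_ennreal]) simp_all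

lemma emeasure_hyp_area_ball:
  assumes "0 < r" "r < 1"
  shows "0 < emeasure hyp_area (ball 0 r)" "emeasure hyp_area (ball 0 r) < \<infinity>"
proof -
  have "emeasure lborel (ball 0 r :: complex set) \<noteq> 0"
    using emeasure_lborel_ball_finite[of "0::complex" r] content_ball_gt_0_iff[of "0::complex" r] assms
    by (auto simp: measure_def)
  hence "0 < emeasure lborel (ball 0 r :: complex set)" by (simp add: zero_less_iff_neq_zero)
  also have "\<dots> = (\<integral>\<^sup>+w. indicator (ball 0 r) (w::complex) \<partial>lborel)" by simp
  also have "\<dots> \<le> emeasure hyp_area (ball 0 r)"
  proof (subst emeasure_hyp_area, simp, rule nn_integral_mono)
    fix w :: complex
    have "1 \<le> ennreal (hyp_dens w)" if "cmod w < 1"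
    proof -
      have "0 < 1 - (cmod w)\<^sup>2" "1 - (cmod w)\<^sup>2 \<le> 1" using that by (auto simp: abs_square_less_1)
      hence "0 < (1 - (cmod w)\<^sup>2)\<^sup>2" "(1 - (cmod w)\<^sup>2)\<^sup>2 \<le> 1" by (auto simp: power_le_one)
      thus ?thesis by (simp add: le_divide_eq)
    qed
    thus "indicator (ball 0 r) w \<le> indicator (ball 0 r \<inter> unit_disc) w * ennreal (hyp_dens w)"
      using assms by (auto simp: indicator_def)
  qed
  finally show "0 < emeasure hyp_area (ball 0 r)" .
  have "emeasure hyp_area (ball 0 r) \<le> (\<integral>\<^sup>+w. ennreal (4 / (1 - r\<^sup>2)\<^sup>2) * indicator (ball 0 r) (w::complex) \<partial>lborel)"
  proof (subst emeasure_hyp_area, simp, rule nn_integral_mono)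
    fix w :: complex
    have "hyp_dens w \<le> 4 / (1 - r\<^sup>2)\<^sup>2" if "cmod w < r"
    proof -
      have "(cmod w)\<^sup>2 \<le> r\<^sup>2" using that by (intro power_mono) auto
      moreover have "r\<^sup>2 < 1" using assms by (simp add: abs_square_less_1)
      ultimately have "(1 - r\<^sup>2)\<^sup>2 \<le> (1 - (cmod w)\<^sup>2)\<^sup>2" "0 < (1 - r\<^sup>2)\<^sup>2"
        by (intro power_mono zero_less_power; linarith)+
      thus ?thesis by (simp add: frac_le)
    qed
    thus "indicator (ball 0 r \<inter> unit_disc) w * ennreal (hyp_dens w) \<le> ennreal (4 / (1 - r\<^sup>2)\<^sup>2) * indicator (ball 0 r) w"
      by (auto simp: indicator_def intro!: ennreal_leI)
  qed
  also have "\<dots> < \<infinity>"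
    using emeasure_lborel_ball_finite[of "0::complex" r]
    by (simp add: nn_integral_cmult_indicator ennreal_mult_less_top)
  finally show "emeasure hyp_area (ball 0 r) < \<infinity>" .
qed

lemma sets_hyp_disc [simp, measurable_cong]: "sets (hyp_disc r) = sets borel"
  by (simp add: hyp_disc_def)

lemma sets_circle_measure [simp, measurable_cong]: "sets circle_measure = sets borel"
  by (simp add: circle_measure_def)

lemma sets_hyp_circle [simp, measurable_cong]: "sets (hyp_circle r) = sets borel"
  by (simp add: hyp_circle_def)

lemma emeasure_hyp_disc:
  assumes [measurable]: "E \<in> sets borel"
  shows "emeasure (hyp_disc r) E = emeasure hyp_area (ball 0 r \<inter> E) / emeasure hyp_area (ball 0 r)"
  unfolding hyp_disc_def by (rule emeasure_uniform_measure) auto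

lemma radial_prob_hyp_disc:
  assumes "0 < r" "r < 1"
  shows "radial_prob (hyp_disc r)"
  unfolding radial_prob_def
proof (intro conjI allI impI)
  show "prob_space (hyp_disc r)"
    unfolding hyp_disc_def using emeasure_hyp_area_ball[OF assms]
    by (intro prob_space_uniform_measure) auto
  show "AE z in hyp_disc r. cmod z < 1"
    unfolding hyp_disc_def using assms by (intro AE_uniform_measureI) auto
next
  fix c :: complex assume c: "cmod c = 1"
  show "distr (hyp_disc r) borel ((*) c) = hyp_disc r"
  proof (rule measure_eqI)
    fix E assume "E \<in> sets (distr (hyp_disc r) borel ((*) c))"
    hence E [measurable]: "E \<in> sets borel" by simp
    have [measurable]: "(*) c -` E \<in> sets borel"
      by (rule measurable_sets_borel[OF _ E]) simp
    have "ball 0 r \<inter> (*) c -` E = (*) c -` (ball 0 r \<inter> E)"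
      using c by (auto simp: norm_mult)
    hence "emeasure hyp_area (ball 0 r \<inter> (*) c -` E) = emeasure (distr hyp_area borel ((*) c)) (ball 0 r \<inter> E)"
      by (subst emeasure_distr) (auto cong: measurable_cong_sets)
    also have "\<dots> = emeasure hyp_area (ball 0 r \<inter> E)"
      by (simp add: distr_hyp_area_rotate[OF c])
    finally show "emeasure (distr (hyp_disc r) borel ((*) c)) E = emeasure (hyp_disc r) E"
      by (subst emeasure_distr) (auto simp: emeasure_hyp_disc hyp_disc_def[THEN arg_cong[of _ _ space]] cong: measurable_cong_sets)
  qed simp
qed simp

lemma radial_probD:
  assumes "radial_prob \<mu>"
  shows "prob_space \<mu>" "sets \<mu> = sets borel" "AE z in \<mu>. cmod z < 1" "space \<mu> = UNIV"
    "cmod c = 1 \<Longrightarrow> distr \<mu> borel ((*) c) = \<mu>"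
  using assms sets_eq_imp_space_eq[of \<mu> borel] by (auto simp: radial_prob_def)

section \<open>The uniform measure on circles\<close>

lemma AE_hyp_area_nonzero: "AE z in hyp_area. z \<noteq> 0"
proof -
  have "AE z in lborel. z \<noteq> (0::complex)" by (rule AE_lborel_singleton)
  thus ?thesis unfolding hyp_area_def using hyp_area_dens_measurable by (subst AE_density) auto
qed

lemma prob_space_circle_measure: "prob_space circle_measure"
proof -
  have "prob_space (hyp_disc (1/2))" using radial_prob_hyp_disc[of "1/2"] radial_probD by simp
  thus ?thesis unfolding circle_measure_def by (rule prob_space.prob_space_distr) (simp cong: measurable_cong_sets)
qed

lemma AE_circle_measure: "AE u in circle_measure. cmod u = 1"
proof -
  have "AE z in hyp_disc (1/2). z \<noteq> 0"
    unfolding hyp_disc_def using AE_hyp_area_nonzero by (intro AE_uniform_measureI) auto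
  hence "AE z in hyp_disc (1/2). cmod (sgn z) = 1" by eventually_elim (simp add: norm_sgn)
  thus ?thesis unfolding circle_measure_def by (subst AE_distr_iff) (auto cong: measurable_cong_sets)
qed

lemma distr_circle_measure_rotate:
  assumes "cmod c = 1"
  shows "distr circle_measure borel ((*) c) = circle_measure"
proof -
  have "distr circle_measure borel ((*) c) = distr (hyp_disc (1/2)) borel (\<lambda>z. c * sgn z)"
    unfolding circle_measure_def by (subst distr_distr) (auto simp: o_def cong: measurable_cong_sets)
  also have "(\<lambda>z. c * sgn z) = (\<lambda>z. sgn (c * z))"
    using assms by (simp add: fun_eq_iff sgn_div_norm norm_mult)
  also have "distr (hyp_disc (1/2)) borel (\<lambda>z. sgn (c * z)) = distr (distr (hyp_disc (1/2)) borel ((*) c)) borel sgn"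
    by (subst distr_distr) (auto simp: o_def cong: measurable_cong_sets)
  also have "\<dots> = circle_measure"
    unfolding circle_measure_def using radial_probD(5)[OF radial_prob_hyp_disc] assms by simp
  finally show ?thesis .
qed

lemma integral_circle_measure_rotate:
  fixes h :: "complex \<Rightarrow> 'a::{banach, second_countable_topology}"
  assumes [measurable]: "h \<in> borel_measurable borel" and c: "cmod c = 1"
  shows "(\<integral>u. h (c * u) \<partial>circle_measure) = (\<integral>u. h u \<partial>circle_measure)"
  by (subst (2) distr_circle_measure_rotate[OF c, symmetric]) (simp add: integral_distr cong: measurable_cong_sets)

lemma radial_prob_hyp_circle:
  assumes "0 \<le> r" "r < 1"
  shows "radial_prob (hyp_circle r)"
  unfolding radial_prob_def
proof (intro conjI allI impI)
  show "prob_space (hyp_circle r)"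
    unfolding hyp_circle_def
    by (rule prob_space.prob_space_distr[OF prob_space_circle_measure]) (simp cong: measurable_cong_sets)
  have "AE u in circle_measure. cmod (u * of_real r) < 1"
    using AE_circle_measure by eventually_elim (use assms in \<open>simp add: norm_mult\<close>)
  thus "AE z in hyp_circle r. cmod z < 1"
    unfolding hyp_circle_def by (subst AE_distr_iff) (auto cong: measurable_cong_sets)
next
  fix c :: complex assume c: "cmod c = 1"
  have "distr (hyp_circle r) borel ((*) c) = distr (distr circle_measure borel ((*) c)) borel (\<lambda>u. u * of_real r)"
    unfolding hyp_circle_def by (subst (1 2) distr_distr) (auto simp: o_def mult.assoc cong: measurable_cong_sets)
  thus "distr (hyp_circle r) borel ((*) c) = hyp_circle r"
    unfolding distr_circle_measure_rotate[OF c] hyp_circle_def .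
qed simp

lemma avg_hyp_circle:
  assumes [measurable]: "f \<in> borel_measurable borel"
  shows "avg (hyp_circle r) f w = (\<integral>u. f (disc_translation w (u * of_real r)) \<partial>circle_measure)"
  unfolding avg_def hyp_circle_def by (subst integral_distr) (auto cong: measurable_cong_sets)

section \<open>Polar coordinates and composition of radial averages\<close>

lemma bounded_borel_integrable:
  assumes "prob_space P" and [measurable]: "X \<in> borel_measurable P" and f: "bounded_borel C f"
  shows "integrable P (\<lambda>x. f (X x))"
proof -
  interpret prob_space P by fact
  note [measurable] = bounded_borelD[OF f]
  show ?thesis
    by (rule integrable_const_bound[of _ C]) (use bounded_borel_bound[OF f] in auto)
qed

text \<open>The rotation hypothesis allows an extra average over c on the circle. After Fubini the
  point X x is fixed and its phase \<open>sgn (X x)\<close> is absorbed by the invariance of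
  \<open>circle_measure\<close>, which leaves the modulus.\<close>

lemma polar_integral:
  assumes P: "prob_space P" and X [measurable]: "X \<in> borel_measurable P" and f: "bounded_borel C h"
    and inv: "\<And>c. cmod c = 1 \<Longrightarrow> (\<integral>x. h (c * X x) \<partial>P) = (\<integral>x. h (X x) \<partial>P)"
  shows "(\<integral>x. h (X x) \<partial>P) = (\<integral>x. (\<integral>u. h (u * of_real (cmod (X x))) \<partial>circle_measure) \<partial>P)"
proof -
  interpret P: prob_space P by fact
  interpret tau: prob_space circle_measure by (rule prob_space_circle_measure)
  interpret PT: pair_prob_space P circle_measure ..
  note [measurable] = bounded_borelD[OF f]
  have "(\<integral>x. h (X x) \<partial>P) = (\<integral>u. (\<integral>x. h (X x) \<partial>P) \<partial>circle_measure)"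
    by (simp add: tau.prob_space)
  also have "\<dots> = (\<integral>u. (\<integral>x. h (u * X x) \<partial>P) \<partial>circle_measure)"
    by (rule integral_cong_AE) (use AE_circle_measure inv in \<open>auto elim!: eventually_mono\<close>)
  also have "\<dots> = (\<integral>x. (\<integral>u. h (u * X x) \<partial>circle_measure) \<partial>P)"
    by (rule PT.Fubini_integral)
       (rule PT.integrable_const_bound[of _ C], use bounded_borel_bound[OF f] in auto)
  also have "\<dots> = (\<integral>x. (\<integral>u. h (u * of_real (cmod (X x))) \<partial>circle_measure) \<partial>P)"
  proof (rule Bochner_Integration.integral_cong[OF refl])
    fix x
    show "(\<integral>u. h (u * X x) \<partial>circle_measure) = (\<integral>u. h (u * of_real (cmod (X x))) \<partial>circle_measure)"
    proof (cases "X x = 0")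
      case False
      have *: "u * X x = (sgn (X x) * u) * of_real (cmod (X x))" for u
        using False by (simp add: sgn_eq)
      show ?thesis
        unfolding * using False
        by (intro integral_circle_measure_rotate[of "\<lambda>u. h (u * of_real (cmod (X x)))" "sgn (X x)"])
           (simp_all add: norm_sgn)
    qed simp
  qed
  finally show ?thesis .
qed

lemma avg_measurable [measurable]:
  assumes mu: "radial_prob \<mu>" and [measurable]: "f \<in> borel_measurable borel"
  shows "avg \<mu> f \<in> borel_measurable borel"
proof -
  interpret prob_space \<mu> using mu by (rule radial_probD)
  have [measurable_cong]: "sets \<mu> = sets borel" using mu by (rule radial_probD)
  show ?thesis unfolding avg_def[abs_def] by measurable
qed

lemma bounded_borel_avg:
  assumes mu: "radial_prob \<mu>" and f: "bounded_borel C f"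
  shows "bounded_borel C (avg \<mu> f)"
proof -
  interpret prob_space \<mu> using mu by (rule radial_probD)
  have [measurable_cong]: "sets \<mu> = sets borel" using mu by (rule radial_probD)
  note [measurable] = bounded_borelD[OF f]
  have "\<bar>avg \<mu> f w\<bar> \<le> C" for w
  proof -
    have int: "integrable \<mu> (\<lambda>z. f (disc_translation w z))"
      by (rule bounded_borel_integrable[OF _ _ f]) (auto simp: prob_space_axioms)
    have "\<bar>avg \<mu> f w\<bar> \<le> (\<integral>z. \<bar>f (disc_translation w z)\<bar> \<partial>\<mu>)"
      unfolding avg_def by (rule integral_abs_bound)
    also have "\<dots> \<le> (\<integral>z. C \<partial>\<mu>)"
      using int bounded_borel_bound[OF f] by (intro integral_mono) auto
    finally show ?thesis by (simp add: prob_space)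
  qed
  thus ?thesis using avg_measurable[OF mu] by (simp add: bounded_borel_def bounded_borelD[OF f])
qed

lemma integral_radial_rotate:
  fixes h :: "complex \<Rightarrow> real"
  assumes mu: "radial_prob \<mu>" and [measurable]: "h \<in> borel_measurable borel" and c: "cmod c = 1"
  shows "(\<integral>z. h (c * z) \<partial>\<mu>) = (\<integral>z. h z \<partial>\<mu>)"
proof -
  have [measurable_cong]: "sets \<mu> = sets borel" using mu by (rule radial_probD)
  show ?thesis
    by (subst (2) radial_probD(5)[OF mu c, symmetric]) (simp add: integral_distr)
qed

lemma avg_polar:
  assumes mu: "radial_prob \<mu>" and f: "bounded_borel C f"
  shows "avg \<mu> f w = (\<integral>z. avg (hyp_circle (cmod z)) f w \<partial>\<mu>)"
proof -
  have [measurable_cong]: "sets \<mu> = sets borel" using mu by (rule radial_probD)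
  note [measurable] = bounded_borelD[OF f]
  have h: "bounded_borel C (\<lambda>z. f (disc_translation w z))"
    using f by (auto simp: bounded_borel_def)
  show ?thesis
    unfolding avg_hyp_circle[OF bounded_borelD[OF f]] unfolding avg_def
    by (rule polar_integral[OF radial_probD(1)[OF mu] _ h])
       (use integral_radial_rotate[OF mu bounded_borelD[OF h]] in auto)
qed

text \<open>The inner average is based at the translate of z by w, and translating by z and then by
  w differs from the translation to that point by a rotation c depending on z. As \<nu> is rotation
  invariant, c disappears.\<close>

lemma avg_avg:
  assumes mu: "radial_prob \<mu>" and nu: "radial_prob \<nu>" and f: "bounded_borel C f" and w: "cmod w < 1"
  shows "avg \<mu> (avg \<nu> f) w = (\<integral>z. \<integral>y. f (disc_translation w (disc_translation z y)) \<partial>\<nu> \<partial>\<mu>)"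
proof -
  interpret mu: prob_space \<mu> using mu by (rule radial_probD)
  interpret nu: prob_space \<nu> using nu by (rule radial_probD)
  have [measurable_cong]: "sets \<mu> = sets borel" "sets \<nu> = sets borel"
    using mu nu by (auto dest: radial_probD)
  note [measurable] = bounded_borelD[OF f] avg_measurable[OF nu bounded_borelD[OF f]]
  show ?thesis
    unfolding avg_def[of \<mu>]
  proof (rule integral_cong_AE)
    show "AE z in \<mu>. avg \<nu> f (disc_translation w z) = (\<integral>y. f (disc_translation w (disc_translation z y)) \<partial>\<nu>)"
      using radial_probD(3)[OF mu]
    proof eventually_elim
      case (elim z)
      define c where "c = (1 + w * cnj z) / (cnj 1 + cnj w * z)"
      have *: "disc_translation w (disc_translation z y) = disc_translation (disc_translation w z) (c * y)" if "cmod y < 1" for y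
        unfolding disc_translation_eq_mob[of w] c_def by (rule mob_disc_translation) (use elim w that in auto)
      have c: "cmod c = 1" unfolding c_def by (rule mob_disc_translation(2)[of _ _ _ 0]) (use elim w in auto)
      have "avg \<nu> f (disc_translation w z) = (\<integral>y. f (disc_translation (disc_translation w z) (c * y)) \<partial>\<nu>)"
        unfolding avg_def by (rule integral_radial_rotate[OF nu _ c, symmetric]) measurable
      also have "\<dots> = (\<integral>y. f (disc_translation w (disc_translation z y)) \<partial>\<nu>)"
        by (rule integral_cong_AE) (use radial_probD(3)[OF nu] * in \<open>auto elim!: eventually_mono\<close>)
      finally show ?case .
    qed
  qed measurable
qed

text \<open>A composite of radial averages is again radial: rotating both variables at once shows
  that only the modulus of the composed translation enters.\<close>

lemma avg_avg_polar:
  assumes mu: "radial_prob \<mu>" and nu: "radial_prob \<nu>" and f: "bounded_borel C f" and w: "cmod w < 1"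
  shows "avg \<mu> (avg \<nu> f) w
    = (\<integral>p. avg (hyp_circle (cmod (disc_translation (fst p) (snd p)))) f w \<partial>(\<mu> \<Otimes>\<^sub>M \<nu>))"
proof -
  interpret mu: prob_space \<mu> using mu by (rule radial_probD)
  interpret nu: prob_space \<nu> using nu by (rule radial_probD)
  interpret MN: pair_prob_space \<mu> \<nu> ..
  have [measurable_cong]: "sets \<mu> = sets borel" "sets \<nu> = sets borel"
    using mu nu by (auto dest: radial_probD)
  note [measurable] = bounded_borelD[OF f]
  define h where "h z = f (disc_translation w z)" for z
  have h: "bounded_borel C h" using f by (auto simp: bounded_borel_def h_def[abs_def])
  note [measurable] = bounded_borelD[OF h]
  have int: "(\<integral>z. \<integral>y. h (disc_translation z y) \<partial>\<nu> \<partial>\<mu>) = (\<integral>p. h (disc_translation (fst p) (snd p)) \<partial>(\<mu> \<Otimes>\<^sub>M \<nu>))"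
    if h: "bounded_borel C h" for h
  proof (subst MN.integral_fst'[symmetric])
    note [measurable] = bounded_borelD[OF h]
    show "integrable (\<mu> \<Otimes>\<^sub>M \<nu>) (\<lambda>p. h (disc_translation (fst p) (snd p)))"
      by (rule bounded_borel_integrable[OF _ _ h]) (auto simp: MN.prob_space_axioms)
  qed simp
  have "avg \<mu> (avg \<nu> f) w = (\<integral>p. h (disc_translation (fst p) (snd p)) \<partial>(\<mu> \<Otimes>\<^sub>M \<nu>))"
    using avg_avg[OF assms] int[OF h] by (simp add: h_def)
  also have "\<dots> = (\<integral>p. (\<integral>u. h (u * of_real (cmod (disc_translation (fst p) (snd p)))) \<partial>circle_measure) \<partial>(\<mu> \<Otimes>\<^sub>M \<nu>))"
  proof (rule polar_integral[OF _ _ h])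
    fix c :: complex assume c: "cmod c = 1"
    have hc: "bounded_borel C (\<lambda>z. h (c * z))" using h by (auto simp: bounded_borel_def)
    have "(\<integral>p. h (c * disc_translation (fst p) (snd p)) \<partial>(\<mu> \<Otimes>\<^sub>M \<nu>))
      = (\<integral>z. \<integral>y. h (disc_translation (c * z) (c * y)) \<partial>\<nu> \<partial>\<mu>)"
      unfolding int[OF hc, symmetric] disc_translation_rotate[OF c] ..
    also have "\<dots> = (\<integral>z. \<integral>y. h (disc_translation z y) \<partial>\<nu> \<partial>\<mu>)"
    proof -
      have "(\<integral>y. h (disc_translation (c * z) (c * y)) \<partial>\<nu>) = (\<integral>y. h (disc_translation (c * z) y) \<partial>\<nu>)" for z
        by (rule integral_radial_rotate[OF nu _ c]) measurable
      moreover have "(\<integral>z. \<integral>y. h (disc_translation (c * z) y) \<partial>\<nu> \<partial>\<mu>) = (\<integral>z. \<integral>y. h (disc_translation z y) \<partial>\<nu> \<partial>\<mu>)"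
        by (rule integral_radial_rotate[OF mu _ c, of "\<lambda>z. \<integral>y. h (disc_translation z y) \<partial>\<nu>"]) measurable
      ultimately show ?thesis by simp
    qed
    finally show "(\<integral>p. h (c * disc_translation (fst p) (snd p)) \<partial>(\<mu> \<Otimes>\<^sub>M \<nu>))
      = (\<integral>p. h (disc_translation (fst p) (snd p)) \<partial>(\<mu> \<Otimes>\<^sub>M \<nu>))"
      unfolding int[OF h] .
  qed (auto simp: MN.prob_space_axioms)
  finally show ?thesis unfolding avg_hyp_circle[OF bounded_borelD[OF f]] h_def .
qed

lemma avg_hyp_circle_measurable [measurable (raw)]:
  assumes [measurable]: "f \<in> borel_measurable borel" "r \<in> borel_measurable M" "w \<in> borel_measurable M"
  shows "(\<lambda>x. avg (hyp_circle (r x)) f (w x)) \<in> borel_measurable M"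
proof -
  interpret prob_space circle_measure by (rule prob_space_circle_measure)
  show ?thesis unfolding avg_hyp_circle[OF assms(1)] by measurable
qed

lemma bounded_avg_hyp_circle:
  assumes f: "bounded_borel C f"
  shows "\<bar>avg (hyp_circle r) f w\<bar> \<le> C"
proof -
  interpret prob_space circle_measure by (rule prob_space_circle_measure)
  note [measurable] = bounded_borelD[OF f]
  have int: "integrable circle_measure (\<lambda>u. f (disc_translation w (u * of_real r)))"
    by (rule bounded_borel_integrable[OF _ _ f]) (auto simp: prob_space_axioms)
  have "\<bar>avg (hyp_circle r) f w\<bar> \<le> (\<integral>u. \<bar>f (disc_translation w (u * of_real r))\<bar> \<partial>circle_measure)"
    unfolding avg_hyp_circle[OF bounded_borelD[OF f]] by (rule integral_abs_bound)
  also have "\<dots> \<le> (\<integral>z. C \<partial>circle_measure)"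
    using int bounded_borel_bound[OF f] by (intro integral_mono) auto
  finally show ?thesis by (simp add: prob_space)
qed

text \<open>The composed radius is symmetric in its two points, so swapping the factors of the
  product measure suffices.\<close>

lemma avg_commute:
  assumes mu: "radial_prob \<mu>" and nu: "radial_prob \<nu>" and f: "bounded_borel C f" and w: "cmod w < 1"
  shows "avg \<mu> (avg \<nu> f) w = avg \<nu> (avg \<mu> f) w"
proof -
  interpret mu: prob_space \<mu> using mu by (rule radial_probD)
  interpret nu: prob_space \<nu> using nu by (rule radial_probD)
  interpret MN: pair_prob_space \<mu> \<nu> ..
  have [measurable_cong]: "sets \<mu> = sets borel" "sets \<nu> = sets borel"
    using mu nu by (auto dest: radial_probD)
  note [measurable] = bounded_borelD[OF f]
  show ?thesis
    unfolding avg_avg_polar[OF mu nu f w] avg_avg_polar[OF nu mu f w]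
    by (subst MN.integral_product_swap[symmetric])
       (simp_all add: split_beta' cmod_disc_translation_sym(1))
qed

lemma avg_avg_hyp_circle:
  assumes mu: "radial_prob \<mu>" and r: "0 \<le> r" "r < 1" and f: "bounded_borel C f" and w: "cmod w < 1"
  shows "avg \<mu> (avg (hyp_circle r) f) w
    = (\<integral>z. \<integral>u. avg (hyp_circle (cmod (disc_translation z (u * of_real r)))) f w \<partial>circle_measure \<partial>\<mu>)"
proof -
  have nu: "radial_prob (hyp_circle r)" using r by (rule radial_prob_hyp_circle)
  interpret mu: prob_space \<mu> using mu by (rule radial_probD)
  interpret nu: prob_space "hyp_circle r" using nu by (rule radial_probD)
  interpret MN: pair_prob_space \<mu> "hyp_circle r" ..
  have [measurable_cong]: "sets \<mu> = sets borel"
    using mu by (auto dest: radial_probD)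
  note [measurable] = bounded_borelD[OF f]
  have "avg \<mu> (avg (hyp_circle r) f) w
    = (\<integral>z. \<integral>y. avg (hyp_circle (cmod (disc_translation z y))) f w \<partial>hyp_circle r \<partial>\<mu>)"
    unfolding avg_avg_polar[OF mu nu f w]
    by (subst MN.integral_fst'[symmetric])
       (auto intro!: MN.integrable_const_bound[of _ C] bounded_avg_hyp_circle[OF f])
  also have "(\<lambda>z. \<integral>y. avg (hyp_circle (cmod (disc_translation z y))) f w \<partial>hyp_circle r)
    = (\<lambda>z. \<integral>u. avg (hyp_circle (cmod (disc_translation z (u * of_real r)))) f w \<partial>circle_measure)"
    unfolding hyp_circle_def[of r]
    by (subst integral_distr) (auto cong: measurable_cong_sets)
  finally show ?thesis .
qed

text \<open>Both points can be rotated together, so the first is put at r on the positive axis and a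
  single angle remains. The radius under the integral expresses the hyperbolic law of
  cosines.\<close>

lemma avg_hyp_circle_hyp_circle:
  assumes r: "0 \<le> r" "r < 1" and s: "0 \<le> s" "s < 1" and f: "bounded_borel C f" and w: "cmod w < 1"
  shows "avg (hyp_circle r) (avg (hyp_circle s) f) w
    = (\<integral>u. avg (hyp_circle (cmod (disc_translation (of_real r) (u * of_real s)))) f w \<partial>circle_measure)"
proof -
  interpret tau: prob_space circle_measure by (rule prob_space_circle_measure)
  note [measurable] = bounded_borelD[OF f]
  define A where "A x = avg (hyp_circle x) f w" for x
  have [measurable]: "A \<in> borel_measurable borel" unfolding A_def[abs_def] by measurable
  define J where "J z = (\<integral>u. A (cmod (disc_translation z (u * of_real s))) \<partial>circle_measure)" for z
  have J: "J (v * of_real r) = J (of_real r)" if "cmod v = 1" for v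
  proof -
    have "J (v * of_real r) = (\<integral>u. A (cmod (disc_translation (v * of_real r) ((v * u) * of_real s))) \<partial>circle_measure)"
      unfolding J_def by (rule integral_circle_measure_rotate[OF _ that, symmetric]) measurable
    also have "\<dots> = J (of_real r)"
      unfolding J_def mult.assoc disc_translation_rotate[OF that] using that by (simp add: norm_mult)
    finally show ?thesis .
  qed
  have "avg (hyp_circle r) (avg (hyp_circle s) f) w = (\<integral>z. J z \<partial>hyp_circle r)"
    unfolding J_def A_def by (rule avg_avg_hyp_circle[OF radial_prob_hyp_circle[OF r] s f w])
  also have "\<dots> = (\<integral>v. J (v * of_real r) \<partial>circle_measure)"
    unfolding hyp_circle_def J_def by (subst integral_distr) (auto cong: measurable_cong_sets)
  also have "\<dots> = (\<integral>v. J (of_real r) \<partial>circle_measure)"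
    by (rule integral_cong_AE) (use AE_circle_measure J in \<open>auto elim!: eventually_mono simp: J_def\<close>)
  also have "\<dots> = J (of_real r)" by (simp add: tau.prob_space)
  finally show ?thesis unfolding J_def A_def .
qed

section \<open>Unfolding over a group of isometries\<close>

text \<open>\<open>L\<close> integrates against a point-pair invariant, a kernel depending on the
  hyperbolic distance alone. Values in \<open>ennreal\<close> and nonnegative f allow all exchanges
  of integrals without integrability conditions.\<close>

definition has_radial_kernel ::
    "((complex \<Rightarrow> real) \<Rightarrow> complex \<Rightarrow> real) \<Rightarrow> (complex \<Rightarrow> ennreal) \<Rightarrow> bool" where
  "has_radial_kernel L k \<longleftrightarrow> k \<in> borel_measurable borel \<and>
     (\<forall>c z. cmod c = 1 \<longrightarrow> k (c * z) = k z) \<and>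
     (\<forall>C f w. bounded_borel C f \<longrightarrow> (\<forall>z. 0 \<le> f z) \<longrightarrow> cmod w < 1 \<longrightarrow>
        ennreal (L f w) = (\<integral>\<^sup>+y. k y * ennreal (f (disc_translation w y)) \<partial>hyp_area))"

definition disc_kernel :: "real \<Rightarrow> complex \<Rightarrow> ennreal" where
  "disc_kernel r z = (if cmod z < r then inverse (emeasure hyp_area (ball 0 r)) else 0)"

lemma disc_kernel_measurable [measurable]: "disc_kernel r \<in> borel_measurable borel"
  unfolding disc_kernel_def[abs_def] by (rule measurable_If) auto

lemma disc_kernel_rotate: "cmod c = 1 \<Longrightarrow> disc_kernel r (c * z) = disc_kernel r z"
  by (simp add: disc_kernel_def norm_mult)

lemma hyp_disc_eq_density: "hyp_disc r = density hyp_area (disc_kernel r)"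
  unfolding hyp_disc_def uniform_measure_def disc_kernel_def[abs_def]
  by (intro arg_cong[of _ _ "density hyp_area"] ext) (auto simp: divide_ennreal_def)

lemma nn_integral_hyp_disc:
  assumes [measurable]: "h \<in> borel_measurable borel"
  shows "(\<integral>\<^sup>+z. h z \<partial>hyp_disc r)
    = (\<integral>\<^sup>+z. disc_kernel r z * h z \<partial>hyp_area)"
  unfolding hyp_disc_eq_density by (rule nn_integral_density) auto

lemma ennreal_avg:
  assumes mu: "radial_prob \<mu>" and f: "bounded_borel C f" and nonneg: "\<And>z. 0 \<le> f z"
  shows "ennreal (avg \<mu> f w) = (\<integral>\<^sup>+z. ennreal (f (disc_translation w z)) \<partial>\<mu>)"
proof -
  have [measurable_cong]: "sets \<mu> = sets borel" using mu by (rule radial_probD)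
  note [measurable] = bounded_borelD[OF f]
  show ?thesis
    unfolding avg_def
    by (rule nn_integral_eq_integral[symmetric])
       (use nonneg in \<open>auto intro: bounded_borel_integrable[OF radial_probD(1)[OF mu] _ f]\<close>)
qed

lemma avg_nonneg: "(\<And>z. 0 \<le> f z) \<Longrightarrow> 0 \<le> avg \<mu> f w"
  unfolding avg_def by simp

lemma has_radial_kernel_hyp_disc:
  assumes "0 < r" "r < 1"
  shows "has_radial_kernel (avg (hyp_disc r)) (disc_kernel r)"
  unfolding has_radial_kernel_def
proof (intro conjI allI impI)
  fix C f w assume f: "bounded_borel C f" "\<forall>z. 0 \<le> f z"
  note [measurable] = bounded_borelD[OF f(1)]
  show "ennreal (avg (hyp_disc r) f w) = (\<integral>\<^sup>+y. disc_kernel r y * ennreal (f (disc_translation w y)) \<partial>hyp_area)"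
    using f by (subst ennreal_avg[OF radial_prob_hyp_disc[OF assms] f(1)]) (auto intro!: nn_integral_hyp_disc)
qed (auto simp: disc_kernel_rotate)

text \<open>The measure \<mu> may be singular, such as a circle. The disc average behind it spreads
  its mass, and Fubini together with the invariance of area under translation by z collects the
  kernel.\<close>

lemma has_radial_kernel_avg_hyp_disc:
  assumes mu: "radial_prob \<mu>" and r: "0 < r" "r < 1"
  defines "k \<equiv> \<lambda>y. \<integral>\<^sup>+z. disc_kernel r (disc_translation (- z) y) \<partial>\<mu>"
  shows "has_radial_kernel (\<lambda>f. avg \<mu> (avg (hyp_disc r) f)) k"
  unfolding has_radial_kernel_def
proof (intro conjI allI impI)
  interpret mu: prob_space \<mu> using mu by (rule radial_probD)
  interpret H: sigma_finite_measure hyp_area by (rule sigma_finite_hyp_area)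
  interpret HM: pair_sigma_finite hyp_area \<mu> ..
  have [measurable_cong]: "sets \<mu> = sets borel" using mu by (rule radial_probD)
  show [measurable]: "k \<in> borel_measurable borel" unfolding k_def by measurable
  {
    fix c z :: complex assume c: "cmod c = 1"
    have "k (c * z) = (\<integral>\<^sup>+x. disc_kernel r (disc_translation (- x) (c * z)) \<partial>distr \<mu> borel ((*) c))"
      unfolding k_def radial_probD(5)[OF mu c] ..
    also have "\<dots> = (\<integral>\<^sup>+x. disc_kernel r (disc_translation (c * (- x)) (c * z)) \<partial>\<mu>)"
      by (subst nn_integral_distr) auto
    also have "\<dots> = k z"
      unfolding disc_translation_rotate[OF c] k_def disc_kernel_rotate[OF c] ..
    finally show "k (c * z) = k z" .
  }
  fix C f w assume f: "bounded_borel C f" and nonneg: "\<forall>z. 0 \<le> f z" and w: "cmod w < 1"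
  note [measurable] = bounded_borelD[OF f]
  have D: "radial_prob (hyp_disc r)" using r by (rule radial_prob_hyp_disc)
  show "ennreal (avg \<mu> (avg (hyp_disc r) f) w) = (\<integral>\<^sup>+y. k y * ennreal (f (disc_translation w y)) \<partial>hyp_area)"
  proof -
    note avg_avg[OF mu D f w]
    also have "ennreal (\<integral>z. \<integral>y. f (disc_translation w (disc_translation z y)) \<partial>hyp_disc r \<partial>\<mu>)
      = (\<integral>\<^sup>+z. \<integral>\<^sup>+y. f (disc_translation w (disc_translation z y)) \<partial>hyp_disc r \<partial>\<mu>)"
    proof -
      interpret D: prob_space "hyp_disc r" using D by (rule radial_probD)
      have b: "bounded_borel C (\<lambda>z. \<integral>y. f (disc_translation w (disc_translation z y)) \<partial>hyp_disc r)"
      proof -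
        have "bounded_borel C (\<lambda>x. f (disc_translation w x))" using f by (auto simp: bounded_borel_def)
        from bounded_borel_avg[OF D this] show ?thesis unfolding avg_def[abs_def] .
      qed
      have "ennreal (\<integral>z. \<integral>y. f (disc_translation w (disc_translation z y)) \<partial>hyp_disc r \<partial>\<mu>)
        = (\<integral>\<^sup>+z. ennreal (\<integral>y. f (disc_translation w (disc_translation z y)) \<partial>hyp_disc r) \<partial>\<mu>)"
        by (rule nn_integral_eq_integral[symmetric])
           (use nonneg bounded_borel_integrable[OF mu.prob_space_axioms _ b, of "\<lambda>z. z"] in auto)
      also have "\<dots> = (\<integral>\<^sup>+z. \<integral>\<^sup>+y. f (disc_translation w (disc_translation z y)) \<partial>hyp_disc r \<partial>\<mu>)"
        by (rule nn_integral_cong, rule nn_integral_eq_integral[symmetric])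
           (use nonneg in \<open>auto intro: bounded_borel_integrable[OF D.prob_space_axioms _ f]\<close>)
      finally show ?thesis .
    qed
    also have "\<dots> = (\<integral>\<^sup>+z. \<integral>\<^sup>+y. disc_kernel r y * ennreal (f (disc_translation w (disc_translation z y))) \<partial>hyp_area \<partial>\<mu>)"
      by (rule nn_integral_cong, subst nn_integral_hyp_disc) auto
    also have "\<dots> = (\<integral>\<^sup>+z. \<integral>\<^sup>+y. disc_kernel r (disc_translation (- z) y) * ennreal (f (disc_translation w y)) \<partial>hyp_area \<partial>\<mu>)"
    proof (rule nn_integral_cong_AE)
      show "AE z in \<mu>. (\<integral>\<^sup>+y. disc_kernel r y * ennreal (f (disc_translation w (disc_translation z y))) \<partial>hyp_area)
          = (\<integral>\<^sup>+y. disc_kernel r (disc_translation (- z) y) * ennreal (f (disc_translation w y)) \<partial>hyp_area)"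
        using radial_probD(3)[OF mu]
      proof eventually_elim
        case (elim z)
        have "(\<integral>\<^sup>+y. disc_kernel r (disc_translation (- z) y) * ennreal (f (disc_translation w y)) \<partial>hyp_area)
          = (\<integral>\<^sup>+y. disc_kernel r (disc_translation (- z) (disc_translation z y)) * ennreal (f (disc_translation w (disc_translation z y))) \<partial>hyp_area)"
          by (rule nn_integral_hyp_area_disc_translation[OF _ elim, symmetric]) measurable
        also have "\<dots> = (\<integral>\<^sup>+y. disc_kernel r y * ennreal (f (disc_translation w (disc_translation z y))) \<partial>hyp_area)"
          by (rule nn_integral_cong_AE, use AE_hyp_area_disc in eventually_elim) (simp add: disc_translation_inverse elim)
        finally show ?case by simp
      qed
    qed
    also have "\<dots> = (\<integral>\<^sup>+y. \<integral>\<^sup>+z. disc_kernel r (disc_translation (- z) y) * ennreal (f (disc_translation w y)) \<partial>\<mu> \<partial>hyp_area)"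
      by (rule HM.Fubini') measurable
    also have "\<dots> = (\<integral>\<^sup>+y. k y * ennreal (f (disc_translation w y)) \<partial>hyp_area)"
      unfolding k_def by (rule nn_integral_cong, subst nn_integral_multc) auto
    finally show ?thesis .
  qed
qed

text \<open>What integration over the quotient requires of the group: off a null set each z is moved
  into F by exactly one group element. Stating uniqueness for almost all points leaves room for the
  fixed points of elliptic elements. \<open>iv\<close> is inversion in the group.\<close>

locale disc_quotient =
  fixes \<Gamma> :: "'g set" and act :: "'g \<Rightarrow> complex \<Rightarrow> complex" and iv :: "'g \<Rightarrow> 'g" and F :: "complex set"
  assumes countable_group: "countable \<Gamma>"
    and act_mob: "g \<in> \<Gamma> \<Longrightarrow> \<exists>a b. cmod b < cmod a \<and> act g = mob a b"
    and iv_closed: "g \<in> \<Gamma> \<Longrightarrow> iv g \<in> \<Gamma>"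
    and iv_iv: "g \<in> \<Gamma> \<Longrightarrow> iv (iv g) = g"
    and act_iv: "g \<in> \<Gamma> \<Longrightarrow> cmod z < 1 \<Longrightarrow> act (iv g) (act g z) = z"
    and F_borel [measurable]: "F \<in> sets borel"
    and F_disc: "F \<subseteq> unit_disc"
    and F_finite: "emeasure hyp_area F < \<infinity>"
    and F_pos: "0 < emeasure hyp_area F"
    and AE_fundamental: "AE z in hyp_area. \<exists>!g. g \<in> \<Gamma> \<and> act g z \<in> F"
begin

definition invariant :: "(complex \<Rightarrow> 'b) \<Rightarrow> bool" where
  "invariant f \<longleftrightarrow> (\<forall>g\<in>\<Gamma>. \<forall>z. cmod z < 1 \<longrightarrow> f (act g z) = f z)"

definition quot :: "complex measure" where
  "quot = density hyp_area (indicator F)"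

lemma sets_quot [simp, measurable_cong]: "sets quot = sets borel"
  by (simp add: quot_def)

lemma space_quot [simp]: "space quot = UNIV"
  by (simp add: quot_def)

lemma nn_integral_quot:
  "h \<in> borel_measurable borel \<Longrightarrow> (\<integral>\<^sup>+w. h w \<partial>quot) = (\<integral>\<^sup>+w. indicator F w * h w \<partial>hyp_area)"
  unfolding quot_def by (subst nn_integral_density) auto

lemma emeasure_quot_UNIV: "emeasure quot UNIV = emeasure hyp_area F"
  unfolding quot_def by (subst emeasure_density) auto

sublocale quot: finite_measure quot
  by (rule finite_measureI) (use F_finite in \<open>auto simp: emeasure_quot_UNIV\<close>)

lemma AE_quot_disc: "AE w in quot. cmod w < 1"
  unfolding quot_def using AE_hyp_area_disc by (subst AE_density) (auto elim!: eventually_mono)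

lemma integrable_quot:
  "bounded_borel C f \<Longrightarrow> integrable quot f"
  by (rule quot.integrable_const_bound[of _ C]) (auto simp: bounded_borel_def)

lemma act_measurable: "g \<in> \<Gamma> \<Longrightarrow> act g \<in> borel_measurable borel"
  using act_mob mob_measurable by metis

lemma act_in_disc: "g \<in> \<Gamma> \<Longrightarrow> cmod z < 1 \<Longrightarrow> cmod (act g z) < 1"
  using act_mob mob_in_disc by metis

lemma nn_integral_act:
  assumes g: "g \<in> \<Gamma>" and [measurable]: "h \<in> borel_measurable borel"
  shows "(\<integral>\<^sup>+z. h (act g z) \<partial>hyp_area) = (\<integral>\<^sup>+z. h z \<partial>hyp_area)"
proof -
  have "distr hyp_area borel (act g) = hyp_area"
    using act_mob[OF g] distr_hyp_area_mob by metis
  thus ?thesis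
    using act_measurable[OF g] by (metis (no_types) nn_integral_distr assms(2) measurable_cong_sets sets_hyp_area)
qed

text \<open>For almost every z the indicators of F at the points g z sum to one over g, so they can
  be inserted and the sum exchanged with the integral.\<close>

lemma nn_integral_unfold:
  assumes [measurable]: "h \<in> borel_measurable borel"
  shows "(\<integral>\<^sup>+z. h z \<partial>hyp_area) = (\<integral>\<^sup>+g. (\<integral>\<^sup>+z. indicator F (act g z) * h z \<partial>hyp_area) \<partial>count_space \<Gamma>)"
proof -
  interpret H: sigma_finite_measure hyp_area by (rule sigma_finite_hyp_area)
  interpret C: sigma_finite_measure "count_space \<Gamma>"
    using countable_group by (rule sigma_finite_measure_count_space_countable)
  interpret CH: pair_sigma_finite "count_space \<Gamma>" hyp_area ..
  have m: "(\<lambda>(g, z). indicator F (act g z) * h z) \<in> borel_measurable (count_space \<Gamma> \<Otimes>\<^sub>M hyp_area)"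
    by (rule measurable_pair_measure_countable1[OF countable_group])
       (use act_measurable in \<open>auto intro!: borel_measurable_times_ennreal borel_measurable_indicator'\<close>)
  have "(\<integral>\<^sup>+g. (\<integral>\<^sup>+z. indicator F (act g z) * h z \<partial>hyp_area) \<partial>count_space \<Gamma>)
    = (\<integral>\<^sup>+z. (\<integral>\<^sup>+g. indicator F (act g z) * h z \<partial>count_space \<Gamma>) \<partial>hyp_area)"
    by (rule CH.Fubini'[OF m, symmetric])
  also have "\<dots> = (\<integral>\<^sup>+z. h z \<partial>hyp_area)"
  proof (rule nn_integral_cong_AE)
    show "AE z in hyp_area. (\<integral>\<^sup>+g. indicator F (act g z) * h z \<partial>count_space \<Gamma>) = h z"
      using AE_fundamental
    proof eventually_elim
      case (elim z)
      then obtain g where g: "g \<in> \<Gamma>" "act g z \<in> F" "\<And>g'. g' \<in> \<Gamma> \<Longrightarrow> act g' z \<in> F \<Longrightarrow> g' = g"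
        by blast
      have "(\<integral>\<^sup>+g. indicator F (act g z) * h z \<partial>count_space \<Gamma>) = (\<integral>\<^sup>+x. indicator {g} x * h z \<partial>count_space \<Gamma>)"
      proof (rule nn_integral_cong)
        fix x assume "x \<in> space (count_space \<Gamma>)"
        hence "act x z \<in> F \<longleftrightarrow> x = g" using g(2) g(3)[of x] unfolding space_count_space by blast
        thus "indicator F (act x z) * h z = indicator {g} x * h z" by (simp add: indicator_def)
      qed
      also have "\<dots> = h z" using g(1) by (simp add: nn_integral_multc)
      finally show ?case .
    qed
  qed
  finally show ?thesis ..
qed

text \<open>Both sides integrate K over the quotient of disc times disc by the diagonal action.
  Unfolding the inner variable yields a sum over g; applying g to both variables moves the condition
  on g z to one on w with the inverse of g, and inversion permutes the group.\<close>

lemma nn_integral_quotient_swap: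
  fixes K :: "complex \<Rightarrow> complex \<Rightarrow> ennreal"
  assumes [measurable]: "case_prod K \<in> borel_measurable (borel \<Otimes>\<^sub>M borel)"
    and inv: "\<And>g w z. g \<in> \<Gamma> \<Longrightarrow> cmod w < 1 \<Longrightarrow> cmod z < 1 \<Longrightarrow> K (act g w) (act g z) = K w z"
  shows "(\<integral>\<^sup>+w. (\<integral>\<^sup>+z. K w z \<partial>hyp_area) \<partial>quot) = (\<integral>\<^sup>+z. (\<integral>\<^sup>+w. K w z \<partial>hyp_area) \<partial>quot)"
proof -
  interpret H: sigma_finite_measure hyp_area by (rule sigma_finite_hyp_area)
  interpret HH: pair_sigma_finite hyp_area hyp_area ..
  interpret C: sigma_finite_measure "count_space \<Gamma>"
    using countable_group by (rule sigma_finite_measure_count_space_countable)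
  interpret CH: pair_sigma_finite "count_space \<Gamma>" hyp_area ..
  define B where "B g = (\<integral>\<^sup>+w. (\<integral>\<^sup>+z. indicator F (act g w) * indicator F z * K w z \<partial>hyp_area) \<partial>hyp_area)" for g
  have unfold: "(\<integral>\<^sup>+w. (\<integral>\<^sup>+z. K w z \<partial>hyp_area) \<partial>quot)
      = (\<integral>\<^sup>+g. (\<integral>\<^sup>+w. (\<integral>\<^sup>+z. indicator F w * indicator F (act g z) * K w z \<partial>hyp_area) \<partial>hyp_area) \<partial>count_space \<Gamma>)"
    if [measurable]: "case_prod K \<in> borel_measurable (borel \<Otimes>\<^sub>M borel)" for K :: "complex \<Rightarrow> complex \<Rightarrow> ennreal"
  proof -
    have m1: "(\<lambda>(w, z). indicator F w * indicator F (act g z) * K w z) \<in> borel_measurable (borel \<Otimes>\<^sub>M borel)" if "g \<in> \<Gamma>" for g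
    proof -
      note [measurable] = act_measurable[OF that]
      show ?thesis by measurable
    qed
    have m2: "(\<lambda>(g, w). \<integral>\<^sup>+z. indicator F w * indicator F (act g z) * K w z \<partial>hyp_area) \<in> borel_measurable (count_space \<Gamma> \<Otimes>\<^sub>M hyp_area)"
    proof (rule measurable_pair_measure_countable1[OF countable_group])
      fix g assume "g \<in> \<Gamma>"
      note [measurable] = m1[OF this]
      show "(\<lambda>w. case (g, w) of (g, w) \<Rightarrow> \<integral>\<^sup>+z. indicator F w * indicator F (act g z) * K w z \<partial>hyp_area) \<in> borel_measurable hyp_area"
        by simp
    qed
    have "(\<integral>\<^sup>+w. (\<integral>\<^sup>+z. K w z \<partial>hyp_area) \<partial>quot) = (\<integral>\<^sup>+w. indicator F w * (\<integral>\<^sup>+z. K w z \<partial>hyp_area) \<partial>hyp_area)"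
      by (rule nn_integral_quot) measurable
    also have "\<dots> = (\<integral>\<^sup>+w. (\<integral>\<^sup>+g. (\<integral>\<^sup>+z. indicator F w * indicator F (act g z) * K w z \<partial>hyp_area) \<partial>count_space \<Gamma>) \<partial>hyp_area)"
    proof (rule nn_integral_cong)
      fix w
      have "indicator F w * (\<integral>\<^sup>+z. K w z \<partial>hyp_area) = (\<integral>\<^sup>+z. indicator F w * K w z \<partial>hyp_area)"
        by (rule nn_integral_cmult[symmetric]) simp
      also have "\<dots> = (\<integral>\<^sup>+g. (\<integral>\<^sup>+z. indicator F (act g z) * (indicator F w * K w z) \<partial>hyp_area) \<partial>count_space \<Gamma>)"
        by (rule nn_integral_unfold) measurable
      finally show "indicator F w * (\<integral>\<^sup>+z. K w z \<partial>hyp_area)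
        = (\<integral>\<^sup>+g. (\<integral>\<^sup>+z. indicator F w * indicator F (act g z) * K w z \<partial>hyp_area) \<partial>count_space \<Gamma>)"
        by (simp add: mult_ac)
    qed
    also have "\<dots> = (\<integral>\<^sup>+g. (\<integral>\<^sup>+w. (\<integral>\<^sup>+z. indicator F w * indicator F (act g z) * K w z \<partial>hyp_area) \<partial>hyp_area) \<partial>count_space \<Gamma>)"
      by (rule CH.Fubini'[OF m2])
    finally show ?thesis .
  qed
  have R: "(\<integral>\<^sup>+z. (\<integral>\<^sup>+w. K w z \<partial>hyp_area) \<partial>quot) = (\<integral>\<^sup>+g. B g \<partial>count_space \<Gamma>)"
  proof -
    have "(\<integral>\<^sup>+z. (\<integral>\<^sup>+w. K w z \<partial>hyp_area) \<partial>quot) = (\<integral>\<^sup>+g. (\<integral>\<^sup>+z. (\<integral>\<^sup>+w. indicator F z * indicator F (act g w) * K w z \<partial>hyp_area) \<partial>hyp_area) \<partial>count_space \<Gamma>)"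
      by (rule unfold) measurable
    also have "\<dots> = (\<integral>\<^sup>+g. B g \<partial>count_space \<Gamma>)"
    proof (rule nn_integral_cong)
      fix g assume "g \<in> space (count_space \<Gamma>)"
      hence g: "g \<in> \<Gamma>" by simp
      note [measurable] = act_measurable[OF g]
      show "(\<integral>\<^sup>+z. (\<integral>\<^sup>+w. indicator F z * indicator F (act g w) * K w z \<partial>hyp_area) \<partial>hyp_area) = B g"
        unfolding B_def by (subst HH.Fubini') (simp_all add: mult_ac)
    qed
    finally show ?thesis .
  qed
  have "(\<integral>\<^sup>+w. (\<integral>\<^sup>+z. K w z \<partial>hyp_area) \<partial>quot) = (\<integral>\<^sup>+g. B (iv g) \<partial>count_space \<Gamma>)"
    unfolding unfold[OF assms(1)]
  proof (rule nn_integral_cong)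
    fix g assume "g \<in> space (count_space \<Gamma>)"
    hence g: "g \<in> \<Gamma>" by simp
    note [measurable] = act_measurable[OF g] act_measurable[OF iv_closed[OF g]]
    have "(\<integral>\<^sup>+w. (\<integral>\<^sup>+z. indicator F w * indicator F (act g z) * K w z \<partial>hyp_area) \<partial>hyp_area)
      = (\<integral>\<^sup>+w. (\<integral>\<^sup>+z. indicator F (act (iv g) (act g w)) * indicator F (act g z) * K (act g w) (act g z) \<partial>hyp_area) \<partial>hyp_area)"
    proof (intro nn_integral_cong_AE, use AE_hyp_area_disc in eventually_elim)
      case (elim w)
      show ?case
        by (intro nn_integral_cong_AE, use AE_hyp_area_disc in eventually_elim) (simp add: act_iv inv g elim)
    qed
    also have "\<dots> = (\<integral>\<^sup>+w. (\<integral>\<^sup>+z. indicator F (act (iv g) (act g w)) * indicator F z * K (act g w) z \<partial>hyp_area) \<partial>hyp_area)"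
      by (intro nn_integral_cong nn_integral_act[OF g, of "\<lambda>z. indicator F (act (iv g) (act g _)) * indicator F z * K (act g _) z"]) measurable
    also have "\<dots> = B (iv g)"
      unfolding B_def
      by (rule nn_integral_act[OF g, of "\<lambda>w. \<integral>\<^sup>+z. indicator F (act (iv g) w) * indicator F z * K w z \<partial>hyp_area"]) measurable
    finally show "(\<integral>\<^sup>+w. (\<integral>\<^sup>+z. indicator F w * indicator F (act g z) * K w z \<partial>hyp_area) \<partial>hyp_area) = B (iv g)" .
  qed
  also have "\<dots> = (\<integral>\<^sup>+g. B g \<partial>count_space \<Gamma>)"
    by (rule nn_integral_bij_count_space) (rule bij_betwI[of _ _ _ iv], auto simp: iv_closed iv_iv)
  finally show ?thesis unfolding R .
qed

lemma invariant_avg: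
  assumes mu: "radial_prob \<mu>" and [measurable]: "f \<in> borel_measurable borel" and f: "invariant f"
  shows "invariant (avg \<mu> f)"
  unfolding invariant_def
proof (intro ballI allI impI)
  fix g w assume g: "g \<in> \<Gamma>" and w: "cmod w < 1"
  have [measurable_cong]: "sets \<mu> = sets borel" using mu by (rule radial_probD)
  note [measurable] = act_measurable[OF g]
  obtain a b where ab: "cmod b < cmod a" "act g = mob a b" using act_mob[OF g] by blast
  define c where "c = (a + b * cnj w) / (cnj a + cnj b * w)"
  have c: "cmod c = 1" unfolding c_def by (rule mob_disc_translation(2)[of _ _ _ 0]) (use ab w in auto)
  have "avg \<mu> f (act g w) = (\<integral>z. f (disc_translation (act g w) (c * z)) \<partial>\<mu>)"
    unfolding avg_def by (rule integral_radial_rotate[OF mu _ c, symmetric]) measurable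
  also have "\<dots> = avg \<mu> f w"
    unfolding avg_def
  proof (rule integral_cong_AE)
    show "AE z in \<mu>. f (disc_translation (act g w) (c * z)) = f (disc_translation w z)"
      using radial_probD(3)[OF mu]
    proof eventually_elim
      case (elim z)
      have "act g (disc_translation w z) = disc_translation (act g w) (c * z)"
        unfolding ab(2) c_def by (rule mob_disc_translation[OF ab(1) w elim])
      thus ?case using f g disc_translation_in_disc[OF w elim] by (metis invariant_def)
    qed
  qed measurable
  finally show "avg \<mu> f (act g w) = avg \<mu> f w" .
qed

text \<open>The value \<open>k (disc_translation (- w) z)\<close> depends only on the distance of w
  and z, hence is symmetric and invariant under the diagonal action; exchanging the variables over
  the quotient does the rest.\<close>

lemma nn_integral_self_adjoint:
  assumes L: "has_radial_kernel L k"
    and f: "bounded_borel C f" "\<And>z. 0 \<le> f z" "invariant f"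
    and g: "bounded_borel C' g" "\<And>z. 0 \<le> g z" "invariant g"
  shows "(\<integral>\<^sup>+w. ennreal (g w) * ennreal (L f w) \<partial>quot) = (\<integral>\<^sup>+w. ennreal (f w) * ennreal (L g w) \<partial>quot)"
proof -
  have k [measurable]: "k \<in> borel_measurable borel"
    and k_rot: "\<And>c z. cmod c = 1 \<Longrightarrow> k (c * z) = k z"
    using L by (auto simp: has_radial_kernel_def)
  have Lk: "ennreal (L h w) = (\<integral>\<^sup>+y. k y * ennreal (h (disc_translation w y)) \<partial>hyp_area)"
    if "bounded_borel C h" "\<And>z. 0 \<le> h z" "cmod w < 1" for C h w
    using L that unfolding has_radial_kernel_def by blast
  have k_eq: "k x = k y" if "cmod x = cmod y" for x y
  proof (cases "y = 0")
    case False
    have "cmod (x / y) = 1" using that False by (simp add: norm_divide)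
    from k_rot[OF this, of y] show ?thesis using False by simp
  qed (use that in auto)
  note [measurable] = bounded_borelD[OF f(1)] bounded_borelD[OF g(1)]
  define K where "K w z = k (disc_translation (- w) z) * ennreal (f z) * ennreal (g w)" for w z
  have K1: "(\<integral>\<^sup>+z. k (disc_translation (- w) z) * ennreal (h z) \<partial>hyp_area) = ennreal (L h w)"
    if h: "bounded_borel C h" "\<And>z. 0 \<le> h z" and w: "cmod w < 1" for C h w
  proof -
    note [measurable] = bounded_borelD[OF h(1)]
    have "(\<integral>\<^sup>+z. k (disc_translation (- w) z) * ennreal (h z) \<partial>hyp_area)
      = (\<integral>\<^sup>+z. k (disc_translation (- w) (disc_translation w z)) * ennreal (h (disc_translation w z)) \<partial>hyp_area)"
      by (rule nn_integral_hyp_area_disc_translation[OF _ w, symmetric]) measurable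
    also have "\<dots> = (\<integral>\<^sup>+z. k z * ennreal (h (disc_translation w z)) \<partial>hyp_area)"
      by (rule nn_integral_cong_AE, use AE_hyp_area_disc in eventually_elim) (simp add: disc_translation_inverse w)
    also have "\<dots> = ennreal (L h w)" by (rule Lk[OF h w, symmetric])
    finally show ?thesis .
  qed
  have "(\<integral>\<^sup>+w. ennreal (g w) * ennreal (L f w) \<partial>quot) = (\<integral>\<^sup>+w. (\<integral>\<^sup>+z. K w z \<partial>hyp_area) \<partial>quot)"
  proof (rule nn_integral_cong_AE, use AE_quot_disc in eventually_elim)
    case (elim w)
    have "(\<integral>\<^sup>+z. K w z \<partial>hyp_area) = (\<integral>\<^sup>+z. k (disc_translation (- w) z) * ennreal (f z) \<partial>hyp_area) * ennreal (g w)"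
      unfolding K_def by (rule nn_integral_multc) measurable
    thus ?case unfolding K1[OF f(1,2) elim] by (simp add: mult.commute)
  qed
  also have "\<dots> = (\<integral>\<^sup>+z. (\<integral>\<^sup>+w. K w z \<partial>hyp_area) \<partial>quot)"
  proof (rule nn_integral_quotient_swap)
    show "(\<lambda>(w, z). K w z) \<in> borel_measurable (borel \<Otimes>\<^sub>M borel)" unfolding K_def by measurable
    fix h w z assume h: "h \<in> \<Gamma>" and w: "cmod w < 1" and z: "cmod z < 1"
    obtain a b where ab: "cmod b < cmod a" "act h = mob a b" using act_mob[OF h] by blast
    have "k (disc_translation (- act h w) (act h z)) = k (disc_translation (- w) z)"
      unfolding ab(2) by (rule k_eq, rule cmod_disc_translation_mob[OF ab(1) w z])
    thus "K (act h w) (act h z) = K w z"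
      using f(3) g(3) h w z by (simp add: K_def invariant_def)
  qed
  also have "\<dots> = (\<integral>\<^sup>+w. ennreal (f w) * ennreal (L g w) \<partial>quot)"
  proof (rule nn_integral_cong_AE, use AE_quot_disc in eventually_elim)
    case (elim z)
    have "(\<integral>\<^sup>+w. K w z \<partial>hyp_area) = (\<integral>\<^sup>+w. ennreal (f z) * (k (disc_translation (- z) w) * ennreal (g w)) \<partial>hyp_area)"
      unfolding K_def using k_eq[OF cmod_disc_translation_sym(2)] by (simp add: mult_ac)
    also have "\<dots> = ennreal (f z) * (\<integral>\<^sup>+w. k (disc_translation (- z) w) * ennreal (g w) \<partial>hyp_area)"
      by (rule nn_integral_cmult) measurable
    finally show ?case unfolding K1[OF g(1,2) elim] .
  qed
  finally show ?thesis .
qed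

lemma integral_self_adjoint:
  assumes L: "has_radial_kernel L k"
    and f: "bounded_borel C f" "\<And>z. 0 \<le> f z" "invariant f"
    and g: "bounded_borel C' g" "\<And>z. 0 \<le> g z" "invariant g"
    and Lf: "L f \<in> borel_measurable borel" "\<And>w. 0 \<le> L f w" and Lg: "L g \<in> borel_measurable borel" "\<And>w. 0 \<le> L g w"
  shows "(\<integral>w. g w * L f w \<partial>quot) = (\<integral>w. f w * L g w \<partial>quot)"
proof -
  note [measurable] = bounded_borelD[OF f(1)] bounded_borelD[OF g(1)] Lf(1) Lg(1)
  have "(\<integral>w. g w * L f w \<partial>quot) = enn2real (\<integral>\<^sup>+w. ennreal (g w * L f w) \<partial>quot)"
    by (rule integral_eq_nn_integral) (use g Lf in auto)
  also have "(\<integral>\<^sup>+w. ennreal (g w * L f w) \<partial>quot) = (\<integral>\<^sup>+w. ennreal (f w * L g w) \<partial>quot)"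
    using nn_integral_self_adjoint[OF L f g] f(2) g(2) Lf(2) Lg(2) by (simp add: ennreal_mult)
  also have "enn2real \<dots> = (\<integral>w. f w * L g w \<partial>quot)"
    by (rule integral_eq_nn_integral[symmetric]) (use f Lg in auto)
  finally show ?thesis .
qed

end

section \<open>Almost convex functions vary slowly\<close>

text \<open>The increment H (q + c) - H q drops by at most e when q advances by c. A large value at
  p would persist over the n following steps, and a very negative one would have been nearly as
  negative over the n preceding steps; after summation either contradicts |H| \<le> C. Hence the
  room of n c below p.\<close>

lemma almost_convex_increment:
  fixes H :: "real \<Rightarrow> real" and n :: nat and s p c e C :: real
  assumes bound: "\<And>p. p \<ge> s \<Longrightarrow> \<bar>H p\<bar> \<le> C"
    and conv: "\<And>p q. p \<ge> s \<Longrightarrow> q \<ge> s \<Longrightarrow> H p + H q - 2 * H ((p + q) / 2) \<ge> - e"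
    and n: "n > 0" and c: "c \<ge> 0" and p: "p \<ge> s + n * c" and "e \<ge> 0"
  shows "\<bar>H (p + c) - H p\<bar> \<le> 2 * C / n + e * n"
proof -
  define d where "d q = H (q + c) - H q" for q
  have step: "d (q + c) \<ge> d q - e" if "q \<ge> s" for q :: real
  proof -
    have eq: "(q + (q + 2 * c)) / 2 = q + c" "q + c + c = q + 2 * c" by auto
    have "H q + H (q + 2 * c) - 2 * H ((q + (q + 2 * c)) / 2) \<ge> - e"
      using that c by (intro conv) auto
    thus ?thesis unfolding d_def eq by linarith
  qed
  have steps: "d (q + real k * c) \<ge> d q - k * e" if "q \<ge> s" for q and k :: nat
  proof (induction k)
    case (Suc k)
    have "q + real k * c \<ge> s" using that c by (simp add: add_increasing2)
    from step[OF this] Suc show ?case by (simp add: algebra_simps)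
  qed simp
  have tel: "(\<Sum>k<m. d (q + real k * c)) = H (q + real m * c) - H q" for q and m :: nat
    by (induction m) (simp_all add: d_def algebra_simps)
  have ps: "p \<ge> s" using p c n by (smt (verit) mult_nonneg_nonneg of_nat_0_le_iff)
  have "real n * (d p - n * e) = (\<Sum>k<n. d p - n * e)" by simp
  also have "\<dots> \<le> (\<Sum>k<n. d (p + real k * c))"
  proof (rule sum_mono)
    fix k assume "k \<in> {..<n}"
    hence "real k * e \<le> n * e" using \<open>e \<ge> 0\<close> by (intro mult_right_mono) auto
    with steps[OF ps, of k] show "d p - n * e \<le> d (p + real k * c)" by linarith
  qed
  also have "\<dots> = H (p + real n * c) - H p" by (rule tel)
  also have "\<dots> \<le> 2 * C"
    using bound[of p] bound[of "p + real n * c"] ps c by (simp add: abs_le_iff add_increasing2)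
  finally have U: "d p \<le> 2 * C / n + e * n"
    using n by (simp add: field_simps)
  define q where "q = p - real n * c"
  have qs: "q \<ge> s" using p by (simp add: q_def)
  have "- 2 * C \<le> H (q + real n * c) - H q"
    using bound[of q] bound[of "q + real n * c"] ps qs c by (simp add: abs_le_iff add_increasing2)
  also have "\<dots> = (\<Sum>k<n. d (q + real k * c))" by (rule tel[symmetric])
  also have "\<dots> \<le> (\<Sum>k<n. d p + n * e)"
  proof (rule sum_mono)
    fix k assume k: "k \<in> {..<n}"
    have "q + real k * c \<ge> s" using qs c by (simp add: add_increasing2)
    have p_eq: "q + real k * c + (real n - real k) * c = p" by (simp add: q_def algebra_simps)
    from steps[OF \<open>q + real k * c \<ge> s\<close>, of "n - k"] k
    have "d (q + real k * c + (real n - real k) * c) \<ge> d (q + real k * c) - (real n - real k) * e"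
      by (simp add: of_nat_diff)
    note this[unfolded p_eq]
    moreover have "(real n - real k) * e \<le> n * e" using \<open>e \<ge> 0\<close> by (intro mult_right_mono) auto
    ultimately show "d (q + real k * c) \<le> d p + n * e" by linarith
  qed
  also have "\<dots> = real n * (d p + n * e)" by simp
  finally have "- (2 * C / n + e * n) \<le> d p"
    using n by (simp add: field_simps)
  with U show ?thesis by (simp add: d_def abs_le_iff)
qed

text \<open>Up to small errors \<Psi> a b = H (a + b) with H p = \<Psi> (p/2) (p/2), so the
  expression is the difference of two consecutive increments of H with step b - a. Positivity for
  distant a and b supplies the almost convexity, which makes each increment small.\<close>

lemma hankel_slow_variation:
  fixes \<Psi> :: "real \<Rightarrow> real \<Rightarrow> real"
  assumes bound: "\<And>a b. a \<ge> 0 \<Longrightarrow> b \<ge> 0 \<Longrightarrow> \<bar>\<Psi> a b\<bar> \<le> C"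
    and pos: "\<And>a b. a \<ge> 0 \<Longrightarrow> b \<ge> 0 \<Longrightarrow> \<Psi> a a + \<Psi> b b - 2 * \<Psi> a b \<ge> 0"
    and sym: "\<And>a b. \<Psi> a b = \<Psi> b a"
    and hankel: "\<And>e. e > 0 \<Longrightarrow> \<exists>T\<ge>0. \<forall>a\<ge>T. \<forall>b\<ge>T. \<forall>a'\<ge>T. \<forall>b'\<ge>T.
        a + b = a' + b' \<longrightarrow> \<bar>\<Psi> a b - \<Psi> a' b'\<bar> \<le> e"
    and e: "e > 0" and B: "B \<ge> 0"
  shows "\<exists>T\<ge>0. \<forall>a\<ge>T. \<forall>b\<ge>T. \<bar>a - b\<bar> \<le> B \<longrightarrow> \<Psi> a a + \<Psi> b b - 2 * \<Psi> a b \<le> e"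
proof -
  have C: "C \<ge> 0" using bound[of 0 0] by simp
  obtain n :: nat where n: "n > 0" "2 * C / n \<le> e / 8"
  proof -
    obtain m :: nat where "16 * C / e < m" using reals_Archimedean2 by blast
    hence "2 * C / Suc m \<le> e / 8" using e by (simp add: field_simps)
    thus ?thesis using that[of "Suc m"] by simp
  qed
  \<comment> \<open>The convexity defect is 2 h per midpoint; n steps accumulate 2 h n = e/8,
    matching 2 C / n \<le> e/8, so that increments stay within e/4.\<close>
  define h where "h = e / (16 * real n)"
  have h: "h > 0" "h \<le> e / 16" "2 * h * n = e / 8"
    using e n(1) by (auto simp: h_def field_simps)
  obtain T where T: "T \<ge> 0" "\<And>a b a' b'. a \<ge> T \<Longrightarrow> b \<ge> T \<Longrightarrow> a' \<ge> T \<Longrightarrow> b' \<ge> T \<Longrightarrow>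
        a + b = a' + b' \<Longrightarrow> \<bar>\<Psi> a b - \<Psi> a' b'\<bar> \<le> h"
    using hankel[OF h(1)] by blast
  define H where "H p = \<Psi> (p / 2) (p / 2)" for p
  have near: "\<bar>\<Psi> a b - H (a + b)\<bar> \<le> h" if "a \<ge> T" "b \<ge> T" for a b
    unfolding H_def using that by (intro T(2)) auto
  have conv: "H p + H q - 2 * H ((p + q) / 2) \<ge> - (2 * h)" if "p \<ge> 2 * T" "q \<ge> 2 * T" for p q
  proof -
    have "\<Psi> (p / 2) (p / 2) + \<Psi> (q / 2) (q / 2) - 2 * \<Psi> (p / 2) (q / 2) \<ge> 0"
      using that T(1) by (intro pos) auto
    moreover have "\<bar>\<Psi> (p / 2) (q / 2) - H (p / 2 + q / 2)\<bar> \<le> h" using that by (intro near) auto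
    moreover have "p / 2 + q / 2 = (p + q) / 2" by simp
    ultimately show ?thesis unfolding H_def[of p] H_def[of q] by (simp add: abs_le_iff)
  qed
  have incr: "\<bar>H (p + c) - H p\<bar> \<le> e / 4" if "c \<ge> 0" "c \<le> B" "p \<ge> 2 * T + n * B" for p c
  proof -
    have "\<bar>H (p + c) - H p\<bar> \<le> 2 * C / n + 2 * h * n"
    proof (rule almost_convex_increment[where s = "2 * T"])
      have "real n * c \<le> n * B" using that by (intro mult_left_mono) auto
      thus "p \<ge> 2 * T + real n * c" using that by linarith
      show "\<bar>H p\<bar> \<le> C" if "2 * T \<le> p" for p
        unfolding H_def using that T(1) by (intro bound) auto
    qed (use conv n h that in auto)
    thus ?thesis using n h by linarith
  qed
  \<comment> \<open>The n backward steps, each of length at most B, must stay in the range where the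
    estimates hold.\<close>
  define T' where "T' = T + n * B"
  have nB: "real n * B \<ge> 0" using B by simp
  have T': "T' \<ge> 0" "T' \<ge> T" using T(1) B by (auto simp: T'_def)
  have main: "\<Psi> a a + \<Psi> b b - 2 * \<Psi> a b \<le> e" if ab: "a \<ge> T'" "a \<le> b" "b - a \<le> B" for a b
  proof -
    have "a \<ge> T" "b \<ge> T" using ab T' by linarith+
    hence "\<bar>\<Psi> a b - H (a + b)\<bar> \<le> h" by (intro near)
    moreover have "\<Psi> a a = H (2 * a)" "\<Psi> b b = H (2 * b)" by (simp_all add: H_def)
    moreover have eq: "2 * a + (b - a) = a + b" "a + b + (b - a) = 2 * b" by auto
    have "\<bar>H (2 * a + (b - a)) - H (2 * a)\<bar> \<le> e / 4"
      "\<bar>H ((a + b) + (b - a)) - H (a + b)\<bar> \<le> e / 4"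
      using ab[unfolded T'_def] nB T(1) by (intro incr; linarith)+
    note this[unfolded eq]
    ultimately show ?thesis using h(2) e unfolding abs_le_iff by linarith
  qed
  show ?thesis
  proof (intro exI conjI allI impI)
    fix a b assume ab: "a \<ge> T'" "b \<ge> T'" "\<bar>a - b\<bar> \<le> B"
    show "\<Psi> a a + \<Psi> b b - 2 * \<Psi> a b \<le> e"
    proof (cases "a \<le> b")
      case True thus ?thesis using main[of a b] ab by auto
    next
      case False thus ?thesis using main[of b a] ab sym[of a b] by auto
    qed
  qed (rule T'(1))
qed

section \<open>Uniform continuity and large circles\<close>

text \<open>Uniform continuity for the hyperbolic metric, with distances measured after w has been
  translated to 0.\<close>

definition hyp_uniformly_continuous :: "(complex \<Rightarrow> real) \<Rightarrow> bool" where
  "hyp_uniformly_continuous f \<longleftrightarrow> (\<forall>e>0. \<exists>d>0. \<forall>w z. cmod w < 1 \<longrightarrow> cmod z < 1 \<longrightarrow> cmod z < d \<longrightarrow>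
     \<bar>f (disc_translation w z) - f w\<bar> \<le> e)"

lemma avg_translate:
  assumes mu: "radial_prob \<mu>" and [measurable]: "f \<in> borel_measurable borel" and w: "cmod w < 1" and z: "cmod z < 1"
  shows "avg \<mu> f (disc_translation w z) = (\<integral>y. f (disc_translation w (disc_translation z y)) \<partial>\<mu>)"
proof -
  have [measurable_cong]: "sets \<mu> = sets borel" using mu by (rule radial_probD)
  define c where "c = (1 + w * cnj z) / (cnj 1 + cnj w * z)"
  have *: "disc_translation w (disc_translation z y) = disc_translation (disc_translation w z) (c * y)" if "cmod y < 1" for y
    unfolding disc_translation_eq_mob[of w] c_def by (rule mob_disc_translation) (use w z that in auto)
  have c: "cmod c = 1" unfolding c_def by (rule mob_disc_translation(2)[of _ _ _ 0]) (use z w in auto)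
  have "avg \<mu> f (disc_translation w z) = (\<integral>y. f (disc_translation (disc_translation w z) (c * y)) \<partial>\<mu>)"
    unfolding avg_def by (rule integral_radial_rotate[OF mu _ c, symmetric]) measurable
  also have "\<dots> = (\<integral>y. f (disc_translation w (disc_translation z y)) \<partial>\<mu>)"
    by (rule integral_cong_AE) (use radial_probD(3)[OF mu] * in \<open>auto elim!: eventually_mono\<close>)
  finally show ?thesis .
qed

lemma AE_lborel_not_in_negligible:
  fixes S :: "'a::euclidean_space set"
  assumes "negligible S" "S \<in> sets borel"
  shows "AE y in lborel. y \<notin> S"
  using assms by (intro AE_not_in) (simp add: negligible_iff_null_sets null_sets_completion_iff)

text \<open>Continuity of translation in the mean for the indicator of a ball: pointwise convergence
  can fail only on the boundary circle, which is null, and the translated balls eventually lie in a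
  slightly larger ball.\<close>

lemma disc_kernel_translate_tendsto:
  fixes x :: "nat \<Rightarrow> complex"
  assumes r: "0 < r" "r < 1" and x1: "\<And>n. cmod (x n) < 1" and x: "x \<longlonglongrightarrow> 0"
  defines "k \<equiv> \<lambda>y::complex. if cmod y < r then 1 else 0 :: real"
  shows "(\<lambda>n. \<integral>y. \<bar>k (disc_translation (- x n) y) - k y\<bar> \<partial>hyp_area) \<longlonglongrightarrow> 0"
proof -
  have [measurable]: "k \<in> borel_measurable borel" unfolding k_def by measurable
  define R where "R = (1 + r) / 2"
  have R: "r < R" "R < 1" "0 < R" using r by (auto simp: R_def)
  \<comment> \<open>The translation by x maps the ball of radius r into that of radius (r + |x|) /
    (1 - |x|).\<close>
  have "\<forall>\<^sub>F n in sequentially. (r + cmod (x n)) / (1 - cmod (x n)) < R"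
  proof (rule order_tendstoD)
    show "(\<lambda>n. (r + cmod (x n)) / (1 - cmod (x n))) \<longlonglongrightarrow> (r + cmod 0) / (1 - cmod (0::complex))"
      by (intro tendsto_intros x) simp
  qed (use R in simp)
  then obtain N where N: "\<And>n. n \<ge> N \<Longrightarrow> (r + cmod (x n)) / (1 - cmod (x n)) < R"
    by (auto simp: eventually_sequentially)
  have dom: "\<bar>k (disc_translation (- x n) y) - k y\<bar> \<le> (if cmod y < R then 1 else 0)"
    if n: "n \<ge> N" and y: "cmod y < 1" for n y
  proof -
    have "cmod y < R" if "cmod (disc_translation (- x n) y) < r"
    proof -
      define y' where "y' = disc_translation (- x n) y"
      have y': "cmod y' < r" "y = disc_translation (x n) y'"
        using that y x1 by (auto simp: y'_def disc_translation_inverse')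
      have a: "cmod (y' + x n) \<le> r + cmod (x n)"
        using norm_triangle_ineq[of y' "x n"] y'(1) by linarith
      have "cmod (cnj (x n) * y') \<le> cmod (x n)"
        using y'(1) r norm_le_disc[of y' "cnj (x n)"] by simp
      hence b: "cmod (1 + cnj (x n) * y') \<ge> 1 - cmod (x n)"
        using norm_triangle_ineq2[of 1 "- (cnj (x n) * y')"] by simp
      have "cmod y \<le> (r + cmod (x n)) / (1 - cmod (x n))"
        unfolding y'(2) disc_translation_def norm_divide
        using a b x1[of n] r by (intro frac_le) auto
      thus ?thesis using N[OF n] by linarith
    qed
    thus ?thesis using R by (auto simp: k_def)
  qed
  have "(\<lambda>n. \<integral>y. \<bar>k (disc_translation (- x (n + N)) y) - k y\<bar> \<partial>hyp_area) \<longlonglongrightarrow> (\<integral>y. 0 \<partial>hyp_area)"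
  proof (rule integral_dominated_convergence[where w = "\<lambda>y. indicator (ball 0 R) y"])
    show "integrable hyp_area (indicator (ball 0 R) :: complex \<Rightarrow> real)"
      using emeasure_hyp_area_ball(2)[OF R(3,2)] by (intro integrable_real_indicator) auto
    show "AE y in hyp_area. norm \<bar>k (disc_translation (- x (n + N)) y) - k y\<bar> \<le> indicator (ball 0 R) y" for n
      using AE_hyp_area_disc
    proof eventually_elim
      case (elim y) thus ?case using dom[of "n + N" y] by (cases "cmod y < R") (simp_all add: indicator_def)
    qed
    have "negligible (sphere (0::complex) r)" by (rule negligible_sphere)
    hence "AE y in lborel. y \<notin> sphere (0::complex) r"
      by (rule AE_lborel_not_in_negligible) simp
    hence "AE y in hyp_area. y \<notin> sphere 0 r"
      unfolding hyp_area_def using hyp_area_dens_measurable by (subst AE_density) auto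
    thus "AE y in hyp_area. (\<lambda>n. \<bar>k (disc_translation (- x (n + N)) y) - k y\<bar>) \<longlonglongrightarrow> 0"
    proof eventually_elim
      case (elim y)
      have x': "(\<lambda>n. x (n + N)) \<longlonglongrightarrow> 0" using x by (rule LIMSEQ_ignore_initial_segment)
      have "(\<lambda>n. cmod (disc_translation (- x (n + N)) y)) \<longlonglongrightarrow> cmod (disc_translation (- 0) y)"
        unfolding disc_translation_def by (intro tendsto_intros x') simp
      hence lim: "(\<lambda>n. cmod (disc_translation (- x (n + N)) y)) \<longlonglongrightarrow> cmod y" by simp
      have "\<forall>\<^sub>F n in sequentially. \<bar>k (disc_translation (- x (n + N)) y) - k y\<bar> = 0"
      proof (cases "cmod y < r")
        case True
        from order_tendstoD(2)[OF lim this] show ?thesis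
          by eventually_elim (use True in \<open>simp add: k_def\<close>)
      next
        case False
        hence "r < cmod y" using elim by (simp add: dist_norm)
        from order_tendstoD(1)[OF lim this] show ?thesis
          by eventually_elim (use False in \<open>simp add: k_def\<close>)
      qed
      thus ?case by (simp add: tendsto_eventually)
    qed
  qed auto
  thus ?thesis by (simp add: LIMSEQ_offset)
qed

lemma integral_hyp_disc:
  assumes r: "0 < r" "r < 1" and [measurable]: "g \<in> borel_measurable borel"
  shows "(\<integral>y. g y \<partial>hyp_disc r) = (LINT y:ball 0 r|hyp_area. g y) / measure hyp_area (ball 0 r)"
proof -
  define A where "A = measure hyp_area (ball 0 r)"
  have fin: "emeasure hyp_area (ball 0 r) < \<infinity>" and A: "A > 0"
    using emeasure_hyp_area_ball[OF r] by (auto simp: A_def measure_def enn2real_positive_iff)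
  have emA: "emeasure hyp_area (ball 0 r) = ennreal A"
    using fin unfolding A_def by (intro emeasure_eq_ennreal_measure) auto
  have D: "hyp_disc r = density hyp_area (\<lambda>y. ennreal ((if cmod y < r then 1 else 0) / A))"
    unfolding hyp_disc_eq_density
    by (intro arg_cong[of _ _ "density hyp_area"] ext)
       (simp add: disc_kernel_def emA A inverse_ennreal divide_inverse)
  have "(\<integral>y. g y \<partial>hyp_disc r) = (\<integral>y. (if cmod y < r then 1 else 0) / A * g y \<partial>hyp_area)"
    unfolding D using A by (subst integral_density) auto
  also have "\<dots> = (\<integral>y. indicator (ball 0 r) y *\<^sub>R g y / A \<partial>hyp_area)"
    by (rule Bochner_Integration.integral_cong) (auto simp: indicator_def)
  finally show ?thesis by (simp add: set_lebesgue_integral_def A_def)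
qed

text \<open>Moving the base point from w to its translate by z only moves the kernel, so the
  difference is at most |C| / A times the mean distance between the kernel and its translate. Hence
  one d serves all h with the same bound, which later makes a whole family equicontinuous.\<close>

lemma hyp_disc_equicontinuous:
  assumes r: "0 < r" "r < 1" and e: "e > 0"
  shows "\<exists>d>0. \<forall>h w z. bounded_borel C h \<longrightarrow> cmod w < 1 \<longrightarrow> cmod z < 1 \<longrightarrow> cmod z < d \<longrightarrow>
     \<bar>avg (hyp_disc r) h (disc_translation w z) - avg (hyp_disc r) h w\<bar> \<le> e"
proof -
  define k where "k y = (if cmod y < r then 1 else 0 :: real)" for y :: complex
  have [measurable]: "k \<in> borel_measurable borel" unfolding k_def by measurable
  define A where "A = measure hyp_area (ball 0 r)"
  have fin: "emeasure hyp_area (ball 0 r) < \<infinity>" and A: "A > 0"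
    using emeasure_hyp_area_ball[OF r] by (auto simp: A_def measure_def enn2real_positive_iff)
  have int: "(\<integral>y. g y \<partial>hyp_disc r) = (\<integral>y. k y / A * g y \<partial>hyp_area)"
    if g: "g \<in> borel_measurable borel" for g :: "complex \<Rightarrow> real"
  proof -
    have "(\<integral>y. g y \<partial>hyp_disc r) = (\<integral>y. indicator (ball 0 r) y *\<^sub>R g y / A \<partial>hyp_area)"
      by (simp add: integral_hyp_disc[OF r g] set_lebesgue_integral_def A_def)
    also have "\<dots> = (\<integral>y. k y / A * g y \<partial>hyp_area)"
      by (rule Bochner_Integration.integral_cong) (auto simp: k_def indicator_def)
    finally show ?thesis .
  qed
  have "\<bar>avg (hyp_disc r) h (disc_translation w z) - avg (hyp_disc r) h w\<bar>
      \<le> \<bar>C\<bar> / A * (\<integral>y. \<bar>k (disc_translation (- z) y) - k y\<bar> \<partial>hyp_area)"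
    if h: "bounded_borel C h" and w: "cmod w < 1" and z: "cmod z < 1" for h w z
  proof -
    note [measurable] = bounded_borelD[OF h]
    have kint: "integrable hyp_area k"
    proof -
      have "k = indicator (ball 0 r)" by (auto simp: k_def indicator_def)
      thus ?thesis using fin by (auto intro!: integrable_real_indicator)
    qed
    have dist: "distr hyp_area borel (disc_translation z) = hyp_area"
      using z by (rule distr_hyp_area_disc_translation)
    have kint': "integrable hyp_area (\<lambda>y. k (disc_translation (- z) y))"
    proof -
      have "distr hyp_area borel (disc_translation (- z)) = hyp_area"
        using z by (intro distr_hyp_area_disc_translation) simp
      thus ?thesis using kint integrable_distr_eq[of "disc_translation (- z)" hyp_area borel k]
        by (simp cong: measurable_cong_sets)
    qed
    have bnd: "\<bar>h y\<bar> \<le> \<bar>C\<bar>" for y using bounded_borel_bound[OF h, of y] by simp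
    have prod: "integrable hyp_area (\<lambda>y. q y / A * h (disc_translation w y))"
      if "integrable hyp_area q" for q
    proof (rule Bochner_Integration.integrable_bound[of _ "\<lambda>y. \<bar>C\<bar> / A * q y"])
      show "AE y in hyp_area. norm (q y / A * h (disc_translation w y)) \<le> norm (\<bar>C\<bar> / A * q y)"
      proof (rule AE_I2)
        fix y
        have "\<bar>q y\<bar> * \<bar>h (disc_translation w y)\<bar> / A \<le> \<bar>q y\<bar> * \<bar>C\<bar> / A"
          using A by (intro divide_right_mono mult_left_mono bnd) auto
        thus "norm (q y / A * h (disc_translation w y)) \<le> norm (\<bar>C\<bar> / A * q y)"
          using A by (simp add: abs_mult mult.commute)
      qed
      have [measurable]: "q \<in> borel_measurable hyp_area" using that by auto
      show "(\<lambda>y. q y / A * h (disc_translation w y)) \<in> borel_measurable hyp_area" by measurable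
    qed (use that in auto)
    have "avg (hyp_disc r) h (disc_translation w z) = (\<integral>y. h (disc_translation w (disc_translation z y)) \<partial>hyp_disc r)"
      by (rule avg_translate[OF radial_prob_hyp_disc[OF r] _ w z]) measurable
    also have "\<dots> = (\<integral>y. k y / A * h (disc_translation w (disc_translation z y)) \<partial>hyp_area)"
      by (rule int) measurable
    also have "\<dots> = (\<integral>y. k (disc_translation (- z) (disc_translation z y)) / A * h (disc_translation w (disc_translation z y)) \<partial>hyp_area)"
    proof (rule integral_cong_AE)
      show "AE y in hyp_area. k y / A * h (disc_translation w (disc_translation z y))
          = k (disc_translation (- z) (disc_translation z y)) / A * h (disc_translation w (disc_translation z y))"
        using AE_hyp_area_disc by eventually_elim (simp add: disc_translation_inverse z)
    qed measurable
    also have "\<dots> = (\<integral>y. k (disc_translation (- z) y) / A * h (disc_translation w y) \<partial>distr hyp_area borel (disc_translation z))"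
      by (subst integral_distr) (auto cong: measurable_cong_sets)
    finally have 1: "avg (hyp_disc r) h (disc_translation w z) = (\<integral>y. k (disc_translation (- z) y) / A * h (disc_translation w y) \<partial>hyp_area)"
      unfolding dist .
    have 2: "avg (hyp_disc r) h w = (\<integral>y. k y / A * h (disc_translation w y) \<partial>hyp_area)"
      unfolding avg_def by (rule int) measurable
    have "avg (hyp_disc r) h (disc_translation w z) - avg (hyp_disc r) h w
      = (\<integral>y. (k (disc_translation (- z) y) - k y) / A * h (disc_translation w y) \<partial>hyp_area)"
      unfolding 1 2 using prod[OF kint] prod[OF kint']
      by (subst Bochner_Integration.integral_diff[symmetric]) (auto simp: diff_divide_distrib left_diff_distrib)
    hence "\<bar>avg (hyp_disc r) h (disc_translation w z) - avg (hyp_disc r) h w\<bar>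
      \<le> (\<integral>y. \<bar>(k (disc_translation (- z) y) - k y) / A * h (disc_translation w y)\<bar> \<partial>hyp_area)"
      by (simp only: integral_abs_bound)
    also have "\<dots> \<le> (\<integral>y. \<bar>C\<bar> / A * \<bar>k (disc_translation (- z) y) - k y\<bar> \<partial>hyp_area)"
    proof (rule integral_mono)
      show "integrable hyp_area (\<lambda>y. \<bar>(k (disc_translation (- z) y) - k y) / A * h (disc_translation w y)\<bar>)"
        by (intro integrable_abs prod Bochner_Integration.integrable_diff kint kint')
      show "integrable hyp_area (\<lambda>y. \<bar>C\<bar> / A * \<bar>k (disc_translation (- z) y) - k y\<bar>)"
        by (intro integrable_mult_right integrable_abs Bochner_Integration.integrable_diff kint kint')
      fix y
      have "\<bar>k (disc_translation (- z) y) - k y\<bar> * \<bar>h (disc_translation w y)\<bar> \<le> \<bar>k (disc_translation (- z) y) - k y\<bar> * \<bar>C\<bar>"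
        by (intro mult_left_mono bnd) auto
      hence "\<bar>k (disc_translation (- z) y) - k y\<bar> * \<bar>h (disc_translation w y)\<bar> / A \<le> \<bar>k (disc_translation (- z) y) - k y\<bar> * \<bar>C\<bar> / A"
        using A by (intro divide_right_mono) auto
      thus "\<bar>(k (disc_translation (- z) y) - k y) / A * h (disc_translation w y)\<bar> \<le> \<bar>C\<bar> / A * \<bar>k (disc_translation (- z) y) - k y\<bar>"
        using A by (simp add: abs_mult mult.commute)
    qed
    finally show ?thesis by simp
  qed
  note bound = this
  show ?thesis
  proof (rule ccontr)
    assume "\<not> ?thesis"
    hence "\<forall>n. \<exists>h w z. bounded_borel C h \<and> cmod w < 1 \<and> cmod z < 1 \<and> cmod z < inverse (real (Suc n)) \<and>
      \<bar>avg (hyp_disc r) h (disc_translation w z) - avg (hyp_disc r) h w\<bar> > e"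
      by (metis not_le inverse_positive_iff_positive of_nat_0_less_iff zero_less_Suc)
    then obtain h w x where hwx: "\<And>n. bounded_borel C (h n)" "\<And>n. cmod (w n) < 1" "\<And>n. cmod (x n) < 1"
      "\<And>n. cmod (x n) < inverse (real (Suc n))"
      "\<And>n. \<bar>avg (hyp_disc r) (h n) (disc_translation (w n) (x n)) - avg (hyp_disc r) (h n) (w n)\<bar> > e"
      by metis
    have "x \<longlonglongrightarrow> 0"
      by (rule tendsto_norm_zero_cancel, rule tendsto_sandwich[OF _ _ tendsto_const LIMSEQ_inverse_real_of_nat])
         (use hwx(4) in \<open>auto intro!: always_eventually less_imp_le\<close>)
    from disc_kernel_translate_tendsto[OF r hwx(3) this]
    have "(\<lambda>n. \<bar>C\<bar> / A * (\<integral>y. \<bar>k (disc_translation (- x n) y) - k y\<bar> \<partial>hyp_area)) \<longlonglongrightarrow> \<bar>C\<bar> / A * 0"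
      unfolding k_def by (intro tendsto_mult tendsto_const)
    hence "\<forall>\<^sub>F n in sequentially. \<bar>C\<bar> / A * (\<integral>y. \<bar>k (disc_translation (- x n) y) - k y\<bar> \<partial>hyp_area) < e"
      using e by (intro order_tendstoD) auto
    then obtain n where "\<bar>C\<bar> / A * (\<integral>y. \<bar>k (disc_translation (- x n) y) - k y\<bar> \<partial>hyp_area) < e"
      by (auto simp: eventually_sequentially)
    with bound[OF hwx(1-3)[of n]] hwx(5)[of n] show False by linarith
  qed
qed

lemma hyp_uniformly_continuous_hyp_disc:
  assumes "0 < r" "r < 1" "bounded_borel C f"
  shows "hyp_uniformly_continuous (avg (hyp_disc r) f)"
  unfolding hyp_uniformly_continuous_def
proof (intro allI impI)
  fix e :: real assume "e > 0"
  from hyp_disc_equicontinuous[OF assms(1,2) this, of C] assms(3)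
  show "\<exists>d>0. \<forall>w z. cmod w < 1 \<longrightarrow> cmod z < 1 \<longrightarrow> cmod z < d \<longrightarrow>
    \<bar>avg (hyp_disc r) f (disc_translation w z) - avg (hyp_disc r) f w\<bar> \<le> e" by meson
qed

text \<open>At equal angles the two circles have points at pseudohyperbolic distance |s - r| / (1 -
  r s), wherever the centre w is.\<close>

lemma avg_hyp_circle_radius_continuous:
  assumes f: "bounded_borel C f"
    and d: "\<And>w z. cmod w < 1 \<Longrightarrow> cmod z < 1 \<Longrightarrow> cmod z < d \<Longrightarrow> \<bar>f (disc_translation w z) - f w\<bar> \<le> e"
    and w: "cmod w < 1" and r: "0 \<le> r" "r < 1" "0 \<le> s" "s < 1" and rs: "\<bar>s - r\<bar> / (1 - r * s) < d"
  shows "\<bar>avg (hyp_circle s) f w - avg (hyp_circle r) f w\<bar> \<le> e"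
proof -
  interpret tau: prob_space circle_measure by (rule prob_space_circle_measure)
  note [measurable] = bounded_borelD[OF f]
  define t where "t = (s - r) / (1 - r * s)"
  have rs1: "r * s < 1" using r by (metis less_1_mult mult_less_cancel_left1 not_less_iff_gr_or_eq mult_le_one less_eq_real_def mult_right_le_one_le order_le_less_trans)
  have t_eq: "disc_translation (- of_real r) (of_real s) = of_real t"
    by (simp add: disc_translation_def t_def)
  have t1: "cmod (of_real t) < 1"
    unfolding t_eq[symmetric] using r by (intro disc_translation_in_disc) auto
  have td: "cmod (of_real t) < d" using rs rs1 unfolding norm_of_real t_def by simp
  have st: "of_real s = disc_translation (of_real r) (of_real t)"
    unfolding t_eq[symmetric] using r by (intro disc_translation_inverse'[symmetric]) auto
  have int: "integrable circle_measure (\<lambda>u. f (disc_translation w (u * of_real r)))" for r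
    by (rule bounded_borel_integrable[OF _ _ f]) (auto simp: tau.prob_space_axioms)
  have "\<bar>avg (hyp_circle s) f w - avg (hyp_circle r) f w\<bar>
    \<le> (\<integral>u. \<bar>f (disc_translation w (u * of_real s)) - f (disc_translation w (u * of_real r))\<bar> \<partial>circle_measure)"
    unfolding avg_hyp_circle[OF bounded_borelD[OF f]]
    by (subst Bochner_Integration.integral_diff[symmetric, OF int int]) (rule integral_abs_bound)
  also have "\<dots> \<le> (\<integral>u. e \<partial>circle_measure)"
  proof (rule integral_mono_AE)
    show "AE u in circle_measure. \<bar>f (disc_translation w (u * of_real s)) - f (disc_translation w (u * of_real r))\<bar> \<le> e"
      using AE_circle_measure
    proof eventually_elim
      case (elim u)
      have ur: "cmod (u * of_real r) < 1" and ut: "cmod (u * of_real t) < 1"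
        using elim r t1 by (auto simp: norm_mult)
      have us: "u * of_real s = disc_translation (u * of_real r) (u * of_real t)"
        unfolding st by (rule disc_translation_rotate[OF elim, symmetric])
      define c where "c = (1 + w * cnj (u * of_real r)) / (cnj 1 + cnj w * (u * of_real r))"
      have c: "cmod c = 1" unfolding c_def by (rule mob_disc_translation(2)[of _ _ _ 0]) (use w ur in auto)
      have "disc_translation w (u * of_real s) = disc_translation (disc_translation w (u * of_real r)) (c * (u * of_real t))"
        unfolding disc_translation_eq_mob[of w] us c_def by (rule mob_disc_translation) (use w ur ut in auto)
      moreover have "cmod (c * (u * of_real t)) = cmod (of_real t)" using c elim by (simp add: norm_mult)
      ultimately show ?case
        using d[OF disc_translation_in_disc[OF w ur], of "c * (u * of_real t)"] t1 td by simp
    qed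
  qed (auto intro!: integrable_abs Bochner_Integration.integrable_diff int)
  finally show ?thesis by (simp add: tau.prob_space)
qed

text \<open>In this scale composing circle averages adds the parameters, up to a bounded error.\<close>

definition rad :: "real \<Rightarrow> real" where
  "rad a = sqrt (1 - exp (- a))"

lemma rad:
  assumes "a \<ge> 0"
  shows "0 \<le> rad a" "rad a < 1" "1 - (rad a)\<^sup>2 = exp (- a)"
  using assms by (auto simp: rad_def)

lemma rad_tendsto: "(rad \<longlongrightarrow> 1) at_top"
  unfolding rad_def by real_asymp

text \<open>Numerator and denominator of the distance both scale with E: x^2 - y^2 = E (q - q') / (q
  q'), and 1 - x y is at least the mean of 1 - x^2 and 1 - y^2. So E cancels, and radii very near 1
  are hyperbolically close as soon as q and q' are close.\<close>

lemma disc_distance_bound: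
  fixes x y q q' E :: real
  assumes "0 \<le> x" "x < 1" "0 \<le> y" "y < 1" "E > 0" "q > 0" "q' > 0"
    and xq: "1 - x\<^sup>2 = E / q" and yq: "1 - y\<^sup>2 = E / q'" and "x + y > 0"
  shows "\<bar>x - y\<bar> / (1 - y * x) \<le> 2 * \<bar>q - q'\<bar> / ((q + q') * (x + y))"
proof -
  have "y * x < 1 * 1" using assms by (intro mult_strict_mono) auto
  hence xy: "1 - y * x > 0" by simp
  have "\<bar>x - y\<bar> * (x + y) = \<bar>x\<^sup>2 - y\<^sup>2\<bar>"
  proof -
    have "x\<^sup>2 - y\<^sup>2 = (x - y) * (x + y)" by (simp add: power2_eq_square algebra_simps)
    thus ?thesis using assms by (simp add: abs_mult)
  qed
  also have "x\<^sup>2 - y\<^sup>2 = E / q' - E / q" using xq yq by linarith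
  also have "\<dots> = E * (q - q') / (q * q')" using assms by (simp add: field_simps)
  also have "\<bar>\<dots>\<bar> = E * \<bar>q - q'\<bar> / (q * q')" using assms by (simp add: abs_mult)
  finally have "\<bar>x - y\<bar> * (x + y) = E * \<bar>q - q'\<bar> / (q * q')" .
  hence 1: "\<bar>x - y\<bar> * (x + y) * (q + q') = 2 * \<bar>q - q'\<bar> * (E * (q + q') / (2 * (q * q')))"
    by (simp only:) (simp add: mult_ac)
  have "E * (q + q') / (2 * (q * q')) = ((1 - x\<^sup>2) + (1 - y\<^sup>2)) / 2"
    unfolding xq yq using assms by (simp add: field_simps)
  also have "\<dots> \<le> 1 - y * x"
    using sum_squares_bound[of x y] by (simp add: field_simps)
  finally have "2 * \<bar>q - q'\<bar> * (E * (q + q') / (2 * (q * q'))) \<le> 2 * \<bar>q - q'\<bar> * (1 - y * x)"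
    by (intro mult_left_mono) auto
  hence "\<bar>x - y\<bar> * ((q + q') * (x + y)) \<le> 2 * \<bar>q - q'\<bar> * (1 - y * x)"
    using 1 by (simp add: mult_ac)
  moreover have "(q + q') * (x + y) > 0" using assms by simp
  ultimately show ?thesis using xy by (simp add: divide_le_eq pos_le_divide_eq mult_ac)
qed

text \<open>At u = -1 the second circle leads straight back towards the centre, and the limit |1 +
  u| of the denominator vanishes. This angle is excluded by discarding the real axis, a null
  set.\<close>

lemma AE_circle_measure_neq: "AE u in circle_measure. u \<noteq> -1"
proof -
  have "negligible {z::complex. \<i> \<bullet> z = 0}"
    by (rule negligible_hyperplane) simp
  hence "AE y in lborel. y \<notin> {z::complex. \<i> \<bullet> z = 0}"
    by (rule AE_lborel_not_in_negligible) measurable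
  hence "AE y in hyp_area. Im y \<noteq> 0"
    unfolding hyp_area_def using hyp_area_dens_measurable by (subst AE_density) (auto simp: inner_complex_def)
  hence "AE z in hyp_disc (1/2). Im z \<noteq> 0"
    unfolding hyp_disc_def by (intro AE_uniform_measureI) auto
  hence "AE z in hyp_disc (1/2). sgn z \<noteq> -1"
  proof eventually_elim
    case (elim z)
    have "Im (sgn z) \<noteq> Im (- 1)" using elim by auto
    thus ?case by metis
  qed
  thus ?thesis unfolding circle_measure_def by (subst AE_distr_iff) (auto cong: measurable_cong_sets)
qed

text \<open>Composing the radii \<open>rad a\<close> and \<open>rad b\<close> at angle u gives a
  radius X with 1 - X^2 = exp (- (a + b)) / q, where q tends to |1 + u|^2. Equal sums share the
  exponential, so by \<open>disc_distance_bound\<close> the two radii merge hyperbolically for u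
  \<noteq> -1, and dominated convergence over u finishes.\<close>

lemma large_circles_tendsto:
  fixes a b a' b' :: "nat \<Rightarrow> real"
  assumes f: "bounded_borel C f" and uc: "hyp_uniformly_continuous f" and w: "cmod w < 1"
    and nn: "\<And>n. 0 \<le> a n" "\<And>n. 0 \<le> b n" "\<And>n. 0 \<le> a' n" "\<And>n. 0 \<le> b' n"
    and lim: "filterlim a at_top sequentially" "filterlim b at_top sequentially"
      "filterlim a' at_top sequentially" "filterlim b' at_top sequentially"
    and sums: "\<And>n. a n + b n = a' n + b' n"
  shows "(\<lambda>n. avg (hyp_circle (rad (a n))) (avg (hyp_circle (rad (b n))) f) w
            - avg (hyp_circle (rad (a' n))) (avg (hyp_circle (rad (b' n))) f) w) \<longlonglongrightarrow> 0"
proof -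
  interpret tau: prob_space circle_measure by (rule prob_space_circle_measure)
  note [measurable] = bounded_borelD[OF f]
  define X where "X a b u = cmod (disc_translation (of_real (rad a)) (u * of_real (rad b)))" for a b u
  define q where "q a b u = (cmod (1 + of_real (rad a) * (u * of_real (rad b))))\<^sup>2" for a b u
  have [measurable]: "X a b \<in> borel_measurable borel" for a b unfolding X_def by measurable
  have X: "0 \<le> X a b u" "X a b u < 1" "1 - (X a b u)\<^sup>2 = exp (- (a + b)) / q a b u" "q a b u > 0"
    if ab: "0 \<le> a" "0 \<le> b" and u: "cmod u = 1" for a b u
  proof -
    have d: "cmod (of_real (rad a)) < 1" "cmod (u * of_real (rad b)) < 1"
      using rad[OF ab(1)] rad[OF ab(2)] u by (auto simp: norm_mult)
    show "0 \<le> X a b u" by (simp add: X_def)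
    show "X a b u < 1" unfolding X_def using d by (rule disc_translation_in_disc)
    show "1 - (X a b u)\<^sup>2 = exp (- (a + b)) / q a b u"
      unfolding X_def one_minus_disc_translation[OF d] q_def
      using rad[OF ab(1)] rad[OF ab(2)] u by (simp add: norm_mult exp_add[symmetric] mult_exp_exp)
    show "q a b u > 0" unfolding q_def using disc_translation_denom_nz[OF d] by simp
  qed
  have q_lim: "(\<lambda>n. q (a n) (b n) u) \<longlonglongrightarrow> (cmod (1 + u))\<^sup>2"
    if "filterlim a at_top sequentially" "filterlim b at_top sequentially" for a b :: "nat \<Rightarrow> real" and u
  proof -
    have "(\<lambda>n. rad (a n)) \<longlonglongrightarrow> 1" "(\<lambda>n. rad (b n)) \<longlonglongrightarrow> 1"
      using that by (auto intro: filterlim_compose[OF rad_tendsto])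
    hence "(\<lambda>n. q (a n) (b n) u) \<longlonglongrightarrow> (cmod (1 + of_real 1 * (u * of_real 1)))\<^sup>2"
      unfolding q_def by (intro tendsto_intros)
    thus ?thesis by simp
  qed
  have X_lim: "(\<lambda>n. X (a n) (b n) u) \<longlonglongrightarrow> 1"
    if "filterlim a at_top sequentially" "filterlim b at_top sequentially"
      "\<And>n. 0 \<le> a n" "\<And>n. 0 \<le> b n" and u: "cmod u = 1" "u \<noteq> -1" for a b :: "nat \<Rightarrow> real" and u
  proof -
    have u0: "(cmod (1 + u))\<^sup>2 \<noteq> 0" using u(2) by (simp add: add_eq_0_iff)
    have "filterlim (\<lambda>n. a n + b n) at_top sequentially"
      using that(1,2) by (rule filterlim_at_top_add_at_top)
    hence "(\<lambda>n. exp (- (a n + b n))) \<longlonglongrightarrow> 0"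
      by (intro filterlim_compose[OF exp_at_bot] filterlim_compose[OF filterlim_uminus_at_bot_at_top])
    hence "(\<lambda>n. sqrt (1 - exp (- (a n + b n)) / q (a n) (b n) u)) \<longlonglongrightarrow> sqrt (1 - 0 / (cmod (1 + u))\<^sup>2)"
      by (intro tendsto_intros q_lim that u0)
    moreover have "sqrt (1 - exp (- (a n + b n)) / q (a n) (b n) u) = X (a n) (b n) u" for n
    proof -
      have "1 - exp (- (a n + b n)) / q (a n) (b n) u = (X (a n) (b n) u)\<^sup>2"
        using X(3)[OF that(3,4) u(1), of n n] by linarith
      thus ?thesis using X(1)[OF that(3,4) u(1)] by simp
    qed
    ultimately show ?thesis by simp
  qed
  define A where "A x = avg (hyp_circle x) f w" for x
  have [measurable]: "A \<in> borel_measurable borel" unfolding A_def[abs_def] by measurable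
  have A_bound: "\<bar>A x\<bar> \<le> C" for x unfolding A_def by (rule bounded_avg_hyp_circle[OF f])
  have int: "integrable circle_measure (\<lambda>u. A (X a b u))" for a b
    by (rule tau.integrable_const_bound[of _ C]) (use A_bound in auto)
  have "(\<lambda>n. \<integral>u. A (X (a n) (b n) u) - A (X (a' n) (b' n) u) \<partial>circle_measure) \<longlonglongrightarrow> (\<integral>u. 0 \<partial>circle_measure)"
  proof (rule integral_dominated_convergence[where w = "\<lambda>_. 2 * C"])
    show "AE u in circle_measure. norm (A (X (a n) (b n) u) - A (X (a' n) (b' n) u)) \<le> 2 * C" for n
    proof (rule AE_I2)
      fix u
      show "norm (A (X (a n) (b n) u) - A (X (a' n) (b' n) u)) \<le> 2 * C"
        using A_bound[of "X (a n) (b n) u"] A_bound[of "X (a' n) (b' n) u"]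
        unfolding real_norm_def by linarith
    qed
    show "AE u in circle_measure. (\<lambda>n. A (X (a n) (b n) u) - A (X (a' n) (b' n) u)) \<longlonglongrightarrow> 0"
      using AE_circle_measure AE_circle_measure_neq
    proof eventually_elim
      case (elim u)
      have u0: "(cmod (1 + u))\<^sup>2 > 0" using elim(2) by (simp add: add_eq_0_iff)
      have XL: "(\<lambda>n. X (a n) (b n) u) \<longlonglongrightarrow> 1" "(\<lambda>n. X (a' n) (b' n) u) \<longlonglongrightarrow> 1"
        using lim nn elim by (auto intro!: X_lim)
      have QL: "(\<lambda>n. q (a n) (b n) u) \<longlonglongrightarrow> (cmod (1 + u))\<^sup>2" "(\<lambda>n. q (a' n) (b' n) u) \<longlonglongrightarrow> (cmod (1 + u))\<^sup>2"
        using lim by (auto intro!: q_lim)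
      define D where "D n = 2 * \<bar>q (a n) (b n) u - q (a' n) (b' n) u\<bar> / ((q (a n) (b n) u + q (a' n) (b' n) u) * (X (a n) (b n) u + X (a' n) (b' n) u))" for n
      have "D \<longlonglongrightarrow> 2 * \<bar>(cmod (1 + u))\<^sup>2 - (cmod (1 + u))\<^sup>2\<bar> / (((cmod (1 + u))\<^sup>2 + (cmod (1 + u))\<^sup>2) * (1 + 1))"
        unfolding D_def using u0 by (intro tendsto_intros XL QL) simp
      hence D0: "D \<longlonglongrightarrow> 0" by simp
      show ?case
      proof (rule tendstoI)
        fix e :: real assume e: "e > 0"
        then obtain d where d: "d > 0" "\<And>w z. cmod w < 1 \<Longrightarrow> cmod z < 1 \<Longrightarrow> cmod z < d \<Longrightarrow> \<bar>f (disc_translation w z) - f w\<bar> \<le> e / 2"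
          using uc unfolding hyp_uniformly_continuous_def by (meson half_gt_zero)
        have "\<forall>\<^sub>F n in sequentially. X (a n) (b n) u > 0" using XL(1) by (rule order_tendstoD) simp
        moreover have "\<forall>\<^sub>F n in sequentially. D n < d" using D0 d(1) by (rule order_tendstoD)
        ultimately show "\<forall>\<^sub>F n in sequentially. dist (A (X (a n) (b n) u) - A (X (a' n) (b' n) u)) 0 < e"
        proof eventually_elim
          case (elim n)
          note X1 = X[OF nn(1,2) \<open>cmod u = 1\<close>, of n n] and X2 = X[OF nn(3,4) \<open>cmod u = 1\<close>, of n n]
          have "\<bar>X (a n) (b n) u - X (a' n) (b' n) u\<bar> / (1 - X (a' n) (b' n) u * X (a n) (b n) u) \<le> D n"
            unfolding D_def
          proof (rule disc_distance_bound[where E = "exp (- (a n + b n))"])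
            show "1 - (X (a' n) (b' n) u)\<^sup>2 = exp (- (a n + b n)) / q (a' n) (b' n) u"
              unfolding sums[of n] by (rule X2(3))
          qed (use X1 X2 elim in auto)
          hence "\<bar>A (X (a n) (b n) u) - A (X (a' n) (b' n) u)\<bar> \<le> e / 2"
            unfolding A_def using X1 X2 elim d(2)
            by (intro avg_hyp_circle_radius_continuous[OF f _ w, of d]) auto
          thus ?case using e by simp
        qed
      qed
    qed
  qed auto
  moreover have "avg (hyp_circle (rad a)) (avg (hyp_circle (rad b)) f) w = (\<integral>u. A (X a b u) \<partial>circle_measure)"
    if "0 \<le> a" "0 \<le> b" for a b
    unfolding A_def X_def using rad[OF that(1)] rad[OF that(2)]
    by (intro avg_hyp_circle_hyp_circle[OF _ _ _ _ f w]) auto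
  ultimately show ?thesis
    using nn by (simp add: Bochner_Integration.integral_diff[OF int int])
qed

section \<open>Equidistribution of large circles\<close>

lemma bounded_borel_mult:
  assumes "bounded_borel C f" "bounded_borel C' g"
  shows "bounded_borel (C * C') (\<lambda>z. f z * g z)"
  unfolding bounded_borel_def
proof (intro conjI allI)
  note [measurable] = assms[THEN bounded_borelD]
  show "(\<lambda>z. f z * g z) \<in> borel_measurable borel" by measurable
  fix z
  have "\<bar>f z\<bar> * \<bar>g z\<bar> \<le> C * C'"
    using bounded_borel_bound[OF assms(1), of z] bounded_borel_bound[OF assms(2), of z]
    by (intro mult_mono) auto
  thus "\<bar>f z * g z\<bar> \<le> C * C'" by (simp add: abs_mult)
qed

lemma bounded_borel_diff:
  assumes "bounded_borel C f" "bounded_borel C' g"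
  shows "bounded_borel (C + C') (\<lambda>z. f z - g z)"
  unfolding bounded_borel_def
proof (intro conjI allI)
  note [measurable] = assms[THEN bounded_borelD]
  show "(\<lambda>z. f z - g z) \<in> borel_measurable borel" by measurable
  fix z
  show "\<bar>f z - g z\<bar> \<le> C + C'"
    using bounded_borel_bound[OF assms(1), of z] bounded_borel_bound[OF assms(2), of z] by linarith
qed

lemma avg_cong:
  assumes mu: "radial_prob \<mu>" and [measurable]: "f \<in> borel_measurable borel" "g \<in> borel_measurable borel"
    and eq: "\<And>z. cmod z < 1 \<Longrightarrow> f z = g z" and w: "cmod w < 1"
  shows "avg \<mu> f w = avg \<mu> g w"
proof -
  have [measurable_cong]: "sets \<mu> = sets borel" using mu by (rule radial_probD)
  show ?thesis
    unfolding avg_def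
    by (rule integral_cong_AE)
       (use radial_probD(3)[OF mu] in \<open>auto elim!: eventually_mono intro!: eq disc_translation_in_disc w\<close>)
qed

lemma (in prob_space) square_expectation_le:
  fixes X :: "'a \<Rightarrow> real"
  assumes [measurable]: "X \<in> borel_measurable M" and b: "\<And>x. \<bar>X x\<bar> \<le> B"
  shows "(expectation X)\<^sup>2 \<le> expectation (\<lambda>x. (X x)\<^sup>2)"
proof -
  have "integrable M X" by (rule integrable_const_bound[of _ B]) (use b in auto)
  moreover have "integrable M (\<lambda>x. (X x)\<^sup>2)"
    by (rule integrable_const_bound[of _ "B\<^sup>2"]) (use power_mono[OF b abs_ge_zero, of _ 2] in auto)
  ultimately have "variance X = expectation (\<lambda>x. (X x)\<^sup>2) - (expectation X)\<^sup>2" by (rule variance_eq)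
  thus ?thesis using variance_positive[of X] by linarith
qed

section \<open>Smoothed circle averages in the mean square over the quotient\<close>

locale disc_quotient_function = disc_quotient +
  fixes f :: "complex \<Rightarrow> real" and C r :: real
  assumes f: "bounded_borel C f" "\<And>z. 0 \<le> f z" "invariant f"
    and r: "0 < r" "r < 1"
begin

definition W :: "real \<Rightarrow> complex \<Rightarrow> real" where
  "W a = avg (hyp_circle (rad a)) (avg (hyp_disc r) f)"

text \<open>The Gram kernel of the functions \<open>W a\<close> in the Hilbert space of the
  quotient.\<close>

definition \<Psi> :: "real \<Rightarrow> real \<Rightarrow> real" where
  "\<Psi> a b = (\<integral>w. W a w * W b w \<partial>quot)"

lemma radial_disc: "radial_prob (hyp_disc r)"
  using r by (rule radial_prob_hyp_disc)

lemma radial_circle: "a \<ge> 0 \<Longrightarrow> radial_prob (hyp_circle (rad a))"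
  using rad by (intro radial_prob_hyp_circle) auto

lemma f1: "bounded_borel C (avg (hyp_disc r) f)" "\<And>z. 0 \<le> avg (hyp_disc r) f z" "invariant (avg (hyp_disc r) f)"
  using f by (auto intro!: bounded_borel_avg radial_disc avg_nonneg invariant_avg bounded_borelD)

lemma W: "a \<ge> 0 \<Longrightarrow> bounded_borel C (W a)" "0 \<le> W a z" "a \<ge> 0 \<Longrightarrow> invariant (W a)"
  unfolding W_def
  by (auto intro: bounded_borel_avg[OF radial_circle f1(1)] avg_nonneg[OF f1(2)]
      invariant_avg[OF radial_circle bounded_borelD[OF f1(1)] f1(3)])

lemma C_nonneg: "0 \<le> C"
  using bounded_borel_bound[OF f(1), of 0] by linarith

text \<open>Self-adjointness is applied to circle after disc, since the circle alone has no area
  kernel, and commutation sorts the factors. The two disc averages end up innermost: the twice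
  averaged f is uniformly continuous, and the remaining double circle average is that of
  \<open>large_circles_tendsto\<close>.\<close>

lemma Psi_eq:
  assumes ab: "a \<ge> 0" "b \<ge> 0"
  shows "\<Psi> a b = (\<integral>w. f w * avg (hyp_circle (rad a)) (avg (hyp_circle (rad b)) (avg (hyp_disc r) (avg (hyp_disc r) f))) w \<partial>quot)"
proof -
  let ?D = "hyp_disc r" and ?L = "\<lambda>h. avg (hyp_circle (rad a)) (avg (hyp_disc r) h)"
  have LW: "bounded_borel C (?L (W b))"
    using W(1)[OF ab(2)] by (auto intro!: bounded_borel_avg radial_disc radial_circle ab)
  have "\<Psi> a b = (\<integral>w. W b w * ?L f w \<partial>quot)"
    by (simp add: \<Psi>_def W_def mult.commute)
  also have "\<dots> = (\<integral>w. f w * ?L (W b) w \<partial>quot)"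
  proof (rule integral_self_adjoint[OF has_radial_kernel_avg_hyp_disc[OF radial_circle[OF ab(1)] r] f W(1,2,3)])
    show "?L f \<in> borel_measurable borel" using W(1)[OF ab(1)] unfolding W_def by (rule bounded_borelD)
    show "?L (W b) \<in> borel_measurable borel" using LW by (rule bounded_borelD)
  qed (auto intro!: avg_nonneg f W ab)
  also have "\<dots> = (\<integral>w. f w * avg (hyp_circle (rad a)) (avg (hyp_circle (rad b)) (avg ?D (avg ?D f))) w \<partial>quot)"
  proof (rule integral_cong_AE)
    have 2: "bounded_borel C (avg (hyp_circle (rad b)) (avg ?D (avg ?D f)))"
      using f1(1) by (auto intro!: bounded_borel_avg radial_disc radial_circle ab)
    have 3: "bounded_borel C (avg ?D (W b))"
      using W(1)[OF ab(2)] by (auto intro!: bounded_borel_avg radial_disc)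
    show "AE w in quot. f w * ?L (W b) w = f w * avg (hyp_circle (rad a)) (avg (hyp_circle (rad b)) (avg ?D (avg ?D f))) w"
      using AE_quot_disc
    proof eventually_elim
      case (elim w)
      have "?L (W b) w = avg (hyp_circle (rad a)) (avg (hyp_circle (rad b)) (avg ?D (avg ?D f))) w"
        using avg_commute[OF radial_disc radial_circle[OF ab(2)] f1(1)] 2 3 elim
        by (intro avg_cong radial_circle ab) (auto dest: bounded_borelD simp: W_def)
      thus ?case by simp
    qed
    have "bounded_borel C (avg (hyp_circle (rad a)) (avg (hyp_circle (rad b)) (avg ?D (avg ?D f))))"
      using 2 by (auto intro!: bounded_borel_avg radial_circle ab)
    note [measurable] = bounded_borelD[OF this] bounded_borelD[OF LW] bounded_borelD[OF f(1)]
    show "(\<lambda>w. f w * ?L (W b) w) \<in> borel_measurable quot" by measurable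
    show "(\<lambda>w. f w * avg (hyp_circle (rad a)) (avg (hyp_circle (rad b)) (avg ?D (avg ?D f))) w) \<in> borel_measurable quot"
      by measurable
  qed
  finally show ?thesis .
qed

text \<open>A failure would produce parameter sequences tending to infinity; but along them the
  double circle averages merge at every point of the disc, boundedly, and the quotient has finite
  area.\<close>

lemma Psi_hankel:
  assumes e: "e > 0"
  shows "\<exists>T\<ge>0. \<forall>a\<ge>T. \<forall>b\<ge>T. \<forall>a'\<ge>T. \<forall>b'\<ge>T. a + b = a' + b' \<longrightarrow> \<bar>\<Psi> a b - \<Psi> a' b'\<bar> \<le> e"
proof (rule ccontr)
  assume "\<not> ?thesis"
  hence "\<forall>n. \<exists>a b a' b'. real n \<le> a \<and> real n \<le> b \<and> real n \<le> a' \<and> real n \<le> b' \<and> a + b = a' + b' \<and> \<bar>\<Psi> a b - \<Psi> a' b'\<bar> > e"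
    by (metis of_nat_0_le_iff not_le)
  then obtain a b a' b' where *: "\<And>n. real n \<le> a n" "\<And>n. real n \<le> b n" "\<And>n. real n \<le> a' n" "\<And>n. real n \<le> b' n"
    "\<And>n. a n + b n = a' n + b' n" "\<And>n. \<bar>\<Psi> (a n) (b n) - \<Psi> (a' n) (b' n)\<bar> > e"
    by metis
  have nn: "0 \<le> a n" "0 \<le> b n" "0 \<le> a' n" "0 \<le> b' n" for n
    using *(1-4)[of n] of_nat_0_le_iff[of n, where 'a = real] by linarith+
  have top: "filterlim x at_top sequentially" if "\<And>n. real n \<le> x n" for x
    by (rule filterlim_at_top_mono[OF filterlim_real_sequentially]) (use that in auto)
  define f2 where "f2 = avg (hyp_disc r) (avg (hyp_disc r) f)"
  have f2: "bounded_borel C f2" "hyp_uniformly_continuous f2"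
    unfolding f2_def
    by (rule bounded_borel_avg[OF radial_disc f1(1)] hyp_uniformly_continuous_hyp_disc[OF r f1(1)])+
  define G where "G x y = avg (hyp_circle (rad x)) (avg (hyp_circle (rad y)) f2)" for x y
  have G: "bounded_borel C (G x y)" if "x \<ge> 0" "y \<ge> 0" for x y
    unfolding G_def by (intro bounded_borel_avg radial_circle that f2(1))
  have fG: "bounded_borel (C * C) (\<lambda>w. f w * G x y w)" if "x \<ge> 0" "y \<ge> 0" for x y
    by (rule bounded_borel_mult[OF f(1) G[OF that]])
  have "(\<lambda>n. \<integral>w. f w * G (a n) (b n) w - f w * G (a' n) (b' n) w \<partial>quot) \<longlonglongrightarrow> (\<integral>w. 0 \<partial>quot)"
  proof (rule integral_dominated_convergence[where w = "\<lambda>_. C * C + C * C"])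
    show "AE w in quot. (\<lambda>n. f w * G (a n) (b n) w - f w * G (a' n) (b' n) w) \<longlonglongrightarrow> 0"
      using AE_quot_disc
    proof eventually_elim
      case (elim w)
      have "(\<lambda>n. f w * (G (a n) (b n) w - G (a' n) (b' n) w)) \<longlonglongrightarrow> f w * 0"
        unfolding G_def
        by (intro tendsto_mult tendsto_const large_circles_tendsto[OF f2 elim] nn top *)
      thus ?case by (simp add: algebra_simps)
    qed
    show "(\<lambda>w. f w * G (a n) (b n) w - f w * G (a' n) (b' n) w) \<in> borel_measurable quot" for n
      using bounded_borelD[OF bounded_borel_diff[OF fG fG]] nn by simp
    show "AE w in quot. norm (f w * G (a n) (b n) w - f w * G (a' n) (b' n) w) \<le> C * C + C * C" for n
      using bounded_borel_bound[OF bounded_borel_diff[OF fG fG]] nn by simp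
  qed auto
  moreover have "(\<integral>w. f w * G (a n) (b n) w - f w * G (a' n) (b' n) w \<partial>quot) = \<Psi> (a n) (b n) - \<Psi> (a' n) (b' n)" for n
    using integrable_quot[OF fG] nn by (subst Bochner_Integration.integral_diff) (auto simp: Psi_eq G_def f2_def)
  ultimately have "(\<lambda>n. \<Psi> (a n) (b n) - \<Psi> (a' n) (b' n)) \<longlonglongrightarrow> 0" by simp
  hence "\<forall>\<^sub>F n in sequentially. \<bar>\<Psi> (a n) (b n) - \<Psi> (a' n) (b' n)\<bar> < e"
    using e by (auto dest: tendstoD simp: dist_norm)
  then obtain n where "\<bar>\<Psi> (a n) (b n) - \<Psi> (a' n) (b' n)\<bar> < e"
    by (auto simp: eventually_sequentially)
  with *(6)[of n] show False by simp
qed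

lemma W_slow_variation:
  assumes e: "e > 0" and B: "B \<ge> 0"
  shows "\<exists>T\<ge>0. \<forall>a\<ge>T. \<forall>b\<ge>T. \<bar>a - b\<bar> \<le> B \<longrightarrow> (\<integral>w. (W a w - W b w)\<^sup>2 \<partial>quot) \<le> e"
proof -
  have WW: "integrable quot (\<lambda>w. W a w * W b w)" if "a \<ge> 0" "b \<ge> 0" for a b
    by (rule integrable_quot[OF bounded_borel_mult[OF W(1) W(1)]]) (use that in auto)
  have sq: "\<Psi> a a + \<Psi> b b - 2 * \<Psi> a b = (\<integral>w. (W a w - W b w)\<^sup>2 \<partial>quot)" if ab: "a \<ge> 0" "b \<ge> 0" for a b
  proof -
    have "(\<integral>w. (W a w - W b w)\<^sup>2 \<partial>quot) = (\<integral>w. W a w * W a w + W b w * W b w - 2 * (W a w * W b w) \<partial>quot)"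
      by (simp add: power2_eq_square algebra_simps)
    also have "\<dots> = \<Psi> a a + \<Psi> b b - 2 * \<Psi> a b"
      unfolding \<Psi>_def using WW ab by simp
    finally show ?thesis ..
  qed
  have "\<exists>T\<ge>0. \<forall>a\<ge>T. \<forall>b\<ge>T. \<bar>a - b\<bar> \<le> B \<longrightarrow> \<Psi> a a + \<Psi> b b - 2 * \<Psi> a b \<le> e"
  proof (rule hankel_slow_variation[OF _ _ _ Psi_hankel e B])
    fix a b :: real assume ab: "a \<ge> 0" "b \<ge> 0"
    show "\<bar>\<Psi> a b\<bar> \<le> C * C * measure quot (space quot)"
    proof -
      have "\<bar>\<Psi> a b\<bar> \<le> (\<integral>w. \<bar>W a w * W b w\<bar> \<partial>quot)" unfolding \<Psi>_def by (rule integral_abs_bound)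
      also have "\<dots> \<le> (\<integral>w. C * C \<partial>quot)"
        by (rule integral_mono) (use WW ab bounded_borel_bound[OF bounded_borel_mult[OF W(1) W(1)]] in auto)
      finally show ?thesis by (simp add: mult.commute)
    qed
    show "\<Psi> a a + \<Psi> b b - 2 * \<Psi> a b \<ge> 0" unfolding sq[OF ab] by simp
  qed (simp add: \<Psi>_def mult.commute)
  then obtain T where T: "T \<ge> 0" "\<And>a b. a \<ge> T \<Longrightarrow> b \<ge> T \<Longrightarrow> \<bar>a - b\<bar> \<le> B \<Longrightarrow> \<Psi> a a + \<Psi> b b - 2 * \<Psi> a b \<le> e"
    by blast
  show ?thesis
  proof (intro exI conjI allI impI)
    fix a b assume ab: "a \<ge> T" "b \<ge> T" "\<bar>a - b\<bar> \<le> B"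
    hence "a \<ge> 0" "b \<ge> 0" using T(1) by auto
    from T(2)[OF ab] sq[OF this] show "(\<integral>w. (W a w - W b w)\<^sup>2 \<partial>quot) \<le> e" by linarith
  qed (rule T(1))
qed

text \<open>A disc average of \<open>W a\<close> is a mixture of \<open>W b\<close> with b at
  bounded distance from a, as moving by z with |z| < s changes 1 - X^2 by bounded factors only.
  Jensen's inequality brings the square inside the mixture, where slow variation applies.\<close>

lemma W_mean_value:
  assumes s: "0 < s" "s < 1" and e: "e > 0"
  shows "\<exists>T\<ge>0. \<forall>a\<ge>T. (\<integral>w. (avg (hyp_disc s) (W a) w - W a w)\<^sup>2 \<partial>quot) \<le> e"
proof -
  \<comment> \<open>From b - a = 2 ln N - ln (1 - |z|^2) with |z| < s, where N = |1 + cnj z y| lies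
    between 1 - s and 2. Each of the three terms bounds one possible contribution.\<close>
  define B where "B = ln 4 - 2 * ln (1 - s) - ln (1 - s\<^sup>2)"
  have s2: "s\<^sup>2 < 1" using s by (simp add: abs_square_less_1)
  have ln_neg: "ln (1 - s) \<le> 0" "ln (1 - s\<^sup>2) \<le> 0" using s s2 by (auto simp: ln_le_zero_iff)
  moreover have "ln (4::real) \<ge> 0" by simp
  ultimately have B: "B \<ge> 0" unfolding B_def by linarith
  obtain T where T: "T \<ge> 0" "\<And>a b. a \<ge> T \<Longrightarrow> b \<ge> T \<Longrightarrow> \<bar>a - b\<bar> \<le> B \<Longrightarrow> (\<integral>w. (W a w - W b w)\<^sup>2 \<partial>quot) \<le> e"
    using W_slow_variation[OF e B] by blast
  have rs: "radial_prob (hyp_disc s)" using s by (rule radial_prob_hyp_disc)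
  interpret S: prob_space "hyp_disc s" using rs by (rule radial_probD)
  interpret tau: prob_space circle_measure by (rule prob_space_circle_measure)
  interpret P: pair_prob_space "hyp_disc s" circle_measure ..
  let ?P = "hyp_disc s \<Otimes>\<^sub>M circle_measure"
  interpret PQ: pair_sigma_finite ?P quot ..
  show ?thesis
  proof (intro exI conjI allI impI)
    \<comment> \<open>Beyond T + B every b within B of a is still beyond T.\<close>
    show "T + B \<ge> 0" using T B by simp
    fix a assume a: "a \<ge> T + B"
    have a0: "a \<ge> 0" "a \<ge> T" using a T B by auto
    note rada = rad[OF a0(1)]
    define X where "X p = cmod (disc_translation (fst p) (snd p * of_real (rad a)))" for p
    define Y where "Y p w = avg (hyp_circle (X p)) (avg (hyp_disc r) f) w - W a w" for p w
    note [measurable] = bounded_borelD[OF f1(1)] bounded_borelD[OF W(1)[OF a0(1)]]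
    have [measurable]: "X \<in> borel_measurable (borel \<Otimes>\<^sub>M borel)" unfolding X_def by measurable
    have Ym [measurable]: "(\<lambda>(p, w). Y p w) \<in> borel_measurable ((borel \<Otimes>\<^sub>M borel) \<Otimes>\<^sub>M borel)" unfolding Y_def by measurable
    have [measurable]: "Y p \<in> borel_measurable borel" for p unfolding Y_def by measurable
    have Yb: "\<bar>Y p w\<bar> \<le> 2 * C" for p w
      using bounded_avg_hyp_circle[OF f1(1), of "X p" w] bounded_borel_bound[OF W(1)[OF a0(1)], of w]
      unfolding Y_def by linarith
    have Y2b: "norm ((Y p w)\<^sup>2) \<le> (2 * C)\<^sup>2" for p w
      using power_mono[OF Yb[of p w] abs_ge_zero, of 2] by simp
    have eq: "avg (hyp_disc s) (W a) w - W a w = (\<integral>p. Y p w \<partial>?P)" if w: "cmod w < 1" for w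
    proof -
      have int: "integrable ?P (\<lambda>p. avg (hyp_circle (X p)) (avg (hyp_disc r) f) w)"
        by (rule P.integrable_const_bound[of _ C]) (use bounded_avg_hyp_circle[OF f1(1)] in auto)
      have "avg (hyp_disc s) (W a) w = (\<integral>z. \<integral>u. avg (hyp_circle (X (z, u))) (avg (hyp_disc r) f) w \<partial>circle_measure \<partial>hyp_disc s)"
        unfolding W_def X_def fst_conv snd_conv by (rule avg_avg_hyp_circle[OF rs rada(1,2) f1(1) w])
      also have "\<dots> = (\<integral>p. avg (hyp_circle (X p)) (avg (hyp_disc r) f) w \<partial>?P)"
        by (rule P.integral_fst'[OF int])
      finally show ?thesis unfolding Y_def using int by (simp add: P.prob_space)
    qed
    have small: "AE p in ?P. (\<integral>w. (Y p w)\<^sup>2 \<partial>quot) \<le> e"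
    proof -
      have "AE z in hyp_disc s. cmod z < s"
        unfolding hyp_disc_def using s by (intro AE_uniform_measureI) auto
      hence "AE z in hyp_disc s. AE u in circle_measure. (\<integral>w. (Y (z, u) w)\<^sup>2 \<partial>quot) \<le> e"
      proof eventually_elim
        case (elim z)
        show ?case using AE_circle_measure
        proof eventually_elim
          case (elim u)
          have z: "cmod z < 1" and zs: "cmod z < s" using \<open>cmod z < s\<close> s by auto
          define y where "y = u * of_real (rad a)"
          have y: "cmod y = rad a" "cmod y < 1" using elim rada by (auto simp: y_def norm_mult)
          have XX: "X (z, u) = cmod (disc_translation z y)" by (simp add: X_def y_def)
          have X1: "0 \<le> X (z, u)" "X (z, u) < 1"
            unfolding XX using z y by (auto intro: disc_translation_in_disc)
          hence X2: "1 - (X (z, u))\<^sup>2 > 0" by (simp add: abs_square_less_1)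
          define b where "b = - ln (1 - (X (z, u))\<^sup>2)"
          have radb: "rad b = X (z, u)" using X1 X2 by (simp add: rad_def b_def)
          define N where "N = cmod (1 + cnj z * y)"
          have zy: "cmod (cnj z * y) \<le> s"
          proof -
            have "cmod (cnj z * y) \<le> cmod (cnj z)" by (rule norm_le_disc[OF y(2)])
            thus ?thesis using zs by simp
          qed
          have N: "1 - s \<le> N" "N \<le> 2"
            unfolding N_def using norm_triangle_ineq2[of 1 "- (cnj z * y)"] norm_triangle_ineq[of 1 "cnj z * y"] zy s by auto
          have N0: "N > 0" using N s by simp
          have z2: "1 - s\<^sup>2 \<le> 1 - (cmod z)\<^sup>2" "1 - (cmod z)\<^sup>2 \<le> 1" "0 < 1 - (cmod z)\<^sup>2"
            using zs z by (auto intro!: power_mono simp: abs_square_less_1)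
          have "1 - (X (z, u))\<^sup>2 = (1 - (cmod z)\<^sup>2) * exp (- a) / N\<^sup>2"
            unfolding XX N_def one_minus_disc_translation[OF z y(2)] y(1) rada(3) ..
          hence "b = - (ln (1 - (cmod z)\<^sup>2) + - a - 2 * ln N)"
            unfolding b_def using z2 N0 by (simp add: ln_div ln_mult ln_realpow)
          hence ba: "b - a = 2 * ln N - ln (1 - (cmod z)\<^sup>2)" by simp
          have "ln (1 - s) \<le> ln N" using N s by simp
          moreover have "ln N \<le> ln 2" using N N0 by simp
          moreover have "ln (1 - s\<^sup>2) \<le> ln (1 - (cmod z)\<^sup>2)" "ln (1 - (cmod z)\<^sup>2) \<le> 0"
            using z2 s2 by (auto simp: ln_le_zero_iff)
          moreover have "ln (4::real) = 2 * ln 2" using ln_realpow[of "2::real" 2] by simp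
          moreover have "ln (2::real) \<ge> 0" by simp
          ultimately have "\<bar>b - a\<bar> \<le> B" using ln_neg unfolding ba B_def abs_le_iff by linarith
          moreover from this have "b \<ge> T" using a by linarith
          ultimately have "(\<integral>w. (W b w - W a w)\<^sup>2 \<partial>quot) \<le> e" using T(2) a0 by blast
          thus ?case unfolding Y_def W_def[of b] radb .
        qed
      qed
      thus ?thesis by (intro P.AE_pair_measure) measurable
    qed
    have "(\<integral>w. (avg (hyp_disc s) (W a) w - W a w)\<^sup>2 \<partial>quot) \<le> (\<integral>w. (\<integral>p. (Y p w)\<^sup>2 \<partial>?P) \<partial>quot)"
    proof (rule integral_mono_AE)
      have b: "bounded_borel (C + C) (\<lambda>w. avg (hyp_disc s) (W a) w - W a w)"
        by (rule bounded_borel_diff[OF bounded_borel_avg[OF rs W(1)] W(1)]) (use a0 in auto)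
      show "integrable quot (\<lambda>w. (avg (hyp_disc s) (W a) w - W a w)\<^sup>2)"
        unfolding power2_eq_square by (rule integrable_quot[OF bounded_borel_mult[OF b b]])
      show "integrable quot (\<lambda>w. \<integral>p. (Y p w)\<^sup>2 \<partial>?P)"
      proof (rule quot.integrable_const_bound[of _ "(2 * C)\<^sup>2"])
        have "norm (\<integral>p. (Y p w)\<^sup>2 \<partial>?P) \<le> (2 * C)\<^sup>2" for w
        proof -
          have "norm (\<integral>p. (Y p w)\<^sup>2 \<partial>?P) \<le> (\<integral>p. (2 * C)\<^sup>2 \<partial>?P)"
            using Y2b by (intro Bochner_Integration.integral_norm_bound[THEN order_trans] integral_mono P.integrable_const_bound[of _ "(2 * C)\<^sup>2"]) auto
          thus ?thesis by (simp add: P.prob_space)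
        qed
        thus "AE w in quot. norm (\<integral>p. (Y p w)\<^sup>2 \<partial>?P) \<le> (2 * C)\<^sup>2" by simp
      qed measurable
      show "AE w in quot. (avg (hyp_disc s) (W a) w - W a w)\<^sup>2 \<le> (\<integral>p. (Y p w)\<^sup>2 \<partial>?P)"
        using AE_quot_disc
      proof eventually_elim
        case (elim w)
        show ?case unfolding eq[OF elim] by (rule P.square_expectation_le[of _ "2 * C"]) (use Yb in auto)
      qed
    qed
    also have "\<dots> = (\<integral>p. (\<integral>w. (Y p w)\<^sup>2 \<partial>quot) \<partial>?P)"
    proof (rule PQ.Fubini_integral)
      interpret fin: finite_measure "?P \<Otimes>\<^sub>M quot"
        by (rule finite_measure_pair_measure) unfold_locales
      show "integrable (?P \<Otimes>\<^sub>M quot) (\<lambda>(p, w). (Y p w)\<^sup>2)"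
        by (rule fin.integrable_const_bound[of _ "(2 * C)\<^sup>2"]) (use Y2b in auto)
    qed
    also have "\<dots> \<le> (\<integral>p. e \<partial>?P)"
    proof (rule integral_mono_AE[OF _ _ small])
      show "integrable ?P (\<lambda>p. \<integral>w. (Y p w)\<^sup>2 \<partial>quot)"
      proof (rule P.integrable_const_bound[of _ "measure quot (space quot) * (2 * C)\<^sup>2"])
        have "norm (\<integral>w. (Y p w)\<^sup>2 \<partial>quot) \<le> measure quot (space quot) * (2 * C)\<^sup>2" for p
        proof -
          have "norm (\<integral>w. (Y p w)\<^sup>2 \<partial>quot) \<le> (\<integral>w. (2 * C)\<^sup>2 \<partial>quot)"
            using Y2b by (intro Bochner_Integration.integral_norm_bound[THEN order_trans] integral_mono quot.integrable_const_bound[of _ "(2 * C)\<^sup>2"]) auto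
          thus ?thesis by simp
        qed
        thus "AE p in ?P. norm (\<integral>w. (Y p w)\<^sup>2 \<partial>quot) \<le> measure quot (space quot) * (2 * C)\<^sup>2" by simp
      qed measurable
    qed auto
    finally show "(\<integral>w. (avg (hyp_disc s) (W a) w - W a w)\<^sup>2 \<partial>quot) \<le> e" by (simp add: P.prob_space)
  qed
qed

text \<open>Self-adjointness tested against the constant 1, which every average fixes.\<close>

lemma integral_W: 
  assumes a: "a \<ge> 0"
  shows "(\<integral>w. W a w \<partial>quot) = (\<integral>w. f w \<partial>quot)"
proof -
  have one: "bounded_borel 1 (\<lambda>_. 1)" "invariant (\<lambda>_. 1 :: real)" "avg \<mu> (\<lambda>_. 1) = (\<lambda>_. 1)" if "radial_prob \<mu>" for \<mu>
    using radial_probD(1)[OF that] by (auto simp: bounded_borel_def invariant_def avg_def prob_space.prob_space)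
  have "(\<integral>w. 1 * W a w \<partial>quot) = (\<integral>w. f w * avg (hyp_circle (rad a)) (avg (hyp_disc r) (\<lambda>_. 1)) w \<partial>quot)"
    unfolding W_def
  proof (rule integral_self_adjoint[OF has_radial_kernel_avg_hyp_disc[OF radial_circle[OF a] r] f one(1) _ one(2)])
    show "avg (hyp_circle (rad a)) (avg (hyp_disc r) f) \<in> borel_measurable borel"
      using W(1)[OF a] unfolding W_def by (rule bounded_borelD)
  qed (auto intro!: avg_nonneg f radial_disc simp: one[OF radial_disc] one[OF radial_circle[OF a]])
  thus ?thesis by (simp add: one[OF radial_disc] one[OF radial_circle[OF a]])
qed

text \<open>Commuting puts the disc average outermost, where it acts on circle averages of f that
  all share the bound C; its modulus of continuity then serves every a.\<close>

lemma W_equicontinuous: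
  assumes e: "e > 0"
  shows "\<exists>d>0. \<forall>a\<ge>0. \<forall>w z. cmod w < 1 \<longrightarrow> cmod z < 1 \<longrightarrow> cmod z < d \<longrightarrow>
    \<bar>W a (disc_translation w z) - W a w\<bar> \<le> e"
proof -
  obtain d where d: "d > 0" "\<And>h w z. bounded_borel C h \<Longrightarrow> cmod w < 1 \<Longrightarrow> cmod z < 1 \<Longrightarrow> cmod z < d \<Longrightarrow>
     \<bar>avg (hyp_disc r) h (disc_translation w z) - avg (hyp_disc r) h w\<bar> \<le> e"
    using hyp_disc_equicontinuous[OF r e, of C] by blast
  show ?thesis
  proof (intro exI[of _ d] conjI allI impI)
    fix a w z assume a: "(0::real) \<le> a" and w: "cmod w < 1" and z: "cmod z < 1" "cmod z < d"
    have "W a w = avg (hyp_disc r) (avg (hyp_circle (rad a)) f) w" if "cmod w < 1" for w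
      unfolding W_def by (rule avg_commute[OF radial_circle[OF a] radial_disc f(1) that])
    thus "\<bar>W a (disc_translation w z) - W a w\<bar> \<le> e"
      using d(2)[OF bounded_borel_avg[OF radial_circle[OF a] f(1)] w z] disc_translation_in_disc[OF w z(1)] w by simp
  qed (rule d(1))
qed

lemma AE_quot_exists:
  assumes "AE w in quot. P w"
  shows "\<exists>w. cmod w < 1 \<and> P w"
proof (rule ccontr)
  assume "\<not> ?thesis"
  hence "AE w in quot. False"
    using assms AE_quot_disc by (elim AE_mp) (auto elim!: eventually_mono)
  hence "emeasure quot UNIV = 0"
    using AE_iff_measurable[of UNIV quot "\<lambda>_. False"] by simp
  thus False using F_pos by (simp add: emeasure_quot_UNIV)
qed

lemma AE_quot_hyp_area: "AE w in hyp_area. P w \<Longrightarrow> AE w in quot. P w"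
  unfolding quot_def by (subst AE_density) (auto elim!: eventually_mono)

text \<open>Equicontinuity and a diagonal choice on a countable dense set give a subsequence
  converging at every point of the disc to some g. The mean value property passes to g, the equality
  case of Jensen makes g constant almost everywhere, and the preserved integral determines the
  constant.\<close>

lemma W_subsequence_tendsto:
  assumes a: "\<And>n. a n \<ge> 0" "filterlim a at_top sequentially"
  shows "\<exists>k. strict_mono (k :: nat \<Rightarrow> nat) \<and> (\<lambda>n. W (a (k n)) 0) \<longlonglongrightarrow> (\<integral>w. f w \<partial>quot) / measure hyp_area F"
proof -
  obtain S :: "complex set" where S: "countable S" "\<And>X. open X \<Longrightarrow> X \<noteq> {} \<Longrightarrow> \<exists>d\<in>S. d \<in> X"
    using countable_dense_exists by blast
  have bd: "\<bar>W (a n) w\<bar> \<le> C" for n w using bounded_borel_bound[OF W(1)[OF a(1)]] .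
  obtain k where k: "strict_mono (k::nat\<Rightarrow>nat)" "\<And>x. x \<in> S \<Longrightarrow> \<exists>l. (\<lambda>n. W (a (k n)) x) \<longlonglongrightarrow> l"
    using function_convergent_subsequence[OF S(1), of "\<lambda>n. W (a n)" C] bd by (metis real_norm_def)
  define h where "h n = W (a (k n))" for n
  have h: "bounded_borel C (h n)" "0 \<le> h n z" "invariant (h n)" for n z
    unfolding h_def using W a by auto
  note [measurable] = bounded_borelD[OF h(1)]
  have ak: "filterlim (\<lambda>n. a (k n)) at_top sequentially"
    by (rule filterlim_compose[OF a(2) filterlim_subseq[OF k(1)]])
  have eqc: "\<exists>d>0. \<forall>n w z. cmod w < 1 \<longrightarrow> cmod z < 1 \<longrightarrow> cmod z < d \<longrightarrow> \<bar>h n (disc_translation w z) - h n w\<bar> \<le> e"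
    if "e > 0" for e
    using W_equicontinuous[OF that] a(1) unfolding h_def by meson
  have conv: "convergent (\<lambda>n. h n w)" if w: "cmod w < 1" for w
  proof (rule Cauchy_convergent, rule CauchyI)
    fix e :: real assume e: "e > 0"
    then obtain d where d: "d > 0" "\<And>n w z. cmod w < 1 \<Longrightarrow> cmod z < 1 \<Longrightarrow> cmod z < d \<Longrightarrow> \<bar>h n (disc_translation w z) - h n w\<bar> \<le> e / 4"
      using eqc[of "e / 4"] by (metis divide_pos_pos zero_less_numeral)
    have den: "1 - cnj w * w \<noteq> 0"
      using disc_translation_denom_nz[of "- w" w] w by simp
    have "((\<lambda>x. disc_translation (- w) x) \<longlongrightarrow> disc_translation (- w) w) (nhds w)"
      unfolding disc_translation_def
      by (rule tendsto_intros filterlim_ident | use den in simp)+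
    hence "\<forall>\<^sub>F x in nhds w. dist (disc_translation (- w) x) (disc_translation (- w) w) < d"
      using d(1) by (rule tendstoD)
    moreover have "disc_translation (- w) w = 0" by (simp add: disc_translation_def)
    moreover have "\<forall>\<^sub>F x in nhds w. x \<in> unit_disc"
      using w by (intro eventually_nhds_in_open) auto
    ultimately have "\<forall>\<^sub>F x in nhds w. cmod (disc_translation (- w) x) < d \<and> cmod x < 1"
      by (auto elim: eventually_elim2)
    then obtain X where X: "open X" "w \<in> X" "\<And>x. x \<in> X \<Longrightarrow> cmod (disc_translation (- w) x) < d \<and> cmod x < 1"
      unfolding eventually_nhds by blast
    then obtain s where s: "s \<in> S" "cmod (disc_translation (- w) s) < d" "cmod s < 1"
      using S(2)[of X] by blast
    have near: "\<bar>h n s - h n w\<bar> \<le> e / 4" for n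
      using d(2)[OF w _ s(2), of n] s w by (simp add: disc_translation_inverse' disc_translation_in_disc)
    have "Cauchy (\<lambda>n. h n s)" using k(2)[OF s(1)] unfolding h_def by (metis LIMSEQ_imp_Cauchy)
    then obtain M where M: "\<And>m n. m \<ge> M \<Longrightarrow> n \<ge> M \<Longrightarrow> norm (h m s - h n s) < e / 4"
      using e by (meson CauchyD divide_pos_pos zero_less_numeral)
    show "\<exists>M. \<forall>m\<ge>M. \<forall>n\<ge>M. norm (h m w - h n w) < e"
    proof (intro exI allI impI)
      fix m n assume "m \<ge> M" "n \<ge> M"
      from M[OF this] near[of m] near[of n] show "norm (h m w - h n w) < e"
        unfolding real_norm_def by linarith
    qed
  qed
  \<comment> \<open>The indicator makes the sequence converge off the disc as well, so g is a Borel
    function on the plane with the bound C.\<close>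
  define g where "g w = lim (\<lambda>n. indicator unit_disc w * h n w)" for w
  have g_lim': "(\<lambda>n. indicator unit_disc w * h n w) \<longlonglongrightarrow> g w" for w
  proof (cases "cmod w < 1")
    case True
    thus ?thesis unfolding g_def using conv[OF True] by (simp add: convergent_LIMSEQ_iff[symmetric])
  qed (simp add: g_def)
  have g_lim: "(\<lambda>n. h n w) \<longlonglongrightarrow> g w" if "cmod w < 1" for w
    using g_lim'[of w] that by simp
  have g_meas [measurable]: "g \<in> borel_measurable borel"
    by (rule borel_measurable_LIMSEQ_real[OF g_lim'])
       (intro borel_measurable_times borel_measurable_indicator bounded_borelD[OF h(1)], simp)
  have g_bound: "\<bar>g w\<bar> \<le> C" for w
  proof (rule LIMSEQ_le_const2[OF tendsto_rabs[OF g_lim']])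
    have "\<bar>indicator unit_disc w * h n w\<bar> \<le> C" for n
      using bounded_borel_bound[OF h(1), of n w] C_nonneg by (simp add: indicator_def)
    thus "\<exists>N. \<forall>n\<ge>N. \<bar>indicator unit_disc w * h n w\<bar> \<le> C" by blast
  qed
  have g: "bounded_borel C g" using g_meas g_bound by (simp add: bounded_borel_def)
  have g_inv: "invariant g"
    unfolding invariant_def
  proof (intro ballI allI impI)
    fix x z assume x: "x \<in> \<Gamma>" and z: "cmod z < 1"
    have "(\<lambda>n. h n z) \<longlonglongrightarrow> g (act x z)"
      using g_lim[OF act_in_disc[OF x z]] h(3) x z by (simp add: invariant_def)
    thus "g (act x z) = g z" using g_lim[OF z] LIMSEQ_unique by blast
  qed
  have mean: "AE w in quot. avg (hyp_disc s) g w = g w" if s: "0 < s" "s < 1" for s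
  proof -
    have rs: "radial_prob (hyp_disc s)" using s by (rule radial_prob_hyp_disc)
    interpret S: prob_space "hyp_disc s" using rs by (rule radial_probD)
    have bh: "bounded_borel (C + C) (\<lambda>w. avg (hyp_disc s) (h n) w - h n w)" for n
      by (rule bounded_borel_diff[OF bounded_borel_avg[OF rs h(1)] h(1)])
    have bg: "bounded_borel (C + C) (\<lambda>w. avg (hyp_disc s) g w - g w)"
      by (rule bounded_borel_diff[OF bounded_borel_avg[OF rs g] g])
    have bh2: "bounded_borel ((C + C) * (C + C)) (\<lambda>w. (avg (hyp_disc s) (h n) w - h n w)\<^sup>2)" for n
      unfolding power2_eq_square by (rule bounded_borel_mult[OF bh bh])
    have bg2: "bounded_borel ((C + C) * (C + C)) (\<lambda>w. (avg (hyp_disc s) g w - g w)\<^sup>2)"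
      unfolding power2_eq_square by (rule bounded_borel_mult[OF bg bg])
    have avg_lim: "(\<lambda>n. avg (hyp_disc s) (h n) w) \<longlonglongrightarrow> avg (hyp_disc s) g w" if w: "cmod w < 1" for w
      unfolding avg_def
    proof (rule integral_dominated_convergence[where w = "\<lambda>_. C"])
      show "AE z in hyp_disc s. (\<lambda>n. h n (disc_translation w z)) \<longlonglongrightarrow> g (disc_translation w z)"
        using radial_probD(3)[OF rs] by eventually_elim (intro g_lim disc_translation_in_disc w)
    qed (use bounded_borel_bound[OF h(1)] in auto)
    have "(\<lambda>n. \<integral>w. (avg (hyp_disc s) (h n) w - h n w)\<^sup>2 \<partial>quot) \<longlonglongrightarrow> (\<integral>w. (avg (hyp_disc s) g w - g w)\<^sup>2 \<partial>quot)"
    proof (rule integral_dominated_convergence[where w = "\<lambda>_. (C + C) * (C + C)"])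
      show "AE w in quot. (\<lambda>n. (avg (hyp_disc s) (h n) w - h n w)\<^sup>2) \<longlonglongrightarrow> (avg (hyp_disc s) g w - g w)\<^sup>2"
        using AE_quot_disc by eventually_elim (intro tendsto_intros avg_lim g_lim)
    qed (use bounded_borelD[OF bh2] bounded_borelD[OF bg2] bounded_borel_bound[OF bh2] in auto)
    moreover have "(\<lambda>n. \<integral>w. (avg (hyp_disc s) (h n) w - h n w)\<^sup>2 \<partial>quot) \<longlonglongrightarrow> 0"
    proof (rule tendstoI)
      fix e :: real assume e: "e > 0"
      then obtain T where T: "\<And>b. b \<ge> T \<Longrightarrow> (\<integral>w. (avg (hyp_disc s) (W b) w - W b w)\<^sup>2 \<partial>quot) \<le> e / 2"
        using W_mean_value[OF s, of "e / 2"] by auto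
      have "\<forall>\<^sub>F n in sequentially. a (k n) \<ge> T"
        using ak by (simp add: filterlim_at_top)
      thus "\<forall>\<^sub>F n in sequentially. dist (\<integral>w. (avg (hyp_disc s) (h n) w - h n w)\<^sup>2 \<partial>quot) 0 < e"
      proof eventually_elim
        case (elim n)
        have "(\<integral>w. (avg (hyp_disc s) (h n) w - h n w)\<^sup>2 \<partial>quot) \<ge> 0" by simp
        with T[OF elim] e show ?case unfolding h_def dist_real_def by simp
      qed
    qed
    ultimately have "(\<integral>w. (avg (hyp_disc s) g w - g w)\<^sup>2 \<partial>quot) = 0"
      using LIMSEQ_unique by blast
    hence "AE w in quot. (avg (hyp_disc s) g w - g w)\<^sup>2 = 0"
      using integrable_quot[OF bg2] by (subst (asm) integral_nonneg_eq_0_iff_AE) auto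
    thus ?thesis by eventually_elim simp
  qed
  \<comment> \<open>Averaging is self-adjoint and fixes 1, so the average of g^2 and g^2 itself have
    the same integral over the quotient. By Jensen and the mean value property the first dominates,
    so they agree almost everywhere: g has variance zero on the disc of radius s about w.\<close>
  have circ: "AE w in quot. AE z in hyp_disc s. g (disc_translation w z) = g w" if s: "0 < s" "s < 1" for s
  proof -
    have rs: "radial_prob (hyp_disc s)" using s by (rule radial_prob_hyp_disc)
    interpret S: prob_space "hyp_disc s" using rs by (rule radial_probD)
    have gg: "bounded_borel (C * C) (\<lambda>w. (g w)\<^sup>2)"
      unfolding power2_eq_square by (rule bounded_borel_mult[OF g g])
    note bgg = bounded_borel_avg[OF rs gg]
    have one: "bounded_borel 1 (\<lambda>_. 1)" "invariant (\<lambda>_. 1 :: real)" "avg (hyp_disc s) (\<lambda>_. 1) = (\<lambda>_. 1)"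
      by (auto simp: bounded_borel_def invariant_def avg_def S.prob_space)
    have "(\<integral>w. 1 * avg (hyp_disc s) (\<lambda>w. (g w)\<^sup>2) w \<partial>quot) = (\<integral>w. (g w)\<^sup>2 * avg (hyp_disc s) (\<lambda>_. 1) w \<partial>quot)"
      by (rule integral_self_adjoint[OF has_radial_kernel_hyp_disc[OF s] gg _ _ one(1) _ one(2)])
         (use g_inv bounded_borelD[OF bgg] in \<open>auto intro!: avg_nonneg simp: one invariant_def\<close>)
    hence I0: "(\<integral>w. avg (hyp_disc s) (\<lambda>w. (g w)\<^sup>2) w - (g w)\<^sup>2 \<partial>quot) = 0"
      using integrable_quot[OF bgg] integrable_quot[OF gg] by (simp add: one)
    have "AE w in quot. avg (hyp_disc s) (\<lambda>w. (g w)\<^sup>2) w - (g w)\<^sup>2 = 0"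
    proof (subst integral_nonneg_eq_0_iff_AE[symmetric])
      show "AE w in quot. 0 \<le> avg (hyp_disc s) (\<lambda>w. (g w)\<^sup>2) w - (g w)\<^sup>2"
        using mean[OF s]
      proof eventually_elim
        case (elim w)
        have "(avg (hyp_disc s) g w)\<^sup>2 \<le> avg (hyp_disc s) (\<lambda>w. (g w)\<^sup>2) w"
          unfolding avg_def by (rule S.square_expectation_le[of _ C]) (use g_bound in auto)
        thus ?case using elim by simp
      qed
    qed (use I0 integrable_quot[OF bgg] integrable_quot[OF gg] in auto)
    thus ?thesis using mean[OF s]
    proof eventually_elim
      case (elim w)
      have i1: "integrable (hyp_disc s) (\<lambda>z. g (disc_translation w z))"
        "integrable (hyp_disc s) (\<lambda>z. (g (disc_translation w z))\<^sup>2)"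
        by (rule bounded_borel_integrable[OF S.prob_space_axioms _ g] bounded_borel_integrable[OF S.prob_space_axioms _ gg]; measurable)+
      have "(\<integral>z. (g (disc_translation w z) - g w)\<^sup>2 \<partial>hyp_disc s)
        = (\<integral>z. (g (disc_translation w z))\<^sup>2 - 2 * g w * g (disc_translation w z) + (g w)\<^sup>2 \<partial>hyp_disc s)"
        by (simp add: power2_diff algebra_simps)
      also have "\<dots> = avg (hyp_disc s) (\<lambda>w. (g w)\<^sup>2) w - 2 * g w * avg (hyp_disc s) g w + (g w)\<^sup>2"
        unfolding avg_def using i1 by (simp add: S.prob_space)
      also have "\<dots> = 0" using elim by (simp add: power2_eq_square)
      finally have "(\<integral>z. (g (disc_translation w z) - g w)\<^sup>2 \<partial>hyp_disc s) = 0" .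
      hence "AE z in hyp_disc s. (g (disc_translation w z) - g w)\<^sup>2 = 0"
      proof (subst (asm) integral_nonneg_eq_0_iff_AE)
        have "integrable (hyp_disc s) (\<lambda>z. (g (disc_translation w z))\<^sup>2 - 2 * g w * g (disc_translation w z) + (g w)\<^sup>2)"
          using i1 by simp
        thus "integrable (hyp_disc s) (\<lambda>z. (g (disc_translation w z) - g w)\<^sup>2)"
          by (simp add: power2_diff algebra_simps)
      qed auto
      thus ?case by eventually_elim simp
    qed
  qed
  \<comment> \<open>Countably many radii tending to 1, so that one base point w0 works for all of
    them and the discs about it fill the unit disc.\<close>
  define \<rho> :: "nat \<Rightarrow> real" where "\<rho> n = 1 - 1 / (n + 2)" for n
  have \<rho>: "0 < \<rho> n" "\<rho> n < 1" for n by (auto simp: \<rho>_def)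
  have "AE w in quot. \<forall>n. AE z in hyp_disc (\<rho> n). g (disc_translation w z) = g w"
    unfolding AE_all_countable using circ[OF \<rho>] by blast
  then obtain w0 where w0: "cmod w0 < 1" "\<And>n. AE z in hyp_disc (\<rho> n). g (disc_translation w0 z) = g w0"
    using AE_quot_exists by blast
  define c where "c = g w0"
  have "AE z in hyp_area. \<forall>n. z \<in> ball 0 (\<rho> n) \<longrightarrow> g (disc_translation w0 z) = c"
    unfolding AE_all_countable
  proof
    fix n
    show "AE z in hyp_area. z \<in> ball 0 (\<rho> n) \<longrightarrow> g (disc_translation w0 z) = c"
      using w0(2)[of n] emeasure_hyp_area_ball[OF \<rho>, of n]
      unfolding hyp_disc_def c_def by (subst (asm) AE_uniform_measure) auto
  qed
  hence "AE z in hyp_area. g (disc_translation w0 z) = c"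
    using AE_hyp_area_disc
  proof eventually_elim
    case (elim z)
    hence "1 - cmod z > 0" by simp
    then obtain n where "1 / real (Suc n) < 1 - cmod z" using reals_Archimedean inverse_eq_divide by metis
    moreover have "1 / (real n + 2) \<le> 1 / real (Suc n)" by (simp add: divide_simps)
    ultimately have "z \<in> ball 0 (\<rho> n)" by (simp add: \<rho>_def)
    with elim show ?case by blast
  qed
  hence "AE y in distr hyp_area borel (disc_translation w0). g y = c"
    by (subst AE_distr_iff) (auto cong: measurable_cong_sets)
  hence gc: "AE y in hyp_area. g y = c"
    unfolding distr_hyp_area_disc_translation[OF w0(1)] .
  \<comment> \<open>So far g = c only almost everywhere; equicontinuity of the functions
    \<open>h n\<close> carries the value over to the single point 0.\<close>
  have "g 0 = c"
  proof (rule ccontr)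
    assume "g 0 \<noteq> c"
    hence e: "\<bar>c - g 0\<bar> / 2 > 0" by simp
    then obtain d where d: "d > 0" "\<And>n w z. cmod w < 1 \<Longrightarrow> cmod z < 1 \<Longrightarrow> cmod z < d \<Longrightarrow> \<bar>h n (disc_translation w z) - h n w\<bar> \<le> \<bar>c - g 0\<bar> / 2"
      using eqc[OF e] by blast
    define d' where "d' = min d (1/2)"
    have d': "0 < d'" "d' < 1" "d' \<le> d" using d(1) by (auto simp: d'_def)
    have "AE y in hyp_disc d'. cmod y < d' \<and> g y = c"
      unfolding hyp_disc_def using gc by (intro AE_uniform_measureI) auto
    moreover have "ae_filter (hyp_disc d') \<noteq> bot"
      using prob_space.ae_filter_bot radial_probD(1)[OF radial_prob_hyp_disc[OF d'(1,2)]] by blast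
    ultimately obtain y where y: "cmod y < d'" "g y = c"
      using eventually_happens' by blast
    have "(\<lambda>n. \<bar>h n y - h n 0\<bar>) \<longlonglongrightarrow> \<bar>g y - g 0\<bar>"
      using y d' by (intro tendsto_intros g_lim) auto
    hence "\<bar>g y - g 0\<bar> \<le> \<bar>c - g 0\<bar> / 2"
      by (rule LIMSEQ_le_const2) (use d(2)[of 0 y] y d' in auto)
    with y e show False by simp
  qed
  moreover have "c * measure hyp_area F = (\<integral>w. f w \<partial>quot)"
  proof -
    have "(\<lambda>n. \<integral>w. h n w \<partial>quot) \<longlonglongrightarrow> (\<integral>w. g w \<partial>quot)"
    proof (rule integral_dominated_convergence[where w = "\<lambda>_. C"])
      show "AE w in quot. (\<lambda>n. h n w) \<longlonglongrightarrow> g w"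
        using AE_quot_disc by eventually_elim (rule g_lim)
    qed (use bounded_borel_bound[OF h(1)] in auto)
    moreover have "(\<integral>w. h n w \<partial>quot) = (\<integral>w. f w \<partial>quot)" for n
      unfolding h_def by (rule integral_W[OF a(1)])
    ultimately have "(\<integral>w. f w \<partial>quot) = (\<integral>w. g w \<partial>quot)"
      by (simp add: LIMSEQ_const_iff)
    also have "\<dots> = (\<integral>w. c \<partial>quot)"
      by (rule integral_cong_AE) (use AE_quot_hyp_area[OF gc] in auto)
    also have "\<dots> = c * measure hyp_area F"
      by (simp add: measure_def emeasure_quot_UNIV mult.commute)
    finally show ?thesis ..
  qed
  moreover have "measure hyp_area F > 0"
    using F_pos F_finite by (simp add: measure_def enn2real_positive_iff)
  ultimately have "g 0 = (\<integral>w. f w \<partial>quot) / measure hyp_area F"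
    by (simp add: field_simps)
  with g_lim[of 0] k(1) show ?thesis unfolding h_def by auto
qed

lemma W_tendsto: "((\<lambda>a. W a 0) \<longlongrightarrow> (\<integral>w. f w \<partial>quot) / measure hyp_area F) at_top"
proof (rule ccontr)
  let ?m = "(\<integral>w. f w \<partial>quot) / measure hyp_area F"
  assume "\<not> ?thesis"
  then obtain e where e: "e > 0" "\<not> (\<forall>\<^sub>F a in at_top. dist (W a 0) ?m < e)"
    unfolding tendsto_iff by blast
  have "\<exists>a. a \<ge> real n \<and> \<not> dist (W a 0) ?m < e" for n
    using e(2) unfolding eventually_at_top_linorder by blast
  then obtain a where a: "\<And>n. a n \<ge> real n" "\<And>n. \<not> dist (W (a n) 0) ?m < e" by metis
  have a0: "a n \<ge> 0" for n using a(1)[of n] of_nat_0_le_iff[of n, where 'a = real] by linarith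
  have "filterlim a at_top sequentially"
    by (rule filterlim_at_top_mono[OF filterlim_real_sequentially]) (use a in auto)
  from W_subsequence_tendsto[OF a0 this] obtain k where "(\<lambda>n. W (a (k n)) 0) \<longlonglongrightarrow> ?m" by blast
  from tendstoD[OF this e(1)] have "\<forall>\<^sub>F n in sequentially. dist (W (a (k n)) 0) ?m < e" .
  then obtain n where "dist (W (a (k n)) 0) ?m < e" by (auto simp: eventually_sequentially)
  with a(2) show False by blast
qed

end

context disc_quotient
begin

text \<open>Uniform continuity of f undoes the smoothing: for a disc of small radius r the circle
  averages of f and of its disc average differ by at most e/4, uniformly in the circle.\<close>

theorem hyp_circle_equidistribution:
  assumes f: "bounded_borel C f" "\<And>z. 0 \<le> f z" "invariant f" and uc: "hyp_uniformly_continuous f"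
  shows "((\<lambda>\<rho>. avg (hyp_circle \<rho>) f 0) \<longlongrightarrow> (\<integral>w. f w \<partial>quot) / measure hyp_area F) (at_left 1)"
proof (rule tendstoI)
  let ?m = "(\<integral>w. f w \<partial>quot) / measure hyp_area F"
  fix e :: real assume e: "e > 0"
  then obtain d where d: "d > 0" "\<And>w z. cmod w < 1 \<Longrightarrow> cmod z < 1 \<Longrightarrow> cmod z < d \<Longrightarrow> \<bar>f (disc_translation w z) - f w\<bar> \<le> e / 4"
    using uc unfolding hyp_uniformly_continuous_def by (metis divide_pos_pos zero_less_numeral)
  define r where "r = min d (1/2)"
  have rd: "0 < r" "r < 1" "r \<le> d" using d(1) by (auto simp: r_def)
  interpret disc_quotient_function \<Gamma> act iv F f C r
    by unfold_locales (use f rd in auto)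
  interpret R: prob_space "hyp_disc r" using radial_disc by (rule radial_probD)
  note [measurable] = bounded_borelD[OF f(1)] bounded_borelD[OF f1(1)]
  have near1: "\<bar>avg (hyp_disc r) f w - f w\<bar> \<le> e / 4" if w: "cmod w < 1" for w
  proof -
    have int: "integrable (hyp_disc r) (\<lambda>z. f (disc_translation w z))"
      by (rule bounded_borel_integrable[OF R.prob_space_axioms _ f(1)]) measurable
    have "avg (hyp_disc r) f w - f w = (\<integral>z. f (disc_translation w z) - f w \<partial>hyp_disc r)"
      unfolding avg_def using int by (simp add: R.prob_space)
    also have "\<bar>\<dots>\<bar> \<le> (\<integral>z. \<bar>f (disc_translation w z) - f w\<bar> \<partial>hyp_disc r)" by (rule integral_abs_bound)
    also have "\<dots> \<le> (\<integral>z. e / 4 \<partial>hyp_disc r)"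
    proof (rule integral_mono_AE)
      show "AE z in hyp_disc r. \<bar>f (disc_translation w z) - f w\<bar> \<le> e / 4"
        unfolding hyp_disc_def
        by (intro AE_uniform_measureI AE_I2 impI) (use rd d(2)[OF w] in auto)
    qed (use int in auto)
    finally show ?thesis by (simp add: R.prob_space)
  qed
  have near: "\<bar>avg (hyp_circle \<rho>) f 0 - avg (hyp_circle \<rho>) (avg (hyp_disc r) f) 0\<bar> \<le> e / 4"
    if \<rho>: "0 \<le> \<rho>" "\<rho> < 1" for \<rho>
  proof -
    have rc: "radial_prob (hyp_circle \<rho>)" using \<rho> by (rule radial_prob_hyp_circle)
    interpret c: prob_space "hyp_circle \<rho>" using rc by (rule radial_probD)
    have int: "integrable (hyp_circle \<rho>) f" "integrable (hyp_circle \<rho>) (avg (hyp_disc r) f)"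
      using bounded_borel_integrable[OF c.prob_space_axioms _ f(1), of "\<lambda>z. z"]
        bounded_borel_integrable[OF c.prob_space_axioms _ f1(1), of "\<lambda>z. z"] by auto
    have "avg (hyp_circle \<rho>) f 0 - avg (hyp_circle \<rho>) (avg (hyp_disc r) f) 0
        = (\<integral>z. f z - avg (hyp_disc r) f z \<partial>hyp_circle \<rho>)"
      unfolding avg_def[of "hyp_circle \<rho>"] using int by simp
    also have "\<bar>\<dots>\<bar> \<le> (\<integral>z. \<bar>f z - avg (hyp_disc r) f z\<bar> \<partial>hyp_circle \<rho>)" by (rule integral_abs_bound)
    also have "\<dots> \<le> (\<integral>z. e / 4 \<partial>hyp_circle \<rho>)"
    proof (rule integral_mono_AE)
      show "AE z in hyp_circle \<rho>. \<bar>f z - avg (hyp_disc r) f z\<bar> \<le> e / 4"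
        using radial_probD(3)[OF rc] by eventually_elim (use near1 in \<open>simp add: abs_minus_commute\<close>)
    qed (use int in auto)
    finally show ?thesis by (simp add: c.prob_space)
  qed
  have "filterlim (\<lambda>\<rho>::real. - ln (1 - \<rho>\<^sup>2)) at_top (at_left 1)" by real_asymp
  hence "((\<lambda>\<rho>. W (- ln (1 - \<rho>\<^sup>2)) 0) \<longlongrightarrow> ?m) (at_left 1)"
    by (rule filterlim_compose[OF W_tendsto])
  hence "\<forall>\<^sub>F \<rho> in at_left 1. dist (W (- ln (1 - \<rho>\<^sup>2)) 0) ?m < e / 2"
    using e by (intro tendstoD) auto
  moreover have "\<forall>\<^sub>F \<rho> in at_left (1::real). \<rho> \<in> {0<..<1}"
    by (rule eventually_at_left_real) simp
  ultimately show "\<forall>\<^sub>F \<rho> in at_left 1. dist (avg (hyp_circle \<rho>) f 0) ?m < e"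
  proof eventually_elim
    case (elim \<rho>)
    hence "\<rho>\<^sup>2 < 1" by (simp add: abs_square_less_1)
    hence "rad (- ln (1 - \<rho>\<^sup>2)) = \<rho>" using elim by (simp add: rad_def)
    with elim(1) have "\<bar>avg (hyp_circle \<rho>) (avg (hyp_disc r) f) 0 - ?m\<bar> < e / 2"
      by (simp add: W_def dist_real_def)
    moreover have "\<bar>avg (hyp_circle \<rho>) f 0 - avg (hyp_circle \<rho>) (avg (hyp_disc r) f) 0\<bar> \<le> e / 4"
      using elim by (intro near) auto
    ultimately show ?case using e unfolding dist_real_def by linarith
  qed
qed

end

section \<open>Parseval's identity and extraction of coefficients\<close>

text \<open>Rotation by c = exp (i pi / (n - m)) multiplies the integrand by -1.\<close>

lemma circle_measure_orthogonal:
  assumes "m < n"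
  shows "(\<integral>u. u ^ m * cnj u ^ n \<partial>circle_measure) = 0"
proof -
  interpret tau: prob_space circle_measure by (rule prob_space_circle_measure)
  define c where "c = cis (pi / real (n - m))"
  have c: "cmod c = 1" by (simp add: c_def)
  have cc: "c * cnj c = 1" using c by (simp flip: complex_norm_square)
  have "c ^ m * cnj c ^ n = (c * cnj c) ^ m * cnj c ^ (n - m)"
    using assms by (simp add: power_mult_distrib power_add[symmetric])
  also have "cnj c ^ (n - m) = cnj (c ^ (n - m))" by simp
  also have "c ^ (n - m) = -1"
  proof -
    have "real (n - m) * (pi / real (n - m)) = pi" using assms by simp
    thus ?thesis unfolding c_def Complex.DeMoivre by (simp only: cis_pi)
  qed
  finally have cmn: "c ^ m * cnj c ^ n = -1" by (simp add: cc)
  have "(\<integral>u. u ^ m * cnj u ^ n \<partial>circle_measure) = (\<integral>u. (c * u) ^ m * cnj (c * u) ^ n \<partial>circle_measure)"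
    by (rule integral_circle_measure_rotate[OF _ c, symmetric]) measurable
  also have "\<dots> = (\<integral>u. (c ^ m * cnj c ^ n) * (u ^ m * cnj u ^ n) \<partial>circle_measure)"
    by (simp add: power_mult_distrib mult_ac)
  also have "\<dots> = - (\<integral>u. u ^ m * cnj u ^ n \<partial>circle_measure)"
    unfolding cmn by simp
  finally have "2 * (\<integral>u. u ^ m * cnj u ^ n \<partial>circle_measure) = 0"
    unfolding mult_2 by (simp only: eq_neg_iff_add_eq_0)
  thus ?thesis by simp
qed

lemma parseval_polynomial:
  fixes q :: "nat \<Rightarrow> complex"
  shows "(\<integral>u. (cmod (\<Sum>m<N. q m * u ^ m))\<^sup>2 \<partial>circle_measure) = (\<Sum>m<N. (cmod (q m))\<^sup>2)"
proof (induction N)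
  case (Suc N)
  interpret tau: prob_space circle_measure by (rule prob_space_circle_measure)
  define P where "P u = (\<Sum>m<N. q m * u ^ m)" for u
  have [measurable]: "P \<in> borel_measurable borel" unfolding P_def by measurable
  have bP: "AE u in circle_measure. cmod (P u) \<le> (\<Sum>m<N. cmod (q m))"
    using AE_circle_measure
    by eventually_elim (auto simp: P_def norm_mult norm_power intro!: order_trans[OF norm_sum] sum_mono)
  have iP: "integrable circle_measure (\<lambda>u. (cmod (P u))\<^sup>2)"
    by (rule tau.integrable_const_bound[of _ "(\<Sum>m<N. cmod (q m))\<^sup>2"])
       (use bP in \<open>auto elim!: eventually_mono intro!: power_mono\<close>)
  have iX: "integrable circle_measure (\<lambda>u. u ^ m * cnj u ^ n)" for m n
    by (rule tau.integrable_const_bound[of _ 1])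
       (use AE_circle_measure in \<open>auto elim!: eventually_mono simp: norm_mult norm_power\<close>)
  have iPX: "integrable circle_measure (\<lambda>u. P u * cnj (q N * u ^ N))"
    unfolding P_def sum_distrib_right
    using iX by (auto intro!: Bochner_Integration.integrable_sum simp: mult.assoc mult.left_commute[of _ "cnj (q N)"])
  have zero: "(\<integral>u. P u * cnj (q N * u ^ N) \<partial>circle_measure) = 0"
  proof -
    have "(\<integral>u. P u * cnj (q N * u ^ N) \<partial>circle_measure)
      = (\<integral>u. (\<Sum>m<N. (q m * cnj (q N)) * (u ^ m * cnj u ^ N)) \<partial>circle_measure)"
    proof (rule Bochner_Integration.integral_cong[OF refl])
      fix u
      show "P u * cnj (q N * u ^ N) = (\<Sum>m<N. (q m * cnj (q N)) * (u ^ m * cnj u ^ N))"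
        by (simp add: P_def sum_distrib_right sum_distrib_left mult_ac)
    qed
    also have "\<dots> = (\<Sum>m<N. \<integral>u. (q m * cnj (q N)) * (u ^ m * cnj u ^ N) \<partial>circle_measure)"
      by (rule Bochner_Integration.integral_sum) (use iX in auto)
    also have "\<dots> = 0" using circle_measure_orthogonal by simp
    finally show ?thesis .
  qed
  have "(\<integral>u. (cmod (\<Sum>m<Suc N. q m * u ^ m))\<^sup>2 \<partial>circle_measure)
    = (\<integral>u. (cmod (P u))\<^sup>2 + 2 * Re (P u * cnj (q N * u ^ N)) + (cmod (q N))\<^sup>2 \<partial>circle_measure)"
  proof (rule integral_cong_AE)
    show "AE u in circle_measure. (cmod (\<Sum>m<Suc N. q m * u ^ m))\<^sup>2
      = (cmod (P u))\<^sup>2 + 2 * Re (P u * cnj (q N * u ^ N)) + (cmod (q N))\<^sup>2"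
      using AE_circle_measure
    proof eventually_elim
      case (elim u)
      have "(cmod (P u + q N * u ^ N))\<^sup>2 = (cmod (P u))\<^sup>2 + 2 * Re (P u * cnj (q N * u ^ N)) + (cmod (q N * u ^ N))\<^sup>2"
      proof -
        have "(cmod (a + b))\<^sup>2 = (cmod a)\<^sup>2 + 2 * Re (a * cnj b) + (cmod b)\<^sup>2" for a b
          unfolding cmod_power2 by (simp add: power2_eq_square algebra_simps)
        thus ?thesis .
      qed
      thus ?case using elim by (simp add: P_def norm_mult norm_power)
    qed
  qed measurable
  also have "\<dots> = (\<integral>u. (cmod (P u))\<^sup>2 \<partial>circle_measure) + 2 * Re (\<integral>u. P u * cnj (q N * u ^ N) \<partial>circle_measure) + (cmod (q N))\<^sup>2"
  proof -
    define R where "R u = Re (P u * cnj (q N * u ^ N))" for u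
    have iR: "integrable circle_measure R" unfolding R_def by (rule integrable_Re[OF iPX])
    have "(\<integral>u. R u \<partial>circle_measure) = Re (\<integral>u. P u * cnj (q N * u ^ N) \<partial>circle_measure)"
      unfolding R_def by (rule integral_Re[OF iPX])
    moreover have "(\<integral>u. (cmod (P u))\<^sup>2 + 2 * R u + (cmod (q N))\<^sup>2 \<partial>circle_measure)
      = (\<integral>u. (cmod (P u))\<^sup>2 \<partial>circle_measure) + 2 * (\<integral>u. R u \<partial>circle_measure) + (cmod (q N))\<^sup>2"
      using iP iR by (simp add: tau.prob_space)
    ultimately show ?thesis unfolding R_def by presburger
  qed
  finally show ?case using Suc zero by (simp add: P_def)
qed simp

text \<open>\<Phi> stands for |G|^2 because a Borel function on the whole plane is wanted, while G
  is controlled only inside the disc. Absolute convergence at radius \<rho> < 1 dominates the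
  partial sums.\<close>

lemma parseval_circle_measure:
  fixes q :: "nat \<Rightarrow> complex" and G :: "complex \<Rightarrow> complex" and \<Phi> :: "complex \<Rightarrow> real"
  assumes G: "\<And>z. cmod z < 1 \<Longrightarrow> ((\<lambda>m. q m * z ^ m) has_sum G z) UNIV"
    and \<Phi>: "\<And>z. cmod z < 1 \<Longrightarrow> \<Phi> z = (cmod (G z))\<^sup>2" and [measurable]: "\<Phi> \<in> borel_measurable borel"
    and \<rho>: "0 \<le> \<rho>" "\<rho> < 1"
  shows "(\<lambda>m. (cmod (q m))\<^sup>2 * \<rho> ^ (2 * m)) sums (\<integral>u. \<Phi> (u * of_real \<rho>) \<partial>circle_measure)"
proof -
  interpret tau: prob_space circle_measure by (rule prob_space_circle_measure)
  define c where "c m = q m * of_real \<rho> ^ m" for m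
  have summ: "summable (\<lambda>m. cmod (c m))"
  proof -
    have "(\<lambda>m. q m * of_real \<rho> ^ m) summable_on UNIV"
      using G[of "of_real \<rho>"] \<rho> by (auto simp: summable_on_def)
    thus ?thesis unfolding c_def
      by (subst (asm) summable_on_iff_abs_summable_on_complex) (rule summable_on_imp_summable)
  qed
  define P where "P N u = (\<Sum>m<N. c m * u ^ m)" for N and u :: complex
  have P_le: "cmod (P N u) \<le> (\<Sum>m. cmod (c m))" if "cmod u = 1" for N u
  proof -
    have "cmod (P N u) \<le> (\<Sum>m<N. cmod (c m))"
      unfolding P_def by (rule order_trans[OF norm_sum]) (simp add: norm_mult norm_power that)
    also have "\<dots> \<le> (\<Sum>m. cmod (c m))" by (rule sum_le_suminf[OF summ]) auto
    finally show ?thesis .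
  qed
  have P_lim: "(\<lambda>N. P N u) \<longlonglongrightarrow> G (u * of_real \<rho>)" if "cmod u = 1" for u
  proof -
    have "(\<lambda>m. q m * (u * of_real \<rho>) ^ m) sums G (u * of_real \<rho>)"
      using G[of "u * of_real \<rho>"] \<rho> that by (intro has_sum_imp_sums) (auto simp: norm_mult)
    thus ?thesis unfolding sums_def P_def c_def by (simp add: power_mult_distrib mult_ac)
  qed
  have "(\<lambda>N. \<integral>u. (cmod (P N u))\<^sup>2 \<partial>circle_measure) \<longlonglongrightarrow> (\<integral>u. \<Phi> (u * of_real \<rho>) \<partial>circle_measure)"
  proof (rule integral_dominated_convergence[where w = "\<lambda>_. (\<Sum>m. cmod (c m))\<^sup>2"])
    show "(\<lambda>u. (cmod (P N u))\<^sup>2) \<in> borel_measurable circle_measure" for N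
      unfolding P_def by measurable
    show "AE u in circle_measure. (\<lambda>N. (cmod (P N u))\<^sup>2) \<longlonglongrightarrow> \<Phi> (u * of_real \<rho>)"
      using AE_circle_measure
    proof eventually_elim
      case (elim u)
      have "\<Phi> (u * of_real \<rho>) = (cmod (G (u * of_real \<rho>)))\<^sup>2" using elim \<rho> by (intro \<Phi>) (simp add: norm_mult)
      thus ?case using P_lim[OF elim] by (auto intro!: tendsto_intros)
    qed
    show "AE u in circle_measure. norm ((cmod (P N u))\<^sup>2) \<le> (\<Sum>m. cmod (c m))\<^sup>2" for N
      using AE_circle_measure by eventually_elim (auto intro!: power_mono P_le)
  qed auto
  moreover have "(\<integral>u. (cmod (P N u))\<^sup>2 \<partial>circle_measure) = (\<Sum>m<N. (cmod (q m))\<^sup>2 * \<rho> ^ (2 * m))" for N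
    unfolding P_def parseval_polynomial c_def using \<rho>
    by (simp add: norm_mult norm_power power_mult_distrib power_mult[symmetric] mult.commute)
  ultimately show ?thesis by (simp add: sums_def)
qed

section \<open>Extracting coefficients of power series\<close>

lemma power_series_tail_bound:
  fixes b :: "nat \<Rightarrow> real"
  assumes b: "\<And>m. \<bar>b m\<bar> \<le> B * K ^ m" and K: "K \<ge> 0" and x: "0 \<le> x" "K * x \<le> 1/2"
  shows "\<bar>(\<Sum>m. b m * x ^ m) - (\<Sum>m<n. b m * x ^ m)\<bar> \<le> 2 * B * (K * x) ^ n"
    "summable (\<lambda>m. b m * x ^ m)"
proof -
  have B: "B \<ge> 0" using b[of 0] by simp
  have le: "\<bar>b m * x ^ m\<bar> \<le> B * (K * x) ^ m" for m
    using mult_right_mono[OF b[of m], of "x ^ m"] x(1) by (simp add: abs_mult power_mult_distrib mult_ac)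
  have Kx: "0 \<le> K * x" "K * x < 1" using K x by auto
  have sg: "summable (\<lambda>m. B * (K * x) ^ m)" using Kx by (intro summable_mult summable_geometric) simp
  show s: "summable (\<lambda>m. b m * x ^ m)"
    by (rule summable_comparison_test'[OF sg, of 0]) (use le in auto)
  have s1: "summable (\<lambda>m. B * (K * x) ^ (m + n))" by (rule summable_ignore_initial_segment[OF sg])
  have "(\<Sum>m. b m * x ^ m) - (\<Sum>m<n. b m * x ^ m) = (\<Sum>m. b (m + n) * x ^ (m + n))"
    using suminf_split_initial_segment[OF s, of n] by simp
  also have "\<bar>\<dots>\<bar> \<le> (\<Sum>m. B * (K * x) ^ (m + n))"
    using norm_suminf_le[OF _ s1, of "\<lambda>m. b (m + n) * x ^ (m + n)"] le[of "_ + n"]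
    unfolding real_norm_def by blast
  also have "(\<Sum>m. B * (K * x) ^ (m + n)) = B * (K * x) ^ n * (\<Sum>m. (K * x) ^ m)"
    using Kx by (subst suminf_mult[symmetric]) (auto simp: power_add mult_ac)
  also have "(\<Sum>m. (K * x) ^ m) = 1 / (1 - K * x)" using Kx by (intro suminf_geometric) simp
  also have "B * (K * x) ^ n * (1 / (1 - K * x)) \<le> B * (K * x) ^ n * 2"
  proof (rule mult_left_mono)
    show "1 / (1 - K * x) \<le> 2" using Kx x(2) by (simp add: divide_le_eq)
  qed (intro mult_nonneg_nonneg zero_le_power B Kx(1))
  finally show "\<bar>(\<Sum>m. b m * x ^ m) - (\<Sum>m<n. b m * x ^ m)\<bar> \<le> 2 * B * (K * x) ^ n" by simp
qed

text \<open>After removing n terms and dividing by x^n, the n-th coefficient is followed by a tail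
  of order x; the ratio K x \<le> 1/2 bounds this tail by twice the bound of its leading
  term.\<close>

lemma power_series_coefficient_approx:
  fixes b :: "nat \<Rightarrow> real"
  assumes b: "\<And>m. \<bar>b m\<bar> \<le> B * K ^ m" and K: "K \<ge> 0" and x: "0 < x" "K * x \<le> 1/2"
  shows "\<bar>((\<Sum>m. b m * x ^ m) - (\<Sum>m<n. b m * x ^ m)) / x ^ n - b n\<bar> \<le> 2 * B * K ^ Suc n * x"
proof -
  have "\<bar>(\<Sum>m. b m * x ^ m) - (\<Sum>m<Suc n. b m * x ^ m)\<bar> \<le> 2 * B * (K * x) ^ Suc n"
    using assms by (intro power_series_tail_bound) auto
  moreover have "(\<Sum>m. b m * x ^ m) - (\<Sum>m<Suc n. b m * x ^ m)
      = (((\<Sum>m. b m * x ^ m) - (\<Sum>m<n. b m * x ^ m)) / x ^ n - b n) * x ^ n"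
    using x(1) by (simp add: field_simps)
  moreover have "2 * B * (K * x) ^ Suc n = 2 * B * K ^ Suc n * x * x ^ n" by (simp add: power_mult_distrib)
  ultimately have "\<bar>(((\<Sum>m. b m * x ^ m) - (\<Sum>m<n. b m * x ^ m)) / x ^ n - b n) * x ^ n\<bar> \<le> 2 * B * K ^ Suc n * x * x ^ n"
    by (simp only:)
  hence "\<bar>((\<Sum>m. b m * x ^ m) - (\<Sum>m<n. b m * x ^ m)) / x ^ n - b n\<bar> * x ^ n \<le> 2 * B * K ^ Suc n * x * x ^ n"
    unfolding abs_mult using x(1) by simp
  thus ?thesis using x(1) mult_le_cancel_right_pos[of "x ^ n"] zero_less_power[of x n] by blast
qed

text \<open>By induction the lower coefficients tend to 0, so dividing by x^n isolates the n-th up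
  to an error of order x that is uniform along the filter. Hence x is fixed small first and the
  limit in r is taken afterwards.\<close>

lemma power_series_coefficients_tendsto:
  fixes b :: "'a \<Rightarrow> nat \<Rightarrow> real" and Fl :: "'a filter"
  assumes K: "K > 0"
    and lim: "\<And>x. 0 < x \<Longrightarrow> K * x \<le> 1/2 \<Longrightarrow> ((\<lambda>r. \<Sum>m. b r m * x ^ m) \<longlongrightarrow> 0) Fl"
    and b': "\<forall>\<^sub>F r in Fl. \<forall>m. \<bar>b r m\<bar> \<le> B * K ^ m"
  shows "((\<lambda>r. b r n) \<longlongrightarrow> 0) Fl"
proof (induction n rule: less_induct)
  case (less n)
  show ?case
  proof (rule tendstoI)
    fix e :: real assume e: "e > 0"
    define c where "c = 2 * \<bar>B\<bar> * K ^ Suc n"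
    have c: "c \<ge> 0" using K by (simp add: c_def)
    \<comment> \<open>The first entry keeps K x \<le> 1/2, the second makes the error c x at most
      e/2.\<close>
    define x where "x = min (1 / (2 * K)) (e / (2 * (c + 1)))"
    have x: "x > 0" "K * x \<le> 1/2"
    proof -
      show "x > 0" using K e c by (simp add: x_def)
      have "x \<le> 1 / (2 * K)" by (simp add: x_def)
      thus "K * x \<le> 1/2" using K by (simp add: field_simps)
    qed
    have cx: "c * x \<le> e / 2"
    proof -
      have "x \<le> e / (2 * (c + 1))" by (simp add: x_def)
      hence "c * x \<le> c * (e / (2 * (c + 1)))" using c by (intro mult_left_mono)
      also have "\<dots> \<le> e / 2" using c e by (simp add: field_simps)
      finally show ?thesis .
    qed
    have "((\<lambda>r. \<bar>(\<Sum>m. b r m * x ^ m) - (\<Sum>m<n. b r m * x ^ m)\<bar> / x ^ n) \<longlongrightarrow> \<bar>0 - (\<Sum>m<n. 0 * x ^ m)\<bar> / x ^ n) Fl"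
      using x(1) by (intro tendsto_intros lim x less) auto
    hence "\<forall>\<^sub>F r in Fl. \<bar>(\<Sum>m. b r m * x ^ m) - (\<Sum>m<n. b r m * x ^ m)\<bar> / x ^ n < e / 2"
      using e by (intro order_tendstoD) auto
    with b' show "\<forall>\<^sub>F r in Fl. dist (b r n) 0 < e"
    proof eventually_elim
      case (elim r)
      have "\<bar>((\<Sum>m. b r m * x ^ m) - (\<Sum>m<n. b r m * x ^ m)) / x ^ n - b r n\<bar> \<le> 2 * B * K ^ Suc n * x"
        using elim(1) K x by (intro power_series_coefficient_approx) auto
      moreover have "\<bar>((\<Sum>m. b r m * x ^ m) - (\<Sum>m<n. b r m * x ^ m)) / x ^ n\<bar>
          = \<bar>(\<Sum>m. b r m * x ^ m) - (\<Sum>m<n. b r m * x ^ m)\<bar> / x ^ n"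
        using x(1) by (simp add: abs_divide)
      moreover have "2 * B * K ^ Suc n * x \<le> c * x"
        unfolding c_def using K x by (intro mult_right_mono) auto
      ultimately show ?case using elim(2) cx unfolding dist_real_def by linarith
    qed
  qed
qed

text \<open>Newton's series for the exponent -4, rewritten by negating the upper index of the
  binomial coefficient. The exponent is that of 1 - |z|^2 in the energy density.\<close>

lemma negative_binomial_sums:
  fixes x :: real
  assumes "\<bar>x\<bar> < 1"
  shows "(\<lambda>m. real ((m + 3) choose 3) * x ^ m) sums (1 / (1 - x) ^ 4)"
proof -
  have "(\<lambda>n. ((- 4) gchoose n) * (- x) ^ n) sums (1 + (- x)) powr (- 4)"
    using assms by (intro gen_binomial_real) simp
  moreover have "((- 4 :: real) gchoose n) * (- x) ^ n = real ((n + 3) choose 3) * x ^ n" for n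
  proof -
    have "((- 4 :: real) gchoose n) = (-1) ^ n * ((real n - (-4) - 1) gchoose n)"
      by (rule gbinomial_negated_upper)
    also have "real n - (-4) - 1 = real (n + 3)" by simp
    also have "real (n + 3) gchoose n = real ((n + 3) choose n)" by (rule binomial_gbinomial[symmetric])
    also have "(n + 3) choose n = (n + 3) choose 3" using binomial_symmetric[of n "n + 3"] by simp
    finally have g: "((- 4 :: real) gchoose n) = (-1) ^ n * real ((n + 3) choose 3)" .
    have "(-1) ^ n * (- x) ^ n = x ^ n" by (simp flip: power_mult_distrib)
    thus ?thesis unfolding g by (metis mult.assoc mult.commute)
  qed
  moreover have "(1 + (- x)) powr (- 4) = 1 / (1 - x) ^ 4"
  proof -
    have "(1 + (- x)) powr (- real 4) = inverse ((1 + (- x)) powr real 4)" by (rule powr_minus)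
    also have "(1 + (- x)) powr real 4 = (1 - x) ^ 4" using assms by (subst powr_realpow) auto
    finally show ?thesis by (simp add: divide_inverse)
  qed
  ultimately show ?thesis by simp
qed

section \<open>Equidistribution of large discs\<close>

text \<open>Counts only the ring between the radii 2 r - 1 and r: there the density is at least 1 /
  (4 (1 - r)^2), and the Euclidean area is pi (3 r - 1) (1 - r). The bound is crude but diverges as
  r tends to 1.\<close>

lemma measure_hyp_area_ball_lower:
  assumes r: "1/2 < r" "r < 1"
  shows "measure hyp_area (ball 0 r) \<ge> pi * (3 * r - 1) / (4 * (1 - r))"
proof -
  let ?s = "2 * r - 1"
  have s: "0 \<le> ?s" "?s \<le> r" using r by auto
  have m: "emeasure lborel (ball (0::complex) t) = ennreal (pi * t\<^sup>2)" if "t \<ge> 0" for t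
    using emeasure_ball[OF that, of "0::complex"] by (simp add: unit_ball_vol_2)
  have "emeasure lborel (ball (0::complex) r - ball 0 ?s) = emeasure lborel (ball (0::complex) r) - emeasure lborel (ball (0::complex) ?s)"
    using s by (intro emeasure_Diff) (auto simp: m)
  also have "\<dots> = ennreal (pi * r\<^sup>2 - pi * ?s\<^sup>2)"
    using s r by (simp add: m ennreal_minus)
  finally have ring: "emeasure lborel (ball (0::complex) r - ball 0 ?s) = ennreal (pi * r\<^sup>2 - pi * ?s\<^sup>2)" .
  define c where "c = 1 / (4 * (1 - r)\<^sup>2)"
  have "ennreal c * emeasure lborel (ball (0::complex) r - ball 0 ?s)
    = (\<integral>\<^sup>+w. ennreal c * indicator (ball 0 r - ball 0 ?s) (w::complex) \<partial>lborel)"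
    by (rule nn_integral_cmult_indicator[symmetric]) simp
  also have "\<dots> \<le> (\<integral>\<^sup>+w. indicator (ball 0 r \<inter> unit_disc) w * ennreal (hyp_dens w) \<partial>lborel)"
  proof (rule nn_integral_mono)
    fix w :: complex
    have "c \<le> hyp_dens w" if w: "cmod w < r" "?s \<le> cmod w"
    proof -
      have "?s\<^sup>2 \<le> (cmod w)\<^sup>2" using w s by (intro power_mono) auto
      moreover have "1 - ?s\<^sup>2 = 4 * r * (1 - r)" by (simp add: power2_eq_square algebra_simps)
      moreover have "r * (1 - r) \<le> 1 - r" using r by (simp add: mult_left_le_one_le)
      ultimately have a: "1 - (cmod w)\<^sup>2 \<le> 4 * (1 - r)" by simp
      have b: "0 < 1 - (cmod w)\<^sup>2" using w r by (simp add: abs_square_less_1)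
      have "(1 - (cmod w)\<^sup>2)\<^sup>2 \<le> (4 * (1 - r))\<^sup>2" using a b by (intro power_mono) auto
      hence "4 / (4 * (1 - r))\<^sup>2 \<le> hyp_dens w" using b by (intro divide_left_mono) (use r in auto)
      moreover have "4 / (4 * (1 - r))\<^sup>2 = c" unfolding c_def power_mult_distrib by simp
      ultimately show ?thesis by simp
    qed
    thus "ennreal c * indicator (ball 0 r - ball 0 ?s) w \<le> indicator (ball 0 r \<inter> unit_disc) w * ennreal (hyp_dens w)"
      using r by (auto simp: indicator_def intro!: ennreal_leI)
  qed
  also have "\<dots> = emeasure hyp_area (ball 0 r)" by (subst emeasure_hyp_area) auto
  also have "\<dots> = ennreal (measure hyp_area (ball 0 r))"
    using emeasure_hyp_area_ball[of r] r by (intro emeasure_eq_ennreal_measure) auto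
  finally have "ennreal (c * (pi * r\<^sup>2 - pi * ?s\<^sup>2)) \<le> ennreal (measure hyp_area (ball 0 r))"
    unfolding ring by (subst ennreal_mult'') (use s in \<open>auto simp: c_def intro!: power_mono\<close>)
  hence "c * (pi * r\<^sup>2 - pi * ?s\<^sup>2) \<le> measure hyp_area (ball 0 r)" by (simp add: ennreal_le_iff)
  moreover have "c * (pi * r\<^sup>2 - pi * ?s\<^sup>2) = pi * (3 * r - 1) / (4 * (1 - r))"
  proof -
    have "pi * r\<^sup>2 - pi * ?s\<^sup>2 = pi * (3 * r - 1) * (1 - r)" by (simp add: power2_eq_square algebra_simps)
    thus ?thesis using r unfolding c_def by (simp add: power2_eq_square)
  qed
  ultimately show ?thesis by simp
qed

lemma measure_hyp_area_ball_at_top: "filterlim (\<lambda>r. measure hyp_area (ball 0 r)) at_top (at_left 1)"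
proof (rule filterlim_at_top_mono)
  show "filterlim (\<lambda>r::real. pi * (3 * r - 1) / (4 * (1 - r))) at_top (at_left 1)" by real_asymp
  have "\<forall>\<^sub>F r in at_left (1::real). r \<in> {1/2<..<1}" by (rule eventually_at_left_real) simp
  thus "\<forall>\<^sub>F r in at_left 1. pi * (3 * r - 1) / (4 * (1 - r)) \<le> measure hyp_area (ball 0 r)"
    by eventually_elim (rule measure_hyp_area_ball_lower; simp)
qed

text \<open>A disc average is a mixture of circle averages, and since the area of large discs
  diverges, the circles inside any fixed ball carry vanishing weight.\<close>

lemma hyp_disc_tendsto:
  assumes f: "bounded_borel C f" and lim: "((\<lambda>\<rho>. avg (hyp_circle \<rho>) f 0) \<longlongrightarrow> l) (at_left 1)"
  shows "((\<lambda>r. avg (hyp_disc r) f 0) \<longlongrightarrow> l) (at_left 1)"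
proof (rule tendstoI)
  fix e :: real assume e: "e > 0"
  have C: "C \<ge> 0" using bounded_borel_bound[OF f, of 0] by linarith
  define A where "A \<rho> = avg (hyp_circle \<rho>) f 0" for \<rho>
  have [measurable]: "A \<in> borel_measurable borel" unfolding A_def using bounded_borelD[OF f] by measurable
  have A_bound: "\<bar>A \<rho>\<bar> \<le> C" for \<rho> unfolding A_def by (rule bounded_avg_hyp_circle[OF f])
  from lim e have "\<forall>\<^sub>F \<rho> in at_left 1. dist (A \<rho>) l < e / 3"
    unfolding A_def by (intro tendstoD) auto
  then obtain s0 where s0: "s0 < 1" "\<And>\<rho>. s0 < \<rho> \<Longrightarrow> \<rho> < 1 \<Longrightarrow> dist (A \<rho>) l < e / 3"
    unfolding eventually_at_left[OF zero_less_one] by blast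
  define s where "s = max ((s0 + 1) / 2) (1/2)"
  have s: "0 < s" "s < 1" "s0 < s" using s0(1) by (auto simp: s_def less_max_iff_disj)
  define M where "M = measure hyp_area (ball 0 s)"
  have M: "M \<ge> 0" by (simp add: M_def)
  have "\<forall>\<^sub>F r in at_left 1. measure hyp_area (ball 0 r) \<ge> 3 * (C + \<bar>l\<bar> + 1) * (M + 1) / e"
    using measure_hyp_area_ball_at_top by (simp add: filterlim_at_top)
  moreover have "\<forall>\<^sub>F r in at_left (1::real). r \<in> {s<..<1}" by (rule eventually_at_left_real) (use s in simp)
  ultimately show "\<forall>\<^sub>F r in at_left 1. dist (avg (hyp_disc r) f 0) l < e"
  proof eventually_elim
    case (elim r)
    hence r: "0 < r" "r < 1" "s < r" using s by auto
    have rd: "radial_prob (hyp_disc r)" using r by (intro radial_prob_hyp_disc)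
    interpret R: prob_space "hyp_disc r" using rd by (rule radial_probD)
    have int: "integrable (hyp_disc r) (\<lambda>z. A (cmod z))"
      by (rule R.integrable_const_bound[of _ C]) (use A_bound in auto)
    have i1: "integrable (hyp_disc r) (\<lambda>z. indicator (ball 0 s) z * (C + \<bar>l\<bar>))"
      by (intro integrable_mult_left integrable_real_indicator) (simp_all add: less_top[symmetric])
    have i2: "integrable (hyp_disc r) (\<lambda>z. indicator (ball 0 s) z * (C + \<bar>l\<bar>) + e / 3)"
      using i1 by (rule Bochner_Integration.integrable_add) simp
    have small: "R.prob (ball 0 s) * (C + \<bar>l\<bar>) < e / 3"
    proof -
      have "ball 0 r \<inter> ball 0 s = ball (0::complex) s" using r by auto
      hence "R.prob (ball 0 s) = M / measure hyp_area (ball 0 r)"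
        using emeasure_hyp_area_ball[OF r(1,2)] emeasure_hyp_area_ball[OF s(1,2)]
        unfolding hyp_disc_def M_def by (subst measure_uniform_measure) auto
      moreover define V where "V = measure hyp_area (ball 0 r)"
      have "V \<ge> 3 * (C + \<bar>l\<bar> + 1) * (M + 1) / e" using elim by (simp add: V_def)
      hence "V * e \<ge> 3 * ((C + \<bar>l\<bar> + 1) * (M + 1))" using e by (simp add: field_simps)
      moreover have "(C + \<bar>l\<bar> + 1) * (M + 1) > M * (C + \<bar>l\<bar>)" using C M by (simp add: algebra_simps add_pos_nonneg)
      ultimately have Ve: "V * e > 3 * (M * (C + \<bar>l\<bar>))" by linarith
      have "V > 0" unfolding V_def using emeasure_hyp_area_ball[OF r(1,2)] by (simp add: measure_def enn2real_positive_iff)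
      with Ve have "M / V * (C + \<bar>l\<bar>) < e / 3" by (simp add: field_simps)
      thus ?thesis using \<open>R.prob (ball 0 s) = M / measure hyp_area (ball 0 r)\<close> by (simp add: V_def)
    qed
    have "avg (hyp_disc r) f 0 - l = (\<integral>z. A (cmod z) - l \<partial>hyp_disc r)"
      unfolding avg_polar[OF rd f] A_def[symmetric] using int by (simp add: R.prob_space)
    also have "\<bar>\<dots>\<bar> \<le> (\<integral>z. \<bar>A (cmod z) - l\<bar> \<partial>hyp_disc r)" by (rule integral_abs_bound)
    also have "\<dots> \<le> (\<integral>z. indicator (ball 0 s) z * (C + \<bar>l\<bar>) + e / 3 \<partial>hyp_disc r)"
    proof (rule integral_mono_AE)
      show "AE z in hyp_disc r. \<bar>A (cmod z) - l\<bar> \<le> indicator (ball 0 s) z * (C + \<bar>l\<bar>) + e / 3"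
        using radial_probD(3)[OF rd]
      proof eventually_elim
        case (elim z)
        show ?case
        proof (cases "cmod z < s")
          case True
          hence "indicator (ball 0 s) z = (1 :: real)" by simp
          moreover have "\<bar>A (cmod z) - l\<bar> \<le> C + \<bar>l\<bar>" using A_bound[of "cmod z"] by linarith
          ultimately show ?thesis using e by simp
        next
          case False
          thus ?thesis using s0(2)[of "cmod z"] elim s by (simp add: dist_real_def)
        qed
      qed
      show "integrable (hyp_disc r) (\<lambda>z. \<bar>A (cmod z) - l\<bar>)" using int by auto
      show "integrable (hyp_disc r) (\<lambda>z. indicator (ball 0 s) z * (C + \<bar>l\<bar>) + e / 3)" by (rule i2)
    qed
    also have "\<dots> = R.prob (ball 0 s) * (C + \<bar>l\<bar>) + e / 3"
      using i1 by (simp add: R.prob_space)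
    finally show ?case using small e by (simp add: dist_real_def)
  qed
qed

text \<open>Following a circle of radius \<rho> by one of fixed radius y ends on radii X with 1 -
  X^2 \<le> (1 - \<rho>^2) / (1 - y)^2, so all of them tend to 1 together.\<close>

lemma hyp_circle_convolution_tendsto:
  assumes f: "bounded_borel C f" and lim: "((\<lambda>\<rho>. avg (hyp_circle \<rho>) f 0) \<longlongrightarrow> l) (at_left 1)"
    and y: "0 \<le> y" "y < 1"
  shows "((\<lambda>\<rho>. avg (hyp_circle \<rho>) (avg (hyp_circle y) f) 0) \<longlongrightarrow> l) (at_left 1)"
proof (rule tendstoI)
  fix e :: real assume e: "e > 0"
  interpret tau: prob_space circle_measure by (rule prob_space_circle_measure)
  define A where "A \<rho> = avg (hyp_circle \<rho>) f 0" for \<rho>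
  have [measurable]: "A \<in> borel_measurable borel" unfolding A_def using bounded_borelD[OF f] by measurable
  have A_bound: "\<bar>A \<rho>\<bar> \<le> C" for \<rho> unfolding A_def by (rule bounded_avg_hyp_circle[OF f])
  from lim e have "\<forall>\<^sub>F \<rho> in at_left 1. dist (A \<rho>) l < e / 2"
    unfolding A_def by (intro tendstoD) auto
  then obtain s where s: "s < 1" "\<And>\<rho>. s < \<rho> \<Longrightarrow> \<rho> < 1 \<Longrightarrow> dist (A \<rho>) l < e / 2"
    unfolding eventually_at_left[OF zero_less_one] by blast
  define t where "t = max s 0"
  have t: "0 \<le> t" "t < 1" "s \<le> t" using s(1) by (auto simp: t_def)
  have "((\<lambda>\<rho>::real. (1 - \<rho>\<^sup>2) / (1 - y)\<^sup>2) \<longlongrightarrow> (1 - 1\<^sup>2) / (1 - y)\<^sup>2) (at_left 1)"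
    using y by (intro tendsto_intros) auto
  hence "\<forall>\<^sub>F \<rho> in at_left 1. (1 - \<rho>\<^sup>2) / (1 - y)\<^sup>2 < 1 - t\<^sup>2"
    by (rule order_tendstoD) (use t in \<open>simp add: abs_square_less_1\<close>)
  moreover have "\<forall>\<^sub>F \<rho> in at_left (1::real). \<rho> \<in> {0<..<1}" by (rule eventually_at_left_real) simp
  ultimately show "\<forall>\<^sub>F \<rho> in at_left 1. dist (avg (hyp_circle \<rho>) (avg (hyp_circle y) f) 0) l < e"
  proof eventually_elim
    case (elim \<rho>)
    define X where "X u = cmod (disc_translation (of_real \<rho>) (u * of_real y))" for u
    have [measurable]: "X \<in> borel_measurable borel" unfolding X_def by measurable
    have int: "integrable circle_measure (\<lambda>u. A (X u))"
      by (rule tau.integrable_const_bound[of _ C]) (use A_bound in auto)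
    have "avg (hyp_circle \<rho>) (avg (hyp_circle y) f) 0 = (\<integral>u. A (X u) \<partial>circle_measure)"
      unfolding A_def X_def using elim y by (intro avg_hyp_circle_hyp_circle[OF _ _ _ _ f]) auto
    hence "avg (hyp_circle \<rho>) (avg (hyp_circle y) f) 0 - l = (\<integral>u. A (X u) - l \<partial>circle_measure)"
      using int by (simp add: tau.prob_space)
    also have "\<bar>\<dots>\<bar> \<le> (\<integral>u. \<bar>A (X u) - l\<bar> \<partial>circle_measure)" by (rule integral_abs_bound)
    also have "\<dots> \<le> (\<integral>u. e / 2 \<partial>circle_measure)"
    proof (rule integral_mono_AE)
      show "AE u in circle_measure. \<bar>A (X u) - l\<bar> \<le> e / 2"
        using AE_circle_measure
      proof eventually_elim
        case (elim u)
        have d: "cmod (of_real \<rho>) < 1" "cmod (u * of_real y) < 1"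
          using \<open>\<rho> \<in> {0<..<1}\<close> elim y by (auto simp: norm_mult)
        have X1: "X u < 1" "0 \<le> X u" unfolding X_def using d by (auto intro: disc_translation_in_disc)
        define N where "N = cmod (1 + of_real \<rho> * (u * of_real y))"
        have "cmod (of_real \<rho> * (u * of_real y)) \<le> cmod (u * of_real y)"
          using norm_le_disc[OF d(1), of "u * of_real y"] by (simp add: mult.commute)
        also have "\<dots> = y" using elim y by (simp add: norm_mult)
        finally have N: "1 - y \<le> N"
          unfolding N_def using norm_triangle_ineq2[of 1 "- (of_real \<rho> * (u * of_real y))"] by simp
        have "1 - (X u)\<^sup>2 = (1 - \<rho>\<^sup>2) * (1 - y\<^sup>2) / N\<^sup>2"
          unfolding X_def N_def one_minus_disc_translation[OF d] using elim y by (simp add: norm_mult)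
        also have "\<dots> \<le> (1 - \<rho>\<^sup>2) * 1 / (1 - y)\<^sup>2"
          using N y \<open>\<rho> \<in> {0<..<1}\<close>
          by (intro frac_le mult_left_mono power_mono) (auto simp: abs_square_le_1)
        also have "\<dots> < 1 - t\<^sup>2" using \<open>(1 - \<rho>\<^sup>2) / (1 - y)\<^sup>2 < 1 - t\<^sup>2\<close> by simp
        finally have "t\<^sup>2 < (X u)\<^sup>2" by simp
        hence "t < X u" using X1 t by (simp add: power2_less_imp_less)
        thus ?case using s(2)[of "X u"] t X1 by (simp add: dist_real_def)
      qed
    qed (use int in auto)
    finally show ?case using e by (simp add: tau.prob_space dist_real_def)
  qed
qed

section \<open>Equidistribution of Taylor coefficients\<close>

context disc_quotient
begin

text \<open>With x = \<rho>^2 the generating function of the b m w is a circle average divided by (1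
  - x)^4; its disc mean tends to l / (1 - x)^4, where l is the mean of f over the quotient. Single
  coefficients can be compared because the bound B 4^m is uniform in w.\<close>

theorem coefficient_equidistribution:
  fixes b :: "nat \<Rightarrow> complex \<Rightarrow> real"
  assumes f: "bounded_borel C f" "\<And>z. 0 \<le> f z" "invariant f" and uc: "hyp_uniformly_continuous f"
    and b_nonneg: "\<And>m w. 0 \<le> b m w" and b_out: "\<And>m w. cmod w \<ge> 1 \<Longrightarrow> b m w = 0"
    and b_bound: "\<And>m w. b m w \<le> B * 4 ^ m"
    and sums: "\<And>w \<rho>. cmod w < 1 \<Longrightarrow> 0 \<le> \<rho> \<Longrightarrow> \<rho> < 1 \<Longrightarrow>
      (\<lambda>m. b m w * \<rho> ^ (2 * m)) sums (avg (hyp_circle \<rho>) f w / (1 - \<rho>\<^sup>2) ^ 4)"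
  shows "b n \<in> borel_measurable borel"
    and "((\<lambda>r. \<integral>w. b n w \<partial>hyp_disc r) \<longlongrightarrow>
       (\<integral>w. f w \<partial>quot) / measure hyp_area F * real ((n + 3) choose 3)) (at_left 1)"
proof -
  note [measurable] = bounded_borelD[OF f(1)]
  define l where "l = (\<integral>w. f w \<partial>quot) / measure hyp_area F"
  have B: "B \<ge> 0" using b_bound[of 0 0] b_nonneg[of 0 0] by simp
  define S where "S x w = indicator unit_disc w * avg (hyp_circle (sqrt x)) f w / (1 - x) ^ 4" for x w
  have S_meas [measurable]: "S x \<in> borel_measurable borel" for x
    unfolding S_def
    by (intro borel_measurable_divide borel_measurable_times borel_measurable_indicator) (simp, measurable)
  have S_sums: "(\<lambda>m. b m w * x ^ m) sums S x w" if x: "0 \<le> x" "x < 1" for x w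
  proof (cases "cmod w < 1")
    case True
    have "sqrt x < 1" using x by simp
    from sums[OF True _ this] x True show ?thesis by (simp add: S_def power_mult)
  qed (use b_out in \<open>simp add: S_def\<close>)
  have bb: "\<bar>b m w\<bar> \<le> B * 4 ^ m" for m w using b_bound b_nonneg by simp
  \<comment> \<open>Measurability of the coefficients has to be derived: each is a pointwise limit
    of difference quotients of the measurable sum along x = 1 / (8 (k + 1)), the lower coefficients
    being settled by induction.\<close>
  have meas: "b n \<in> borel_measurable borel" for n
  proof (induction n rule: less_induct)
    case (less n)
    define x :: "nat \<Rightarrow> real" where "x k = 1 / (8 * real (Suc k))" for k
    have x: "0 < x k" "4 * x k \<le> 1/2" "x k < 1" for k by (auto simp: x_def field_simps)
    define T where "T k w = (S (x k) w - (\<Sum>m<n. b m w * x k ^ m)) / x k ^ n" for k w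
    have "(\<lambda>k. T k w) \<longlonglongrightarrow> b n w" for w
    proof (rule LIM_zero_cancel, rule tendsto_rabs_zero_cancel, rule tendsto_sandwich[OF _ _ tendsto_const])
      have "\<bar>T k w - b n w\<bar> \<le> 2 * B * 4 ^ Suc n * x k" for k
        using power_series_coefficient_approx[where b = "\<lambda>m. b m w" and n = n, OF bb _ x(1,2)[of k]] S_sums[of "x k" w] x[of k]
        unfolding T_def by (simp add: sums_iff)
      thus "\<forall>\<^sub>F k in sequentially. \<bar>T k w - b n w\<bar> \<le> 2 * B * 4 ^ Suc n * x k" by simp
      have "(\<lambda>k. 1 / 8 * inverse (real (Suc k))) \<longlonglongrightarrow> 1 / 8 * 0"
        by (intro tendsto_mult tendsto_const LIMSEQ_inverse_real_of_nat)
      hence "(\<lambda>k. x k) \<longlonglongrightarrow> 0" by (simp add: x_def field_simps)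
      hence "(\<lambda>k. 2 * B * 4 ^ Suc n * x k) \<longlonglongrightarrow> 2 * B * 4 ^ Suc n * 0"
        by (intro tendsto_mult tendsto_const)
      thus "(\<lambda>k. 2 * B * 4 ^ Suc n * x k) \<longlonglongrightarrow> 0" by simp
    qed auto
    moreover have "T k \<in> borel_measurable borel" for k
      unfolding T_def using less by (intro borel_measurable_divide borel_measurable_diff S_meas borel_measurable_sum borel_measurable_times) auto
    ultimately show ?case by (rule borel_measurable_LIMSEQ_real)
  qed
  thus "b n \<in> borel_measurable borel" .
  note [measurable] = meas
  define \<beta> where "\<beta> r m = (\<integral>w. b m w \<partial>hyp_disc r)" for r m
  define c where "c m = real ((m + 3) choose 3)" for m
  have \<beta>_bound: "\<bar>\<beta> r m\<bar> \<le> B * 4 ^ m" and \<beta>_sum: "0 < x \<Longrightarrow> 4 * x \<le> 1/2 \<Longrightarrow>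
      (\<lambda>m. \<beta> r m * x ^ m) sums (avg (hyp_disc r) (avg (hyp_circle (sqrt x)) f) 0 / (1 - x) ^ 4)"
    if r: "0 < r" "r < 1" for r m x
  proof -
    have rd: "radial_prob (hyp_disc r)" using r by (rule radial_prob_hyp_disc)
    interpret R: prob_space "hyp_disc r" using rd by (rule radial_probD)
    have int: "integrable (hyp_disc r) (b m)" for m
      by (rule R.integrable_const_bound[of _ "B * 4 ^ m"]) (use bb in auto)
    have "\<bar>\<beta> r m\<bar> \<le> (\<integral>w. \<bar>b m w\<bar> \<partial>hyp_disc r)" for m unfolding \<beta>_def by (rule integral_abs_bound)
    also have "(\<integral>w. \<bar>b m w\<bar> \<partial>hyp_disc r) \<le> (\<integral>w. B * 4 ^ m \<partial>hyp_disc r)" for m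
      by (rule integral_mono) (use int bb in auto)
    finally show bd: "\<bar>\<beta> r m\<bar> \<le> B * 4 ^ m" for m by (simp add: R.prob_space)
    assume x: "0 < x" "4 * x \<le> 1/2"
    have x1: "0 \<le> x" "x < 1" using x by auto
    have "(\<lambda>m. \<integral>w. b m w * x ^ m \<partial>hyp_disc r) sums (\<integral>w. (\<Sum>m. b m w * x ^ m) \<partial>hyp_disc r)"
    proof (rule sums_integral)
      show "AE w in hyp_disc r. summable (\<lambda>m. norm (b m w * x ^ m))"
        using S_sums[OF x1] b_nonneg x by (simp add: sums_iff abs_mult)
      have "(\<integral>w. norm (b m w * x ^ m) \<partial>hyp_disc r) = \<beta> r m * x ^ m" for m
        using b_nonneg x by (simp add: \<beta>_def)
      thus "summable (\<lambda>m. \<integral>w. norm (b m w * x ^ m) \<partial>hyp_disc r)"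
        using power_series_tail_bound(2)[OF bd, of x] x by simp
    qed (use int in simp)
    moreover have "(\<Sum>m. b m w * x ^ m) = S x w" for w using S_sums[OF x1] by (simp add: sums_iff)
    moreover have "(\<integral>w. S x w \<partial>hyp_disc r) = avg (hyp_disc r) (avg (hyp_circle (sqrt x)) f) 0 / (1 - x) ^ 4"
    proof -
      have "(\<integral>w. S x w \<partial>hyp_disc r) = (\<integral>w. avg (hyp_circle (sqrt x)) f w / (1 - x) ^ 4 \<partial>hyp_disc r)"
      proof (rule integral_cong_AE)
        show "AE w in hyp_disc r. S x w = avg (hyp_circle (sqrt x)) f w / (1 - x) ^ 4"
          using radial_probD(3)[OF rd] by eventually_elim (simp add: S_def)
      qed measurable
      thus ?thesis by (simp add: avg_def[of "hyp_disc r"])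
    qed
    ultimately show "(\<lambda>m. \<beta> r m * x ^ m) sums (avg (hyp_disc r) (avg (hyp_circle (sqrt x)) f) 0 / (1 - x) ^ 4)"
      by (simp add: \<beta>_def)
  qed
  \<comment> \<open>A single term of the binomial series at x = 1/4 is at most the sum (4/3)^4 <
    4.\<close>
  have c_bound: "\<bar>c m\<bar> \<le> 4 * 4 ^ m" for m
  proof -
    have s: "(\<lambda>m. c m * (1/4) ^ m) sums (1 / (1 - 1/4) ^ 4)"
      unfolding c_def by (rule negative_binomial_sums) simp
    have "(\<Sum>i\<in>{m}. c i * (1/4) ^ i) \<le> (\<Sum>i. c i * (1/4) ^ i)"
      by (rule sum_le_suminf) (use s in \<open>auto simp: sums_iff c_def\<close>)
    also have "\<dots> = 1 / (1 - 1/4) ^ 4" using s by (simp add: sums_iff)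
    also have "\<dots> \<le> 4" by (simp add: power_divide)
    finally have "c m \<le> 4 * 4 ^ m" by (simp add: power_divide field_simps)
    thus ?thesis by (simp add: c_def)
  qed
  have "((\<lambda>r. \<beta> r n - l * c n) \<longlongrightarrow> 0) (at_left 1)"
  proof (rule power_series_coefficients_tendsto[where B = "B + 4 * \<bar>l\<bar>" and K = 4])
    have ev: "\<forall>\<^sub>F r in at_left (1::real). r \<in> {0<..<1}" by (rule eventually_at_left_real) simp
    have lc: "\<bar>l * c m\<bar> \<le> 4 * \<bar>l\<bar> * 4 ^ m" for m
      using mult_left_mono[OF c_bound[of m], of "\<bar>l\<bar>"] by (simp add: abs_mult mult_ac)
    from ev show "\<forall>\<^sub>F r in at_left 1. \<forall>m. \<bar>\<beta> r m - l * c m\<bar> \<le> (B + 4 * \<bar>l\<bar>) * 4 ^ m"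
    proof eventually_elim
      case (elim r)
      show ?case
      proof
        fix m
        have "\<bar>\<beta> r m - l * c m\<bar> \<le> \<bar>\<beta> r m\<bar> + \<bar>l * c m\<bar>" by (rule abs_triangle_ineq4)
        also have "\<dots> \<le> B * 4 ^ m + 4 * \<bar>l\<bar> * 4 ^ m"
          using elim by (intro add_mono \<beta>_bound lc) auto
        finally show "\<bar>\<beta> r m - l * c m\<bar> \<le> (B + 4 * \<bar>l\<bar>) * 4 ^ m" by (simp add: algebra_simps)
      qed
    qed
    fix x :: real assume x: "0 < x" "4 * x \<le> 1/2"
    hence x1: "0 \<le> x" "x < 1" "0 \<le> sqrt x" "sqrt x < 1" by auto
    have rc: "radial_prob (hyp_circle (sqrt x))" using x1 by (intro radial_prob_hyp_circle)
    have "((\<lambda>r. avg (hyp_disc r) (avg (hyp_circle (sqrt x)) f) 0) \<longlongrightarrow> l) (at_left 1)"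
      unfolding l_def using x1
      by (intro hyp_disc_tendsto[OF bounded_borel_avg[OF rc f(1)]] hyp_circle_convolution_tendsto[OF f(1)]
          hyp_circle_equidistribution[OF f uc]) auto
    hence "((\<lambda>r. avg (hyp_disc r) (avg (hyp_circle (sqrt x)) f) 0 / (1 - x) ^ 4 - l * (1 / (1 - x) ^ 4))
      \<longlongrightarrow> l / (1 - x) ^ 4 - l * (1 / (1 - x) ^ 4)) (at_left 1)"
      using x1 by (intro tendsto_intros) auto
    hence lim: "((\<lambda>r. avg (hyp_disc r) (avg (hyp_circle (sqrt x)) f) 0 / (1 - x) ^ 4 - l * (1 / (1 - x) ^ 4))
      \<longlongrightarrow> 0) (at_left 1)" by simp
    show "((\<lambda>r. \<Sum>m. (\<beta> r m - l * c m) * x ^ m) \<longlongrightarrow> 0) (at_left 1)"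
    proof (rule Lim_transform_eventually[OF lim])
      from ev show "\<forall>\<^sub>F r in at_left 1. avg (hyp_disc r) (avg (hyp_circle (sqrt x)) f) 0 / (1 - x) ^ 4 - l * (1 / (1 - x) ^ 4)
        = (\<Sum>m. (\<beta> r m - l * c m) * x ^ m)"
      proof eventually_elim
        case (elim r)
        have "(\<lambda>m. \<beta> r m * x ^ m - l * (c m * x ^ m)) sums
          (avg (hyp_disc r) (avg (hyp_circle (sqrt x)) f) 0 / (1 - x) ^ 4 - l * (1 / (1 - x) ^ 4))"
          unfolding c_def using elim x x1 by (intro sums_diff sums_mult \<beta>_sum negative_binomial_sums) auto
        thus ?case by (simp add: sums_iff algebra_simps)
      qed
    qed
  qed simp
  hence "((\<lambda>r. (\<beta> r n - l * c n) + l * c n) \<longlongrightarrow> 0 + l * c n) (at_left 1)"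
    by (intro tendsto_add tendsto_const)
  thus "((\<lambda>r. \<integral>w. b n w \<partial>hyp_disc r) \<longlongrightarrow>
       (\<integral>w. f w \<partial>quot) / measure hyp_area F * real ((n + 3) choose 3)) (at_left 1)"
    by (simp add: \<beta>_def l_def c_def)
qed

end

section \<open>Fuchsian groups\<close>

lemma SU11_D:
  assumes "A \<in> carrier SU11"
  shows "A $ 2 $ 1 = cnj (A $ 1 $ 2)" "A $ 2 $ 2 = cnj (A $ 1 $ 1)"
    "(cmod (A $ 1 $ 1))\<^sup>2 - (cmod (A $ 1 $ 2))\<^sup>2 = 1" "cmod (A $ 1 $ 2) < cmod (A $ 1 $ 1)"
    "mobius A = mob (A $ 1 $ 1) (A $ 1 $ 2)"
proof -
  show e: "A $ 2 $ 1 = cnj (A $ 1 $ 2)" "A $ 2 $ 2 = cnj (A $ 1 $ 1)"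
    using assms by (auto simp: SU11_def)
  have "A $ 1 $ 1 * cnj (A $ 1 $ 1) - A $ 1 $ 2 * cnj (A $ 1 $ 2) = 1"
    using assms e by (simp add: SU11_def det_2)
  hence "complex_of_real ((cmod (A $ 1 $ 1))\<^sup>2 - (cmod (A $ 1 $ 2))\<^sup>2) = of_real 1"
    unfolding of_real_diff complex_norm_square by simp
  thus n: "(cmod (A $ 1 $ 1))\<^sup>2 - (cmod (A $ 1 $ 2))\<^sup>2 = 1" using of_real_eq_iff by blast
  hence "(cmod (A $ 1 $ 2))\<^sup>2 < (cmod (A $ 1 $ 1))\<^sup>2" by linarith
  thus "cmod (A $ 1 $ 2) < cmod (A $ 1 $ 1)" by (rule power2_less_imp_less) simp
  show "mobius A = mob (A $ 1 $ 1) (A $ 1 $ 2)"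
    by (simp add: mobius_def mob_def fun_eq_iff e)
qed

lemma mobius_mult:
  assumes A: "A \<in> carrier SU11" and B: "B \<in> carrier SU11" and z: "cmod z < 1"
  shows "mobius (A ** B) z = mobius A (mobius B z)"
proof -
  note a = SU11_D[OF A] and b = SU11_D[OF B]
  have d: "B $ 2 $ 1 * z + B $ 2 $ 2 \<noteq> 0"
    unfolding b(1,2) by (rule mob_denom_nz[OF b(4) z])
  have "mobius A (mobius B z) = ((A $ 1 $ 1 * (B $ 1 $ 1 * z + B $ 1 $ 2) + A $ 1 $ 2 * (B $ 2 $ 1 * z + B $ 2 $ 2)) / (B $ 2 $ 1 * z + B $ 2 $ 2))
     / ((A $ 2 $ 1 * (B $ 1 $ 1 * z + B $ 1 $ 2) + A $ 2 $ 2 * (B $ 2 $ 1 * z + B $ 2 $ 2)) / (B $ 2 $ 1 * z + B $ 2 $ 2))"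
  proof -
    have e: "x * (n / D) + y = (x * n + y * D) / D" if "D \<noteq> 0" for x y n D :: complex
      using that by (simp add: add_divide_distrib)
    show ?thesis unfolding mobius_def e[OF d] ..
  qed
  also have "\<dots> = (A $ 1 $ 1 * (B $ 1 $ 1 * z + B $ 1 $ 2) + A $ 1 $ 2 * (B $ 2 $ 1 * z + B $ 2 $ 2))
    / (A $ 2 $ 1 * (B $ 1 $ 1 * z + B $ 1 $ 2) + A $ 2 $ 2 * (B $ 2 $ 1 * z + B $ 2 $ 2))"
    using d by simp
  also have "\<dots> = mobius (A ** B) z"
    by (simp add: mobius_def matrix_matrix_mult_def sum_2 algebra_simps)
  finally show ?thesis ..
qed

lemma PSU11_D:
  assumes "g \<in> carrier PSU11" "A \<in> g"
  shows "A \<in> carrier SU11" "g = {A, - A}" "psu_map g = mobius A"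
proof -
  obtain B where B: "B \<in> carrier SU11" "g = {B, - B}" using assms(1) by (auto simp: carrier_PSU11)
  have "- B \<in> carrier SU11" using B(1) by (auto simp: SU11_def det_2)
  thus "A \<in> carrier SU11" "g = {A, - A}" using B assms(2) by auto
  thus "psu_map g = mobius A" using psu_map_coset by simp
qed

lemma PSU11_obtain:
  assumes "g \<in> carrier PSU11"
  obtains A where "A \<in> carrier SU11" "g = {A, - A}" "psu_map g = mobius A" "A \<in> g"
proof -
  obtain A where "A \<in> g" using assms by (auto simp: carrier_PSU11)
  from that[OF PSU11_D[OF assms this] this] show ?thesis .
qed

lemma PSU11_mult_mem:
  assumes "A \<in> g" "B \<in> h"
  shows "A ** B \<in> g \<otimes>\<^bsub>PSU11\<^esub> h"
proof -
  have "A \<otimes>\<^bsub>SU11\<^esub> B \<in> g <#>\<^bsub>SU11\<^esub> h" using assms unfolding set_mult_def by blast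
  thus ?thesis by (simp add: PSU11_def FactGroup_def SU11_def)
qed

lemma one_PSU11: "\<one>\<^bsub>PSU11\<^esub> = {mat 1, - mat 1}"
  by (simp add: PSU11_def FactGroup_def)

lemma psu_map_mult:
  assumes g: "g \<in> carrier PSU11" and h: "h \<in> carrier PSU11" and z: "cmod z < 1"
  shows "psu_map (g \<otimes>\<^bsub>PSU11\<^esub> h) z = psu_map g (psu_map h z)"
proof -
  interpret group PSU11 by (rule group_PSU11)
  obtain A where A: "A \<in> carrier SU11" "psu_map g = mobius A" "A \<in> g" using PSU11_obtain[OF g] by metis
  obtain B where B: "B \<in> carrier SU11" "psu_map h = mobius B" "B \<in> h" using PSU11_obtain[OF h] by metis
  have "psu_map (g \<otimes>\<^bsub>PSU11\<^esub> h) = mobius (A ** B)"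
    using PSU11_D(3)[OF m_closed[OF g h] PSU11_mult_mem[OF A(3) B(3)]] .
  thus ?thesis using mobius_mult[OF A(1) B(1) z] A B by simp
qed

lemma psu_map_one: "psu_map \<one>\<^bsub>PSU11\<^esub> z = z"
  unfolding one_PSU11 psu_map_coset by (simp add: mobius_def mat_def)

lemma psu_map_mob:
  assumes "g \<in> carrier PSU11"
  shows "\<exists>a b. cmod b < cmod a \<and> (cmod a)\<^sup>2 - (cmod b)\<^sup>2 = 1 \<and> psu_map g = mob a b"
proof -
  obtain A where A: "A \<in> carrier SU11" "psu_map g = mobius A" using PSU11_obtain[OF assms] by blast
  show ?thesis unfolding A(2) using SU11_D(3-5)[OF A(1)] by blast
qed

section \<open>Discreteness and proper discontinuity\<close>

lemma SU11_inverse: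
  assumes "A \<in> carrier SU11"
  obtains A' where "A' \<in> carrier SU11" "A' ** A = mat 1" "A ** A' = mat 1"
    "\<And>i j. cmod (A' $ i $ j) \<le> cmod (A $ 1 $ 1)" "A' = inv\<^bsub>SU11\<^esub> A"
proof -
  interpret SU: group SU11 by (rule group_SU11)
  note a = SU11_D[OF assms]
  define B :: "complex^2^2" where
    "B = vector [vector [A $ 2 $ 2, - A $ 1 $ 2], vector [- A $ 2 $ 1, A $ 1 $ 1]]"
  have B: "B \<in> carrier SU11" "B ** A = mat 1" "A ** B = mat 1"
    using assms by (auto simp: SU11_def B_def det_2 matrix_matrix_mult_def vec_eq_iff forall_2
                           sum_2 mat_def algebra_simps)
  moreover have "\<forall>i j. cmod (B $ i $ j) \<le> cmod (A $ 1 $ 1)"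
    using a(4) by (simp add: forall_2 B_def a(1,2))
  moreover have "B = inv\<^bsub>SU11\<^esub> A"
    by (rule SU.inv_equality[symmetric]) (use B assms in \<open>auto simp: SU11_def\<close>)
  ultimately show ?thesis using that by blast
qed

lemma norm_matrix_2_le:
  fixes A :: "complex^2^2"
  assumes "\<And>i j. cmod (A $ i $ j) \<le> c"
  shows "norm A \<le> 4 * c"
proof -
  have row: "norm (A $ i) \<le> 2 * c" for i
  proof -
    have "norm (A $ i) \<le> (\<Sum>j\<in>UNIV. cmod (A $ i $ j))" unfolding norm_vec_def by (rule L2_set_le_sum) simp
    also have "\<dots> \<le> 2 * c" using assms[of i 1] assms[of i 2] by (simp add: sum_2)
    finally show ?thesis .
  qed
  have "norm A \<le> (\<Sum>i\<in>UNIV. norm (A $ i))" unfolding norm_vec_def[of A] by (rule L2_set_le_sum) simp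
  also have "\<dots> \<le> 4 * c" using row[of 1] row[of 2] by (simp add: sum_2)
  finally show ?thesis .
qed

text \<open>Discreteness provides an open set of PSU(1,1) that meets \<Gamma> only in the identity;
  its preimage is open among the matrices of \<open>SU11\<close> and contains a neighbourhood of
  \<open>mat 1\<close>.\<close>

lemma fuchsian_isolated:
  assumes "fuchsian \<Gamma>"
  obtains e where "e > 0" "\<And>A. A \<in> carrier SU11 \<Longrightarrow> {A, - A} \<in> \<Gamma> \<Longrightarrow> dist A (mat 1) < e \<Longrightarrow> {A, - A} = \<one>\<^bsub>PSU11\<^esub>"
proof -
  have sub: "subgroup \<Gamma> PSU11" and disc: "subtopology PSU11_topology \<Gamma> = discrete_topology \<Gamma>"
    using assms by (auto simp: fuchsian_def)
  have one: "\<one>\<^bsub>PSU11\<^esub> \<in> \<Gamma>" using sub by (rule subgroup.one_closed)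
  hence "openin (subtopology PSU11_topology \<Gamma>) {\<one>\<^bsub>PSU11\<^esub>}" by (simp add: disc)
  then obtain U where U: "openin PSU11_topology U" "{\<one>\<^bsub>PSU11\<^esub>} = U \<inter> \<Gamma>"
    unfolding openin_subtopology by blast
  have U': "U \<subseteq> carrier PSU11" "openin (top_of_set (carrier SU11)) (\<Union>U)"
    using U(1) by (auto simp: openin_PSU11_topology)
  have "mat 1 \<in> \<Union>U" using U(2) one_PSU11 by blast
  then obtain e where e: "e > 0" "\<And>A. A \<in> carrier SU11 \<Longrightarrow> dist A (mat 1) < e \<Longrightarrow> A \<in> \<Union>U"
    using U'(2) unfolding openin_euclidean_subtopology_iff by blast
  show ?thesis
  proof (rule that[OF e(1)])
    fix A assume A: "A \<in> carrier SU11" "{A, - A} \<in> \<Gamma>" "dist A (mat 1) < e"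
    then obtain g where g: "g \<in> U" "A \<in> g" using e(2) by blast
    have gA: "g = {A, - A}" by (rule PSU11_D(2)[OF subsetD[OF U'(1) g(1)] g(2)])
    have "{A, - A} \<in> U \<inter> \<Gamma>" using g(1) A(2) unfolding gA by (rule IntI)
    thus "{A, - A} = \<one>\<^bsub>PSU11\<^esub>" unfolding U(2)[symmetric] by (rule singletonD)
  qed
qed

text \<open>Bounding the first entry bounds the whole matrix, so infinitely many such matrices would
  accumulate. For two nearby ones A and B the product of the inverse of A with B is close to the
  identity, hence B = A or B = - A by isolation; but a ball about an accumulation point holds
  infinitely many.\<close>

lemma fuchsian_finite_bounded:
  assumes \<Gamma>: "fuchsian \<Gamma>"
  shows "finite {g \<in> \<Gamma>. \<exists>A\<in>g. cmod (A $ 1 $ 1) \<le> R}"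
proof -
  interpret P: group PSU11 by (rule group_PSU11)
  have sub: "subgroup \<Gamma> PSU11" using \<Gamma> by (simp add: fuchsian_def)
  have carr: "\<Gamma> \<subseteq> carrier PSU11" using sub by (rule subgroup.subset)
  obtain e where e: "e > 0" "\<And>A. A \<in> carrier SU11 \<Longrightarrow> {A, - A} \<in> \<Gamma> \<Longrightarrow> dist A (mat 1) < e \<Longrightarrow> {A, - A} = \<one>\<^bsub>PSU11\<^esub>"
    using fuchsian_isolated[OF \<Gamma>] by blast
  define X where "X = {A \<in> carrier SU11. {A, - A} \<in> \<Gamma> \<and> cmod (A $ 1 $ 1) \<le> R}"
  \<comment> \<open>Each entry of A' (B - A) is at most 2 (|R| + 1) dist A B, and a matrix norm is
    at most 4 times the bound on the entries; together this gives the constant 8 (|R| + 1).\<close>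
  have close: "B = A \<or> B = - A" if A: "A \<in> X" and B: "B \<in> X" and AB: "dist A B < e / (8 * (\<bar>R\<bar> + 1))" for A B
  proof -
    have A1: "A \<in> carrier SU11" "{A, - A} \<in> \<Gamma>" "cmod (A $ 1 $ 1) \<le> R" and B1: "B \<in> carrier SU11" "{B, - B} \<in> \<Gamma>"
      using A B by (auto simp: X_def)
    obtain A' where A': "A' \<in> carrier SU11" "A' ** A = mat 1" "A ** A' = mat 1" "\<And>i j. cmod (A' $ i $ j) \<le> cmod (A $ 1 $ 1)"
      using SU11_inverse[OF A1(1)] by metis
    define C where "C = A' ** B"
    define g where "g = inv\<^bsub>PSU11\<^esub> {A, - A} \<otimes>\<^bsub>PSU11\<^esub> {B, - B}"
    have gA: "{A, - A} \<in> carrier PSU11" "{B, - B} \<in> carrier PSU11" using A1(2) B1(2) carr by auto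
    have g: "g \<in> \<Gamma>" unfolding g_def
      using subgroup.m_closed[OF sub subgroup.m_inv_closed[OF sub A1(2)] B1(2)] .
    have A'g: "A' \<in> inv\<^bsub>PSU11\<^esub> {A, - A}"
    proof -
      have "{A', - A'} \<in> carrier PSU11" using A'(1) by (auto simp: carrier_PSU11)
      moreover have "{A', - A'} \<otimes>\<^bsub>PSU11\<^esub> {A, - A} = \<one>\<^bsub>PSU11\<^esub>"
      proof -
        have "A' ** A \<in> {A', - A'} \<otimes>\<^bsub>PSU11\<^esub> {A, - A}" by (rule PSU11_mult_mem) auto
        from PSU11_D(2)[OF P.m_closed[OF calculation gA(1)] this] show ?thesis unfolding A'(2) one_PSU11 .
      qed
      ultimately have "inv\<^bsub>PSU11\<^esub> {A, - A} = {A', - A'}" using gA(1) by (intro P.inv_equality)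
      thus ?thesis by simp
    qed
    have "C \<in> g" unfolding C_def g_def by (rule PSU11_mult_mem[OF A'g]) simp
    from PSU11_D[OF subsetD[OF carr g] this] have C: "C \<in> carrier SU11" "g = {C, - C}" by auto
    have "dist C (mat 1) < e"
    proof -
      have "C - mat 1 = A' ** (B - A)" unfolding C_def A'(2)[symmetric]
        by (simp add: matrix_matrix_mult_def vec_eq_iff algebra_simps sum_subtractf)
      have "cmod ((C - mat 1) $ i $ j) \<le> 2 * (\<bar>R\<bar> + 1) * dist A B" for i j
      proof -
        have "cmod ((B - A) $ k $ j) \<le> dist A B" for k
        proof -
          have "cmod ((B - A) $ k $ j) \<le> norm ((B - A) $ k)" by (rule Finite_Cartesian_Product.norm_nth_le)
          also have "\<dots> \<le> norm (B - A)" by (rule Finite_Cartesian_Product.norm_nth_le)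
          finally show ?thesis by (simp add: dist_norm norm_minus_commute)
        qed
        hence 1: "cmod (A' $ i $ k * (B - A) $ k $ j) \<le> (\<bar>R\<bar> + 1) * dist A B" for k
          unfolding norm_mult using A'(4)[of i k] A1(3) by (intro mult_mono) auto
        have "(C - mat 1) $ i $ j = A' $ i $ 1 * (B - A) $ 1 $ j + A' $ i $ 2 * (B - A) $ 2 $ j"
          unfolding \<open>C - mat 1 = A' ** (B - A)\<close> by (simp add: matrix_matrix_mult_def sum_2)
        also have "cmod \<dots> \<le> (\<bar>R\<bar> + 1) * dist A B + (\<bar>R\<bar> + 1) * dist A B"
          by (rule norm_triangle_le) (use 1[of 1] 1[of 2] in linarith)
        finally show ?thesis by (simp add: algebra_simps)
      qed
      hence "norm (C - mat 1) \<le> 4 * (2 * (\<bar>R\<bar> + 1) * dist A B)" by (rule norm_matrix_2_le)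
      also have "\<dots> < e" using AB by (simp add: pos_less_divide_eq mult_ac)
      finally show ?thesis by (simp add: dist_norm)
    qed
    with e(2)[OF C(1)] g C(2) have "g = \<one>\<^bsub>PSU11\<^esub>" by simp
    hence "C = mat 1 \<or> C = - mat 1" using \<open>C \<in> g\<close> by (simp add: one_PSU11)
    moreover have "A ** C = B" unfolding C_def by (simp add: matrix_mul_assoc A'(3))
    ultimately show ?thesis using mult_minus_mat[of A] by auto
  qed
  have "finite X"
  proof (rule ccontr)
    assume inf: "infinite X"
    have "bounded X"
    proof (rule boundedI)
      fix A assume A: "A \<in> X"
      hence a: "A \<in> carrier SU11" "cmod (A $ 1 $ 1) \<le> R" by (auto simp: X_def)
      note d = SU11_D[OF a(1)]
      have "\<forall>i j. cmod (A $ i $ j) \<le> R" using a(2) d by (auto simp: forall_2)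
      thus "norm A \<le> 4 * R" by (intro norm_matrix_2_le) auto
    qed
    then obtain x where x: "x islimpt X" using inf bounded_infinite_imp_islimpt[of X X] by blast
    define d where "d = e / (16 * (\<bar>R\<bar> + 1))"
    have d: "d > 0" using e(1) by (simp add: d_def)
    have I: "infinite (X \<inter> ball x d)" using x d islimpt_eq_infinite_ball by blast
    then obtain A where A: "A \<in> X" "A \<in> ball x d" by (metis Int_iff ex_in_conv finite.emptyI)
    have "X \<inter> ball x d \<subseteq> {A, - A}"
    proof
      fix B assume B: "B \<in> X \<inter> ball x d"
      have "dist A B < d + d" using A B dist_triangle3[of A B x] by (auto simp: dist_commute)
      also have "d + d = e / (8 * (\<bar>R\<bar> + 1))"
      proof -
        have "e / (16 * y) + e / (16 * y) = e / (8 * y)" for y :: real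
          by (cases "y = 0") (simp_all add: field_simps)
        thus ?thesis unfolding d_def .
      qed
      finally show "B \<in> {A, - A}" using close[OF A(1), of B] B by auto
    qed
    thus False using I finite_subset by blast
  qed
  moreover have "{g \<in> \<Gamma>. \<exists>A\<in>g. cmod (A $ 1 $ 1) \<le> R} \<subseteq> (\<lambda>A. {A, - A}) ` X"
  proof
    fix g assume "g \<in> {g \<in> \<Gamma>. \<exists>A\<in>g. cmod (A $ 1 $ 1) \<le> R}"
    then obtain A where A: "g \<in> \<Gamma>" "A \<in> g" "cmod (A $ 1 $ 1) \<le> R" by blast
    from PSU11_D[OF subsetD[OF carr A(1)] A(2)] A show "g \<in> (\<lambda>A. {A, - A}) ` X" by (auto simp: X_def)
  qed
  ultimately show ?thesis using finite_surj by blast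
qed

text \<open>From 1 - |g z|^2 = (1 - |z|^2) / N^2 with N = |cnj b z + cnj a|, keeping |g z| away from
  1 bounds N from above, while N is at least |a| (1 - |z|). So |a| is bounded.\<close>

lemma fuchsian_locally_finite:
  assumes \<Gamma>: "fuchsian \<Gamma>" and z: "cmod z < 1" and \<rho>: "\<rho> < 1"
  shows "finite {g \<in> \<Gamma>. cmod (psu_map g z) \<le> \<rho>}"
proof -
  have carr: "\<Gamma> \<subseteq> carrier PSU11" using \<Gamma> by (auto simp: fuchsian_def dest: subgroup.subset)
  define \<rho>' where "\<rho>' = max \<rho> 0"
  have \<rho>': "0 \<le> \<rho>'" "\<rho>' < 1" "\<rho> \<le> \<rho>'" using \<rho> by (auto simp: \<rho>'_def)
  define R where "R = sqrt (1 / (1 - \<rho>'\<^sup>2)) / (1 - cmod z)"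
  have "{g \<in> \<Gamma>. cmod (psu_map g z) \<le> \<rho>} \<subseteq> {g \<in> \<Gamma>. \<exists>A\<in>g. cmod (A $ 1 $ 1) \<le> R}"
  proof
    fix g assume "g \<in> {g \<in> \<Gamma>. cmod (psu_map g z) \<le> \<rho>}"
    hence g: "g \<in> \<Gamma>" "cmod (psu_map g z) \<le> \<rho>'" using \<rho>' by auto
    obtain A where A: "A \<in> carrier SU11" "psu_map g = mobius A" "A \<in> g"
      using PSU11_obtain[OF subsetD[OF carr g(1)]] by metis
    define a b where "a = A $ 1 $ 1" and "b = A $ 1 $ 2"
    have ab: "cmod b < cmod a" "(cmod a)\<^sup>2 - (cmod b)\<^sup>2 = 1" "psu_map g = mob a b"
      unfolding a_def b_def A(2) using SU11_D(3-5)[OF A(1)] by auto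
    define N where "N = cmod (cnj b * z + cnj a)"
    have N: "N > 0" unfolding N_def using mob_denom_nz[OF ab(1) z] by simp
    have "1 - (cmod (psu_map g z))\<^sup>2 = (1 - (cmod z)\<^sup>2) / N\<^sup>2"
      unfolding ab(3) one_minus_mob[OF ab(1) z] ab(2) N_def by simp
    also have "\<dots> \<le> 1 / N\<^sup>2" using N by (intro divide_right_mono) auto
    finally have "1 - \<rho>'\<^sup>2 \<le> 1 / N\<^sup>2"
      using power_mono[OF g(2), of 2] by simp
    moreover have "1 - \<rho>'\<^sup>2 > 0" using \<rho>' by (simp add: abs_square_less_1)
    ultimately have "N\<^sup>2 \<le> 1 / (1 - \<rho>'\<^sup>2)" using N by (simp add: field_simps)
    hence N2: "N \<le> sqrt (1 / (1 - \<rho>'\<^sup>2))" by (rule real_le_rsqrt)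
    have "cmod (cnj b * z) \<le> cmod a * cmod z" unfolding norm_mult using ab(1) by (intro mult_right_mono) auto
    moreover have "cmod (cnj a) - cmod (cnj b * z) \<le> N"
      unfolding N_def using norm_triangle_ineq2[of "cnj a" "- (cnj b * z)"] by (simp add: add.commute)
    ultimately have "cmod a * (1 - cmod z) \<le> sqrt (1 / (1 - \<rho>'\<^sup>2))" using N2 by (simp add: algebra_simps)
    hence "cmod a \<le> R" using z unfolding R_def by (simp add: pos_le_divide_eq)
    thus "g \<in> {g \<in> \<Gamma>. \<exists>A\<in>g. cmod (A $ 1 $ 1) \<le> R}" using g A(3) by (auto simp: a_def)
  qed
  thus ?thesis using fuchsian_finite_bounded[OF \<Gamma>] finite_subset by blast
qed

lemma fuchsian_countable:
  assumes \<Gamma>: "fuchsian \<Gamma>"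
  shows "countable \<Gamma>"
proof -
  have carr: "\<Gamma> \<subseteq> carrier PSU11" using \<Gamma> by (auto simp: fuchsian_def dest: subgroup.subset)
  have eq: "\<Gamma> = (\<Union>n::nat. {g \<in> \<Gamma>. cmod (psu_map g 0) \<le> 1 - 1 / (n + 2)})"
  proof (intro equalityI subsetI)
    fix g assume g: "g \<in> \<Gamma>"
    have "cmod (psu_map g 0) < 1"
      using psu_map_mob[OF subsetD[OF carr g]] mob_in_disc[of _ _ 0] by auto
    hence "1 - cmod (psu_map g 0) > 0" by simp
    then obtain n where "1 / real (Suc n) < 1 - cmod (psu_map g 0)" using reals_Archimedean inverse_eq_divide by metis
    moreover have "1 / (real n + 2) \<le> 1 / real (Suc n)" by (simp add: divide_simps)
    ultimately have "cmod (psu_map g 0) \<le> 1 - 1 / (real n + 2)" by simp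
    thus "g \<in> (\<Union>n::nat. {g \<in> \<Gamma>. cmod (psu_map g 0) \<le> 1 - 1 / (n + 2)})" using g by blast
  qed auto
  have "countable {g \<in> \<Gamma>. cmod (psu_map g 0) \<le> 1 - 1 / (real n + 2)}" for n
    by (rule countable_finite, rule fuchsian_locally_finite[OF \<Gamma>]) auto
  thus ?thesis by (subst eq) (intro countable_UN countableI_type)
qed

text \<open>A total order that selects one point from each orbit by a Borel condition.\<close>

definition lex_le :: "complex \<Rightarrow> complex \<Rightarrow> bool" where
  "lex_le w v \<longleftrightarrow> cmod w < cmod v \<or> (cmod w = cmod v \<and>
     (Re w < Re v \<or> (Re w = Re v \<and> Im w \<le> Im v)))"

lemma lex_le_antisym: "lex_le w v \<Longrightarrow> lex_le v w \<Longrightarrow> w = v"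
  unfolding lex_le_def by (intro complex_eqI) linarith+

lemma finite_lex_le_minimum:
  assumes "finite S" "S \<noteq> {}"
  shows "\<exists>w\<in>S. \<forall>v\<in>S. lex_le w v"
  using assms
proof (induction S rule: finite_ne_induct)
  case (singleton x)
  thus ?case by (simp add: lex_le_def)
next
  case (insert x S)
  then obtain w where w: "w \<in> S" "\<forall>v\<in>S. lex_le w v" by blast
  have tot: "lex_le w x \<or> lex_le x w" by (auto simp: lex_le_def)
  have trans: "lex_le x v" if "lex_le x w" "lex_le w v" for v using that by (auto simp: lex_le_def)
  have refl: "lex_le x x" by (simp add: lex_le_def)
  show ?case
  proof (cases "lex_le w x")
    case True thus ?thesis using w by auto
  next
    case False thus ?thesis using w tot trans refl by (intro bexI[of _ x]) auto
  qed
qed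

text \<open>Only finitely many group elements lead from z to points no farther from 0 than z, so
  every orbit has a least point. Being least is a conjunction of Borel conditions over the countable
  group.\<close>

lemma fundamental_set_exists:
  assumes \<Gamma>: "fuchsian \<Gamma>"
  shows "\<exists>F. fundamental_set \<Gamma> F"
proof -
  interpret P: group PSU11 by (rule group_PSU11)
  have sub: "subgroup \<Gamma> PSU11" using \<Gamma> by (simp add: fuchsian_def)
  have carr: "\<Gamma> \<subseteq> carrier PSU11" using sub by (rule subgroup.subset)
  have mob: "\<exists>a b. cmod b < cmod a \<and> psu_map g = mob a b" if "g \<in> \<Gamma>" for g
    using psu_map_mob[OF subsetD[OF carr that]] by blast
  have in_disc: "cmod (psu_map g z) < 1" if "g \<in> \<Gamma>" "cmod z < 1" for g z
    using mob[OF that(1)] mob_in_disc that(2) by metis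
  have mult: "psu_map (g \<otimes>\<^bsub>PSU11\<^esub> h) z = psu_map g (psu_map h z)" "g \<otimes>\<^bsub>PSU11\<^esub> h \<in> \<Gamma>"
    if "g \<in> \<Gamma>" "h \<in> \<Gamma>" "cmod z < 1" for g h z
    using that carr psu_map_mult subgroup.m_closed[OF sub] by blast+
  have inv: "psu_map (inv\<^bsub>PSU11\<^esub> g) (psu_map g z) = z" "inv\<^bsub>PSU11\<^esub> g \<in> \<Gamma>"
    if "g \<in> \<Gamma>" "cmod z < 1" for g z
  proof -
    show i: "inv\<^bsub>PSU11\<^esub> g \<in> \<Gamma>" using that(1) by (rule subgroup.m_inv_closed[OF sub])
    have "psu_map (inv\<^bsub>PSU11\<^esub> g \<otimes>\<^bsub>PSU11\<^esub> g) z = z"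
      using that(1) carr psu_map_one by (simp add: P.l_inv subset_iff)
    thus "psu_map (inv\<^bsub>PSU11\<^esub> g) (psu_map g z) = z" using mult(1)[OF i that] by simp
  qed
  have one: "\<one>\<^bsub>PSU11\<^esub> \<in> \<Gamma>" using sub by (rule subgroup.one_closed)
  define F where "F = unit_disc \<inter> (\<Inter>g\<in>\<Gamma>. {w. lex_le w (psu_map g w)})"
  have F_borel: "F \<in> sets borel"
  proof -
    have "{w. lex_le w (psu_map g w)} \<in> sets borel" if g: "g \<in> \<Gamma>" for g
    proof -
      obtain a b where ab: "psu_map g = mob a b" using mob[OF g] by blast
      show ?thesis unfolding ab lex_le_def by measurable
    qed
    hence "(\<Inter>g\<in>\<Gamma>. {w. lex_le w (psu_map g w)}) \<in> sets borel"
      using fuchsian_countable[OF \<Gamma>] one by (intro sets.countable_INT') auto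
    thus ?thesis unfolding F_def by (intro sets.Int) auto
  qed
  have "\<exists>!w. w \<in> F \<and> (\<exists>g\<in>\<Gamma>. w = psu_map g z)" if z: "z \<in> unit_disc" for z
  proof -
    have z1: "cmod z < 1" using z by simp
    \<comment> \<open>Orbit points of larger modulus lose against z at once, so comparison within
      this finite set suffices.\<close>
    define S where "S = (\<lambda>g. psu_map g z) ` {g \<in> \<Gamma>. cmod (psu_map g z) \<le> cmod z}"
    have "finite S" unfolding S_def by (rule finite_imageI, rule fuchsian_locally_finite[OF \<Gamma> z1 z1])
    moreover have "z \<in> S" unfolding S_def using one psu_map_one[of z] by force
    ultimately obtain w where w: "w \<in> S" "\<And>v. v \<in> S \<Longrightarrow> lex_le w v"
      using finite_lex_le_minimum[of S] by (metis empty_iff)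
    obtain g where g: "g \<in> \<Gamma>" "w = psu_map g z" "cmod w \<le> cmod z" using w(1) by (auto simp: S_def)
    have "w \<in> F"
      unfolding F_def
    proof (intro IntI INT_I CollectI)
      show "w \<in> unit_disc" using g(3) z1 by simp
      fix h assume h: "h \<in> \<Gamma>"
      show "lex_le w (psu_map h w)"
      proof (cases "cmod (psu_map h w) \<le> cmod z")
        case True
        have "psu_map h w = psu_map (h \<otimes>\<^bsub>PSU11\<^esub> g) z" using mult(1)[OF h g(1) z1] g(2) by simp
        hence "psu_map h w \<in> S" unfolding S_def using True mult(2)[OF h g(1) z1] by force
        thus ?thesis by (rule w(2))
      next
        case False
        thus ?thesis using g(3) by (simp add: lex_le_def)
      qed
    qed
    have uniq: "w' = w" if w': "w' \<in> F" "g' \<in> \<Gamma>" "w' = psu_map g' z" for w' g'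
    proof -
      have rel: "\<exists>h\<in>\<Gamma>. psu_map k z = psu_map h (psu_map l z)" if kl: "k \<in> \<Gamma>" "l \<in> \<Gamma>" for k l
      proof -
        have "psu_map (k \<otimes>\<^bsub>PSU11\<^esub> inv\<^bsub>PSU11\<^esub> l) (psu_map l z) = psu_map k z"
          using mult(1)[OF kl(1) inv(2)[OF kl(2) z1] in_disc[OF kl(2) z1]] inv(1)[OF kl(2) z1] by simp
        thus ?thesis using mult(2)[OF kl(1) inv(2)[OF kl(2) z1] z1] by metis
      qed
      obtain h where "h \<in> \<Gamma>" "w = psu_map h w'" using rel[OF g(1) w'(2)] g(2) w'(3) by metis
      hence "lex_le w' w" using w'(1) by (auto simp: F_def)
      moreover obtain h' where "h' \<in> \<Gamma>" "w' = psu_map h' w" using rel[OF w'(2) g(1)] g(2) w'(3) by metis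
      hence "lex_le w w'" using \<open>w \<in> F\<close> by (auto simp: F_def)
      ultimately show ?thesis by (rule lex_le_antisym)
    qed
    show ?thesis
    proof (rule ex1I[of _ w])
      show "w \<in> F \<and> (\<exists>g\<in>\<Gamma>. w = psu_map g z)" using \<open>w \<in> F\<close> g(1,2) by blast
    qed (use uniq in \<open>elim conjE bexE\<close>)
  qed
  thus ?thesis using F_borel unfolding fundamental_set_def by (intro exI[of _ F]) (auto simp: F_def)
qed

text \<open>A fixed point is a root of cnj b z^2 + (cnj a - a) z - b. If all coefficients vanish,
  then b = 0 and a is real with |a| = 1, which describes the identity of PSU(1,1).\<close>

lemma psu_map_finite_fixed_points:
  assumes g: "g \<in> carrier PSU11" "g \<noteq> \<one>\<^bsub>PSU11\<^esub>"
  shows "finite {z. cmod z < 1 \<and> psu_map g z = z}"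
proof -
  obtain A where A: "A \<in> carrier SU11" "g = {A, - A}" "psu_map g = mobius A" using PSU11_obtain[OF g(1)] by metis
  define a b where "a = A $ 1 $ 1" and "b = A $ 1 $ 2"
  note d = SU11_D[OF A(1), folded a_def b_def]
  define p where "p = [:- b, cnj a - a, cnj b:]"
  have "p \<noteq> 0"
  proof
    assume "p = 0"
    hence p: "b = 0" "cnj a = a" by (auto simp: p_def)
    hence "Im a = 0" by (simp add: complex_eq_iff)
    moreover have "(Re a)\<^sup>2 + (Im a)\<^sup>2 = 1" using d(3) p by (simp add: cmod_power2)
    ultimately have "a = 1 \<or> a = -1" by (auto simp: complex_eq_iff power2_eq_1_iff)
    moreover have "A $ 1 $ 1 = a" "A $ 1 $ 2 = 0" "A $ 2 $ 1 = 0" "A $ 2 $ 2 = a"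
      using d(1,2) p by (auto simp: a_def b_def)
    ultimately have "A = mat 1 \<or> A = - mat 1" by (auto simp: vec_eq_iff forall_2 mat_def)
    hence "g = \<one>\<^bsub>PSU11\<^esub>" unfolding A(2) one_PSU11 by auto
    with g(2) show False ..
  qed
  hence "finite {z. poly p z = 0}" by (rule poly_roots_finite)
  moreover have "{z. cmod z < 1 \<and> psu_map g z = z} \<subseteq> {z. poly p z = 0}"
  proof clarify
    fix z assume z: "cmod z < 1" "psu_map g z = z"
    have nz: "cnj b * z + cnj a \<noteq> 0" using mob_denom_nz[OF d(4) z(1)] .
    have "a * z + b = z * (cnj b * z + cnj a)"
      using z(2) nz unfolding A(3) d(5) mob_def by (simp add: divide_eq_eq)
    thus "poly p z = 0" by (simp add: p_def algebra_simps)
  qed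
  ultimately show ?thesis using finite_subset by blast
qed

text \<open>A fundamental set holds one point of every orbit, whereas unfolding counts group
  elements. The two agree off the points fixed by some nontrivial element, and these are countably
  many, hence null.\<close>

lemma disc_quotient_fuchsian:
  assumes \<Gamma>: "fuchsian \<Gamma>" and F: "fundamental_set \<Gamma> F"
    and fin: "emeasure hyp_area F < \<infinity>" and pos: "0 < emeasure hyp_area F"
  shows "disc_quotient \<Gamma> psu_map (m_inv PSU11) F"
proof -
  interpret P: group PSU11 by (rule group_PSU11)
  have sub: "subgroup \<Gamma> PSU11" using \<Gamma> by (simp add: fuchsian_def)
  have carr: "\<Gamma> \<subseteq> carrier PSU11" using sub by (rule subgroup.subset)
  have cl: "inv\<^bsub>PSU11\<^esub> g \<in> \<Gamma>" if "g \<in> \<Gamma>" for g using that by (rule subgroup.m_inv_closed[OF sub])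
  have act_inv: "psu_map (inv\<^bsub>PSU11\<^esub> g) (psu_map g z) = z" if "g \<in> \<Gamma>" "cmod z < 1" for g z
  proof -
    have "psu_map (inv\<^bsub>PSU11\<^esub> g \<otimes>\<^bsub>PSU11\<^esub> g) z = z"
      using that(1) carr psu_map_one by (simp add: P.l_inv subset_iff)
    thus ?thesis using psu_map_mult[OF subsetD[OF carr cl[OF that(1)]] subsetD[OF carr that(1)] that(2)] by simp
  qed
  show ?thesis
  proof
    show "countable \<Gamma>" using \<Gamma> by (rule fuchsian_countable)
    show "\<exists>a b. cmod b < cmod a \<and> psu_map g = mob a b" if "g \<in> \<Gamma>" for g
      using psu_map_mob[OF subsetD[OF carr that]] by blast
    show "inv\<^bsub>PSU11\<^esub> g \<in> \<Gamma>" if "g \<in> \<Gamma>" for g using cl[OF that] .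
    show "inv\<^bsub>PSU11\<^esub> (inv\<^bsub>PSU11\<^esub> g) = g" if "g \<in> \<Gamma>" for g using that carr by (intro P.inv_inv) auto
    show "psu_map (inv\<^bsub>PSU11\<^esub> g) (psu_map g z) = z" if "g \<in> \<Gamma>" "cmod z < 1" for g z using act_inv[OF that] .
    show "F \<in> sets borel" "F \<subseteq> unit_disc" using F by (auto simp: fundamental_set_def)
    show "AE z in hyp_area. \<exists>!g. g \<in> \<Gamma> \<and> psu_map g z \<in> F"
    proof -
      define N where "N = (\<Union>g\<in>\<Gamma> - {\<one>\<^bsub>PSU11\<^esub>}. {z. cmod z < 1 \<and> psu_map g z = z})"
      have "countable N" unfolding N_def
      proof (rule countable_UN)
        show "countable (\<Gamma> - {\<one>\<^bsub>PSU11\<^esub>})" using fuchsian_countable[OF \<Gamma>] by (rule countable_Diff)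
        show "countable {z. cmod z < 1 \<and> psu_map g z = z}" if "g \<in> \<Gamma> - {\<one>\<^bsub>PSU11\<^esub>}" for g
          using that carr by (intro countable_finite psu_map_finite_fixed_points) auto
      qed
      hence "N \<in> null_sets lborel" by (rule countable_imp_null_set_lborel)
      hence "AE z in lborel. z \<notin> N" by (rule AE_not_in)
      hence "AE z in hyp_area. z \<notin> N"
        unfolding hyp_area_def using hyp_area_dens_measurable by (subst AE_density) auto
      thus ?thesis using AE_hyp_area_disc
      proof eventually_elim
        case (elim z)
        have uniq: "\<exists>!w. w \<in> F \<and> (\<exists>g\<in>\<Gamma>. w = psu_map g z)"
          using F elim(2) by (auto simp: fundamental_set_def)
        then obtain g where g: "g \<in> \<Gamma>" "psu_map g z \<in> F" by blast
        have "g' = g" if g': "g' \<in> \<Gamma>" "psu_map g' z \<in> F" for g'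
        proof -
          have eq: "psu_map g' z = psu_map g z" using uniq g g' by blast
          define h where "h = inv\<^bsub>PSU11\<^esub> g \<otimes>\<^bsub>PSU11\<^esub> g'"
          have h: "h \<in> \<Gamma>" unfolding h_def using subgroup.m_closed[OF sub cl[OF g(1)] g'(1)] .
          have "psu_map h z = z"
            unfolding h_def using psu_map_mult[OF subsetD[OF carr cl[OF g(1)]] subsetD[OF carr g'(1)] elim(2)] eq act_inv[OF g(1) elim(2)]
            by simp
          hence "h = \<one>\<^bsub>PSU11\<^esub>" using elim h by (auto simp: N_def)
          hence "inv\<^bsub>PSU11\<^esub> g = inv\<^bsub>PSU11\<^esub> g'"
            unfolding h_def using g(1) g'(1) carr by (intro P.inv_equality[symmetric]) auto
          thus ?thesis using g(1) g'(1) carr by (metis P.inv_inv subsetD)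
        qed
        thus ?case using g by blast
      qed
    qed
  qed (use fin pos in auto)
qed

section \<open>Quadratic differentials\<close>

text \<open>Up to a constant the squared pointwise norm of Q in the hyperbolic metric. The value
  zero off the disc allows global bounds and measurability.\<close>

definition energy_density :: "(complex \<Rightarrow> complex) \<Rightarrow> complex \<Rightarrow> real" where
  "energy_density Q w = (if cmod w < 1 then (cmod (Q w))\<^sup>2 * (1 - (cmod w)\<^sup>2) ^ 4 else 0)"

lemma deriv_mob:
  assumes "cmod b < cmod a" "cmod z < 1"
  shows "deriv (mob a b) z = of_real ((cmod a)\<^sup>2 - (cmod b)\<^sup>2) / (cnj b * z + cnj a)\<^sup>2"
  by (rule DERIV_imp_deriv, rule mob_has_field_derivative, rule mob_denom_nz) (use assms in auto)

text \<open>Rests on 1 - |g z|^2 = |g'(z)| (1 - |z|^2). It serves twice: for group elements it gives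
  invariance of the density, for translations the link with the Taylor coefficients of the
  pullback.\<close>

lemma energy_density_mob:
  assumes ab: "cmod b < cmod a" and z: "cmod z < 1"
  shows "energy_density Q (mob a b z) = (cmod (Q (mob a b z) * (deriv (mob a b) z)\<^sup>2))\<^sup>2 * (1 - (cmod z)\<^sup>2) ^ 4"
proof -
  define n where "n = (cmod a)\<^sup>2 - (cmod b)\<^sup>2"
  have n: "n > 0" using ab by (simp add: n_def power_strict_mono)
  define N where "N = cmod (cnj b * z + cnj a)"
  have N: "N > 0" unfolding N_def using mob_denom_nz[OF ab z] by simp
  have "cmod (deriv (mob a b) z) = n / N\<^sup>2"
    unfolding deriv_mob[OF ab z] n_def[symmetric] N_def norm_divide norm_power norm_of_real using n by simp
  hence "(cmod (Q (mob a b z) * (deriv (mob a b) z)\<^sup>2))\<^sup>2 = (cmod (Q (mob a b z)))\<^sup>2 * (n / N\<^sup>2) ^ 4"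
    by (simp add: norm_mult norm_power power_mult_distrib power_mult[symmetric])
  moreover have "1 - (cmod (mob a b z))\<^sup>2 = (n / N\<^sup>2) * (1 - (cmod z)\<^sup>2)"
    unfolding one_minus_mob[OF ab z] n_def N_def by simp
  hence "(1 - (cmod (mob a b z))\<^sup>2) ^ 4 = (n / N\<^sup>2) ^ 4 * (1 - (cmod z)\<^sup>2) ^ 4"
    by (simp only: power_mult_distrib)
  ultimately show ?thesis
    using mob_in_disc[OF ab z] by (simp add: energy_density_def)
qed

lemma energy_density_disc_translation:
  assumes "cmod w < 1" "cmod z < 1"
  shows "energy_density Q (disc_translation w z) = (cmod (pullback Q w z))\<^sup>2 * (1 - (cmod z)\<^sup>2) ^ 4"
  unfolding pullback_def disc_translation_eq_mob by (rule energy_density_mob) (use assms in auto)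

lemma energy_density_nonneg: "0 \<le> energy_density Q z"
  unfolding energy_density_def by auto

lemma bounded_borel_energy_density:
  assumes Q: "Q \<in> A_inf \<Gamma>"
  shows "\<exists>C. bounded_borel C (energy_density Q)"
proof -
  obtain M where "\<forall>z\<in>unit_disc. cmod (Q z * (1 - (cmod z)\<^sup>2)\<^sup>2) \<le> M"
    using Q unfolding A_inf_def bdd_above_def by blast
  hence M: "cmod (Q z * (1 - (cmod z)\<^sup>2)\<^sup>2) \<le> M" if "cmod z < 1" for z using that by simp
  have bound: "\<bar>energy_density Q z\<bar> \<le> M\<^sup>2" for z
  proof (cases "cmod z < 1")
    case True
    have "energy_density Q z = (cmod (Q z * (1 - (cmod z)\<^sup>2)\<^sup>2))\<^sup>2"
      using True by (simp add: energy_density_def norm_mult norm_power power_mult_distrib flip: of_real_power of_real_diff)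
    also have "\<dots> \<le> M\<^sup>2" using M[OF True] by (intro power_mono) auto
    finally show ?thesis using energy_density_nonneg[of Q z] by simp
  qed (simp add: energy_density_def)
  have "continuous_on unit_disc Q"
    using Q by (auto simp: A_inf_def intro: holomorphic_on_imp_continuous_on)
  hence "(\<lambda>z. indicator unit_disc z *\<^sub>R Q z) \<in> borel_measurable borel"
    by (intro borel_measurable_continuous_on_indicator) auto
  hence "(\<lambda>z. (cmod (indicator unit_disc z *\<^sub>R Q z))\<^sup>2 * (1 - (cmod z)\<^sup>2) ^ 4) \<in> borel_measurable borel"
    by measurable
  also have "(\<lambda>z. (cmod (indicator unit_disc z *\<^sub>R Q z))\<^sup>2 * (1 - (cmod z)\<^sup>2) ^ 4) = energy_density Q"
    by (auto simp: energy_density_def fun_eq_iff indicator_def)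
  finally show ?thesis using bound by (auto simp: bounded_borel_def)
qed

text \<open>Seen from w, the density is that of the pullback near 0, whose Taylor coefficients are
  bounded independently of w; so one modulus of continuity at 0 serves every w.\<close>

lemma hyp_uniformly_continuous_energy_density:
  assumes q: "\<And>w z. cmod w < 1 \<Longrightarrow> cmod z < 1 \<Longrightarrow> ((\<lambda>m. q m w * z ^ m) has_sum pullback Q w z) UNIV"
    and bound: "\<And>m w. cmod w < 1 \<Longrightarrow> cmod (q m w) \<le> B * 2 ^ m"
  shows "hyp_uniformly_continuous (energy_density Q)"
  unfolding hyp_uniformly_continuous_def
proof (intro allI impI)
  fix e :: real assume e: "e > 0"
  have B: "B \<ge> 0" using bound[of 0 0] by (simp add: order_trans[OF norm_ge_zero])
  \<comment> \<open>For x = |z| the change is at most 28 B^2 x: 12 B^2 x from the pullback, by |g -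
    h| \<le> 4 B x and g + h \<le> 3 B, and 16 B^2 x from the weight, by g \<le> 2 B and Bernoulli's
    inequality. The added 1 covers B = 0.\<close>
  define d where "d = min (1/4) (e / (28 * B\<^sup>2 + 1))"
  have "e / (28 * B\<^sup>2 + 1) > 0" using e by (intro divide_pos_pos add_nonneg_pos) auto
  hence d: "d > 0" "d \<le> 1/4" "d \<le> e / (28 * B\<^sup>2 + 1)"
    unfolding d_def by (simp_all only: min.cobounded1 min.cobounded2 min_less_iff_conj) simp
  have main: "\<bar>energy_density Q (disc_translation w z) - energy_density Q w\<bar> \<le> e"
    if w: "cmod w < 1" and z: "cmod z < 1" "cmod z < d" for w z
  proof -
    define x where "x = cmod z"
    have x: "0 \<le> x" "x \<le> 1/4" "x \<le> e / (28 * B\<^sup>2 + 1)" using z d by (auto simp: x_def)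
    define G where "G = pullback Q w z"
    have "(\<lambda>m. q m w * z ^ m) sums G" unfolding G_def by (rule has_sum_imp_sums, rule q[OF w z(1)])
    hence sG: "(\<lambda>m. q (m + 1) w * z ^ (m + 1)) sums (G - q 0 w)"
      using sums_iff_shift[of "\<lambda>m. q m w * z ^ m" 1 "G - q 0 w"] by simp
    have G0: "pullback Q w 0 = q 0 w"
      using has_sum_imp_sums[OF q[OF w, of 0]] by (simp add: eq_commute)
    have geo: "(\<lambda>m. B * (2 * x) ^ (m + 1)) sums (B * (2 * x) * (1 / (1 - 2 * x)))"
      using sums_mult[OF geometric_sums[of "2 * x"], of "B * (2 * x)"] x by (simp add: mult_ac)
    have "cmod (G - q 0 w) \<le> (\<Sum>m. B * (2 * x) ^ (m + 1))"
      unfolding sums_unique[OF sG]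
    proof (rule norm_suminf_le)
      fix m
      have "cmod (q (m + 1) w) * x ^ (m + 1) \<le> B * 2 ^ (m + 1) * x ^ (m + 1)"
        using bound[OF w, of "m + 1"] x(1) by (intro mult_right_mono) auto
      thus "cmod (q (m + 1) w * z ^ (m + 1)) \<le> B * (2 * x) ^ (m + 1)"
        by (simp add: norm_mult norm_power x_def power_mult_distrib mult_ac)
    qed (use geo in \<open>simp add: sums_iff\<close>)
    also have "\<dots> = B * (2 * x) * (1 / (1 - 2 * x))" using geo by (simp add: sums_iff)
    also have "\<dots> \<le> B * (2 * x) * 2"
      using x B by (intro mult_left_mono) (auto simp: divide_le_eq)
    finally have diff: "cmod (G - q 0 w) \<le> 4 * B * x" by simp
    define g h where "g = cmod G" and "h = cmod (q 0 w)"
    have h: "0 \<le> h" "h \<le> B" using bound[OF w, of 0] by (auto simp: h_def)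
    have gh: "\<bar>g - h\<bar> \<le> 4 * B * x"
      unfolding g_def h_def using norm_triangle_ineq3[of G "q 0 w"] diff by linarith
    have "4 * B * x \<le> B" using x B mult_left_mono[of x "1/4" "4 * B"] by simp
    hence g: "0 \<le> g" "g \<le> 2 * B" using gh h by (auto simp: g_def)
    have x2: "x\<^sup>2 \<le> x" "x\<^sup>2 \<le> 1" using x by (auto simp: power2_eq_square mult_left_le_one_le mult_le_one)
    have "1 + real 4 * (- x\<^sup>2) \<le> (1 + (- x\<^sup>2)) ^ 4" using x2 by (intro Bernoulli_inequality) simp
    hence b1: "1 - (1 - x\<^sup>2) ^ 4 \<le> 4 * x" using x2 by simp
    have b0: "0 \<le> 1 - (1 - x\<^sup>2) ^ 4" using x2 by (simp add: power_le_one)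
    have "\<bar>g\<^sup>2 - h\<^sup>2\<bar> = \<bar>g - h\<bar> * (g + h)"
    proof -
      have "g\<^sup>2 - h\<^sup>2 = (g - h) * (g + h)" by (simp add: power2_eq_square algebra_simps)
      thus ?thesis using g h by (simp add: abs_mult)
    qed
    also have "\<dots> \<le> (4 * B * x) * (3 * B)" using gh g h x B by (intro mult_mono) auto
    finally have t1: "\<bar>g\<^sup>2 - h\<^sup>2\<bar> \<le> 12 * B\<^sup>2 * x" by (simp add: power2_eq_square mult_ac)
    have "g\<^sup>2 * (1 - (1 - x\<^sup>2) ^ 4) \<le> (2 * B)\<^sup>2 * (4 * x)"
      using g b0 b1 by (intro mult_mono power_mono) auto
    hence t2: "g\<^sup>2 * (1 - (1 - x\<^sup>2) ^ 4) \<le> 16 * B\<^sup>2 * x" by (simp add: power_mult_distrib)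
    have t3: "0 \<le> g\<^sup>2 * (1 - (1 - x\<^sup>2) ^ 4)" using b0 by simp
    have "energy_density Q (disc_translation w z) = g\<^sup>2 * (1 - x\<^sup>2) ^ 4"
      unfolding energy_density_disc_translation[OF w z(1)] g_def G_def x_def ..
    moreover have "energy_density Q w = h\<^sup>2"
      using energy_density_disc_translation[OF w, of 0 Q] by (simp add: G0 h_def)
    moreover have "g\<^sup>2 * (1 - x\<^sup>2) ^ 4 - h\<^sup>2 = (g\<^sup>2 - h\<^sup>2) - g\<^sup>2 * (1 - (1 - x\<^sup>2) ^ 4)"
      by (simp add: algebra_simps)
    ultimately have "\<bar>energy_density Q (disc_translation w z) - energy_density Q w\<bar> \<le> 28 * B\<^sup>2 * x"
      using t1 t2 t3 by linarith
    also have "\<dots> \<le> (28 * B\<^sup>2 + 1) * x" using x by (simp add: algebra_simps)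
    also have "\<dots> \<le> e"
    proof -
      have "28 * B\<^sup>2 + 1 > 0" by (simp add: add_nonneg_pos)
      thus ?thesis using x(3) by (simp add: pos_le_divide_eq mult.commute)
    qed
    finally show ?thesis .
  qed
  show "\<exists>d>0. \<forall>w z. cmod w < 1 \<longrightarrow> cmod z < 1 \<longrightarrow> cmod z < d \<longrightarrow>
      \<bar>energy_density Q (disc_translation w z) - energy_density Q w\<bar> \<le> e"
    using d(1) main by blast
qed

text \<open>The area density 4 / (1 - |w|^2)^2 cancels two of the four weight factors and
  contributes the 4.\<close>

lemma integral_energy_density:
  assumes F [measurable]: "F \<in> sets borel" and FD: "F \<subseteq> unit_disc" and Q: "bounded_borel C (energy_density Q)"
  shows "(\<integral>w. energy_density Q w \<partial>density hyp_area (indicator F))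
    = 4 * (LINT w:F|lborel. (cmod (Q w))\<^sup>2 * (1 - (cmod w)\<^sup>2)\<^sup>2)"
proof -
  note [measurable] = bounded_borelD[OF Q]
  have H: "hyp_area = density lborel (\<lambda>w. ennreal (indicator unit_disc w * hyp_dens w))"
    unfolding hyp_area_def by (intro arg_cong[of _ _ "density lborel"]) (auto simp: indicator_def fun_eq_iff)
  have "(\<integral>w. energy_density Q w \<partial>density hyp_area (\<lambda>w. ennreal (indicator F w)))
    = (\<integral>w. indicator F w *\<^sub>R energy_density Q w \<partial>hyp_area)"
    by (rule integral_density) auto
  also have "\<dots> = (\<integral>w. (indicator unit_disc w * hyp_dens w) *\<^sub>R (indicator F w *\<^sub>R energy_density Q w) \<partial>lborel)"
    unfolding H
  proof (rule integral_density)
    show "(\<lambda>w. indicator unit_disc w * hyp_dens w) \<in> borel_measurable lborel"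
      using hyp_dens_measurable by (intro borel_measurable_times borel_measurable_indicator) auto
  qed auto
  also have "\<dots> = (\<integral>w. 4 * (indicator F w *\<^sub>R ((cmod (Q w))\<^sup>2 * (1 - (cmod w)\<^sup>2)\<^sup>2)) \<partial>lborel)"
  proof (rule Bochner_Integration.integral_cong[OF refl])
    fix w :: complex
    show "(indicator unit_disc w * hyp_dens w) *\<^sub>R (indicator F w *\<^sub>R energy_density Q w)
      = 4 * (indicator F w *\<^sub>R ((cmod (Q w))\<^sup>2 * (1 - (cmod w)\<^sup>2)\<^sup>2))"
    proof (cases "w \<in> F")
      case True
      hence w: "cmod w < 1" using FD by auto
      hence "(cmod w)\<^sup>2 < 1" by (simp add: abs_square_less_1)
      hence "1 - (cmod w)\<^sup>2 \<noteq> 0" by simp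
      moreover have "y \<noteq> 0 \<Longrightarrow> 4 / y\<^sup>2 * (p * y ^ 4) = 4 * (p * y\<^sup>2)" for y p :: real
        by (simp add: field_simps power2_eq_square power4_eq_xxxx)
      ultimately show ?thesis using True w by (simp add: energy_density_def)
    qed simp
  qed
  also have "\<dots> = 4 * (LINT w:F|lborel. (cmod (Q w))\<^sup>2 * (1 - (cmod w)\<^sup>2)\<^sup>2)"
    by (simp add: set_lebesgue_integral_def)
  finally show ?thesis by (simp add: ennreal_indicator)
qed

theorem theorem4p9:
  fixes \<Gamma> :: "(complex^2^2) set set"
    and Q :: "complex \<Rightarrow> complex"
    and a :: "nat \<Rightarrow> complex \<Rightarrow> complex"
    and j :: nat
  assumes "cofinite_fuchsian \<Gamma>"
    and "Q \<in> A_inf \<Gamma>"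
    and "\<And>w z. w \<in> unit_disc \<Longrightarrow> z \<in> unit_disc \<Longrightarrow>
           ((\<lambda>n. (of_nat n ^ 3 - of_nat n) * a n w * z ^ (n - 2)) has_sum pullback Q w z) {2..}"
    and "j \<ge> 2"
  shows "((\<lambda>r. enn2real (quotient_area \<Gamma>) * (LINT w:ball 0 r|hyp_area. (cmod (a j w))\<^sup>2)
               / measure hyp_area (ball 0 r))
          \<longlongrightarrow> 8 / (3 * (real j ^ 3 - real j)) * (WP_norm \<Gamma> Q)\<^sup>2) (at_left 1)"
proof -
  define F where "F = quotient_set \<Gamma>"
  have \<Gamma>: "fuchsian \<Gamma>" and fin: "emeasure hyp_area F < \<infinity>"
    using assms(1) by (auto simp: cofinite_fuchsian_def quotient_area_def F_def)
  have fund: "fundamental_set \<Gamma> F"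
    unfolding F_def quotient_set_def using fundamental_set_exists[OF \<Gamma>] by (rule someI_ex)
  have F_borel: "F \<in> sets borel" and FD: "F \<subseteq> unit_disc" using fund by (auto simp: fundamental_set_def)
  obtain C where f: "bounded_borel C (energy_density Q)"
    using bounded_borel_energy_density[OF assms(2)] by blast
  have C: "C \<ge> 0" using bounded_borel_bound[OF f, of 0] by linarith
  have area: "enn2real (quotient_area \<Gamma>) = measure hyp_area F"
    by (simp add: quotient_area_def F_def measure_def)
  have WP: "(\<integral>w. energy_density Q w \<partial>density hyp_area (indicator F)) = 16 * (WP_norm \<Gamma> Q)\<^sup>2"
  proof -
    have "0 \<le> (LINT w:F|lborel. (cmod (Q w))\<^sup>2 * (1 - (cmod w)\<^sup>2)\<^sup>2)"
      by (simp add: set_lebesgue_integral_def)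
    hence "(WP_norm \<Gamma> Q)\<^sup>2 = 1/4 * (LINT w:F|lborel. (cmod (Q w))\<^sup>2 * (1 - (cmod w)\<^sup>2)\<^sup>2)"
      by (simp add: WP_norm_def F_def)
    thus ?thesis by (simp add: integral_energy_density[OF F_borel FD f])
  qed
  define c where "c = real j ^ 3 - real j"
  define n where "n = j - 2"
  have j: "j = n + 2" using assms(4) by (simp add: n_def)
  have c: "c > 0" "real ((n + 3) choose 3) = c / 6"
  proof -
    \<comment> \<open>With j = n + 2 the product is (j + 1) j (j - 1) = j^3 - j.\<close>
    have "6 * ((n + 3) choose 3) = (n + 3) * (n + 2) * (n + 1)"
    proof -
      have "3 * ((n + 3) choose 3) = (n + 3) * ((n + 2) choose 2)"
        using Suc_times_binomial_eq[of "n + 2" 2] by (simp add: numeral_3_eq_3 mult.commute)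
      moreover have "2 * ((n + 2) choose 2) = (n + 2) * (n + 1)"
        using Suc_times_binomial_eq[of "n + 1" 1] by (simp add: numeral_2_eq_2 mult.commute)
      moreover have "6 * X = 2 * (3 * X)" "2 * (k * Y) = k * (2 * Y)" for k X Y :: nat
        by simp_all
      ultimately show ?thesis by (metis mult.assoc)
    qed
    hence "real (6 * ((n + 3) choose 3)) = real ((n + 3) * (n + 2) * (n + 1))" by (simp only:)
    hence "6 * real ((n + 3) choose 3) = (real n + 3) * (real n + 2) * (real n + 1)"
      unfolding of_nat_mult of_nat_add by simp
    moreover have "c = (real n + 3) * (real n + 2) * (real n + 1)"
      unfolding c_def j by (simp add: power3_eq_cube algebra_simps)
    ultimately show "real ((n + 3) choose 3) = c / 6" "c > 0" by simp_all
  qed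
  show ?thesis
  \<comment> \<open>Equidistribution divides by the area of the quotient; at area zero both sides of
    the limit vanish.\<close>
  proof (cases "emeasure hyp_area F = 0")
    case True
    have "AE w in density hyp_area (indicator F). energy_density Q w = 0"
    proof (subst AE_density)
      have "AE w in hyp_area. w \<notin> F" using True F_borel by (intro AE_not_in) auto
      thus "AE w in hyp_area. 0 < (indicator F w :: ennreal) \<longrightarrow> energy_density Q w = 0"
        by eventually_elim simp
    qed (use F_borel in simp)
    hence "(\<integral>w. energy_density Q w \<partial>density hyp_area (indicator F)) = 0"
      by (rule integral_eq_zero_AE)
    hence "(WP_norm \<Gamma> Q)\<^sup>2 = 0" using WP by simp
    moreover have "measure hyp_area F = 0" using True by (simp add: measure_def)
    ultimately show ?thesis by (simp add: area)
  next
    case False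
    interpret disc_quotient \<Gamma> psu_map "m_inv PSU11" F
      by (rule disc_quotient_fuchsian[OF \<Gamma> fund fin]) (use False in \<open>simp add: zero_less_iff_neq_zero\<close>)
    have f_inv: "invariant (energy_density Q)"
      unfolding invariant_def
    proof (intro ballI allI impI)
      fix g z assume g: "g \<in> \<Gamma>" and z: "cmod z < 1"
      obtain x y where xy: "cmod y < cmod x" "psu_map g = mob x y" using act_mob[OF g] by blast
      have "Q (psu_map g z) * (deriv (psu_map g) z)\<^sup>2 = Q z"
        using assms(2) g z by (auto simp: A_inf_def)
      thus "energy_density Q (psu_map g z) = energy_density Q z"
        unfolding xy(2) energy_density_mob[OF xy(1) z] using z by (simp add: energy_density_def)
    qed
    \<comment> \<open>The given expansion starts at index 2; after the shift, \<open>q m w\<close>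
      is the m-th Taylor coefficient of the pullback at w.\<close>
    define q where "q m w = (of_nat (m + 2) ^ 3 - of_nat (m + 2)) * a (m + 2) w" for m w
    have q_sum: "((\<lambda>m. q m w * z ^ m) has_sum pullback Q w z) UNIV" if "cmod w < 1" "cmod z < 1" for w z
    proof -
      have bij: "bij_betw (\<lambda>m::nat. m + 2) UNIV {2..}"
        by (rule bij_betwI[of _ _ _ "\<lambda>m. m - 2"]) auto
      have "((\<lambda>n. (of_nat n ^ 3 - of_nat n) * a n w * z ^ (n - 2)) has_sum pullback Q w z) {2..}"
        using assms(3)[of w z] that by simp
      thus ?thesis
        using has_sum_reindex_bij_betw[OF bij, of "\<lambda>n. (of_nat n ^ 3 - of_nat n) * a n w * z ^ (n - 2)" "pullback Q w z"]
        by (simp add: q_def)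
    qed
    define b where "b m w = (if cmod w < 1 then (cmod (q m w))\<^sup>2 else 0)" for m w
    have b_sums: "(\<lambda>m. b m w * \<rho> ^ (2 * m)) sums (avg (hyp_circle \<rho>) (energy_density Q) w / (1 - \<rho>\<^sup>2) ^ 4)"
      if w: "cmod w < 1" and \<rho>: "0 \<le> \<rho>" "\<rho> < 1" for w \<rho>
    proof -
      note [measurable] = bounded_borelD[OF f]
      define \<Phi> where "\<Phi> z = energy_density Q (disc_translation w z) / (1 - (cmod z)\<^sup>2) ^ 4" for z
      have [measurable]: "\<Phi> \<in> borel_measurable borel" unfolding \<Phi>_def by measurable
      have \<Phi>: "\<Phi> z = (cmod (pullback Q w z))\<^sup>2" if "cmod z < 1" for z
      proof -
        have "1 - (cmod z)\<^sup>2 > 0" using that by (simp add: abs_square_less_1)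
        thus ?thesis unfolding \<Phi>_def energy_density_disc_translation[OF w that] by simp
      qed
      have "(\<lambda>m. (cmod (q m w))\<^sup>2 * \<rho> ^ (2 * m)) sums (\<integral>u. \<Phi> (u * of_real \<rho>) \<partial>circle_measure)"
        by (rule parseval_circle_measure[OF q_sum[OF w] \<Phi> _ \<rho>]) auto
      also have "(\<integral>u. \<Phi> (u * of_real \<rho>) \<partial>circle_measure)
        = (\<integral>u. energy_density Q (disc_translation w (u * of_real \<rho>)) / (1 - \<rho>\<^sup>2) ^ 4 \<partial>circle_measure)"
      proof (rule integral_cong_AE)
        show "AE u in circle_measure. \<Phi> (u * of_real \<rho>) = energy_density Q (disc_translation w (u * of_real \<rho>)) / (1 - \<rho>\<^sup>2) ^ 4"
          using AE_circle_measure by eventually_elim (use \<rho> in \<open>simp add: \<Phi>_def norm_mult\<close>)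
      qed measurable
      also have "\<dots> = avg (hyp_circle \<rho>) (energy_density Q) w / (1 - \<rho>\<^sup>2) ^ 4"
        by (simp add: avg_hyp_circle)
      finally show ?thesis using w by (simp add: b_def)
    qed
    \<comment> \<open>One nonnegative term of the series at \<rho> = 1/2, where \<rho>^(2 m) =
      4^(-m), is at most the sum, itself at most (4/3)^4 C \<le> 4 C.\<close>
    have b_bound: "b m w \<le> 4 * C * 4 ^ m" for m w
    proof (cases "cmod w < 1")
      case True
      note s = b_sums[OF True, of "1/2"]
      have "(\<Sum>i\<in>{m}. b i w * (1/2) ^ (2 * i)) \<le> (\<Sum>i. b i w * (1/2) ^ (2 * i))"
        by (rule sum_le_suminf) (use s in \<open>auto simp: sums_iff b_def\<close>)
      also have "\<dots> = avg (hyp_circle (1/2)) (energy_density Q) w / (1 - (1/2)\<^sup>2) ^ 4"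
        using s by (simp add: sums_iff)
      also have "\<dots> \<le> C / (1 - (1/2)\<^sup>2) ^ 4"
        using bounded_avg_hyp_circle[OF f, of "1/2" w] by (intro divide_right_mono) auto
      also have "\<dots> \<le> 4 * C" using C by (simp add: power2_eq_square power4_eq_xxxx)
      finally have "b m w * (1/4) ^ m \<le> 4 * C" by (simp add: power_mult power2_eq_square)
      hence "b m w * (1/4) ^ m * 4 ^ m \<le> 4 * C * 4 ^ m" by (intro mult_right_mono) auto
      moreover have "b m w * (1/4) ^ m * 4 ^ m = b m w" by (simp add: mult.assoc flip: power_mult_distrib)
      ultimately show ?thesis by simp
    qed (use C in \<open>simp add: b_def\<close>)
    have q_bound: "cmod (q m w) \<le> 2 * sqrt C * 2 ^ m" if "cmod w < 1" for m w
    proof (rule power2_le_imp_le)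
      have "(2 * sqrt C * 2 ^ m)\<^sup>2 = 4 * C * 4 ^ m"
        using C by (simp add: power_mult_distrib flip: power_mult) (simp add: mult.commute[of m] power_mult)
      thus "(cmod (q m w))\<^sup>2 \<le> (2 * sqrt C * 2 ^ m)\<^sup>2" using b_bound[of m w] that by (simp add: b_def)
    qed (use C in simp)
    have uc: "hyp_uniformly_continuous (energy_density Q)"
      by (rule hyp_uniformly_continuous_energy_density[OF q_sum q_bound])
    have b_meas: "b n \<in> borel_measurable borel"
      and lim: "((\<lambda>r. \<integral>w. b n w \<partial>hyp_disc r) \<longlongrightarrow> (\<integral>w. energy_density Q w \<partial>quot) / measure hyp_area F * real ((n + 3) choose 3)) (at_left 1)"
      by (rule coefficient_equidistribution[OF f energy_density_nonneg f_inv uc _ _ b_bound b_sums]; simp add: b_def)+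
    have mF: "measure hyp_area F > 0"
      using F_pos F_finite by (simp add: measure_def enn2real_positive_iff)
    have "((\<lambda>r. measure hyp_area F / c\<^sup>2 * (\<integral>w. b n w \<partial>hyp_disc r))
      \<longlongrightarrow> measure hyp_area F / c\<^sup>2 * ((\<integral>w. energy_density Q w \<partial>quot) / measure hyp_area F * real ((n + 3) choose 3))) (at_left 1)"
      by (intro tendsto_mult tendsto_const lim)
    \<comment> \<open>The area cancels, and 16 (c / 6) / c^2 = 8 / (3 c).\<close>
    also have "measure hyp_area F / c\<^sup>2 * ((\<integral>w. energy_density Q w \<partial>quot) / measure hyp_area F * real ((n + 3) choose 3))
      = 8 / (3 * c) * (WP_norm \<Gamma> Q)\<^sup>2"
      unfolding quot_def WP c(2) using mF c(1) by (simp add: power2_eq_square)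
    finally have lim': "((\<lambda>r. measure hyp_area F / c\<^sup>2 * (\<integral>w. b n w \<partial>hyp_disc r)) \<longlongrightarrow> 8 / (3 * c) * (WP_norm \<Gamma> Q)\<^sup>2) (at_left 1)" .
    have ev: "\<forall>\<^sub>F r in at_left (1::real). r \<in> {0<..<1}" by (rule eventually_at_left_real) simp
    show ?thesis unfolding c_def[symmetric] area
    proof (rule Lim_transform_eventually[OF lim'])
      from ev show "\<forall>\<^sub>F r in at_left 1. measure hyp_area F / c\<^sup>2 * (\<integral>w. b n w \<partial>hyp_disc r)
        = measure hyp_area F * (LINT w:ball 0 r|hyp_area. (cmod (a j w))\<^sup>2) / measure hyp_area (ball 0 r)"
      proof eventually_elim
        case (elim r)
        have bn: "b n w = c\<^sup>2 * (cmod (a j w))\<^sup>2" if "cmod w < 1" for w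
        proof -
          have "q n w = of_real c * a j w" by (simp add: q_def c_def j)
          thus ?thesis using that by (simp add: b_def norm_mult power_mult_distrib)
        qed
        have "(LINT w:ball 0 r|hyp_area. b n w) = (\<integral>w. c\<^sup>2 * (indicator (ball 0 r) w *\<^sub>R (cmod (a j w))\<^sup>2) \<partial>hyp_area)"
          unfolding set_lebesgue_integral_def
          by (rule Bochner_Integration.integral_cong) (use elim bn in \<open>auto simp: indicator_def\<close>)
        also have "\<dots> = c\<^sup>2 * (LINT w:ball 0 r|hyp_area. (cmod (a j w))\<^sup>2)"
          by (simp add: set_lebesgue_integral_def)
        finally show ?case using elim c(1) by (simp add: integral_hyp_disc b_meas)
      qed
    qed
  qed
qed

end
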